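(* Let $g\ge 1$ be an integer. Let $m^{\mathrm{skew}}_{2g}$ denote the smallest spectral radius $>1$ among all primitive skew-reciprocal matrices $A\in\mathrm{GL}_{2g}(\mathbb{Z})$, and let $m^{\mathrm{rec}}_{2g}$ denote the smallest spectral radius $>1$ among all primitive reciprocal matrices $A\in\mathrm{GL}_{2g}(\mathbb{Z})$. If $g\neq 3$, then $m^{\mathrm{skew}}_{2g}<m^{\mathrm{rec}}_{2g}$. If $g=3$, then $m^{\mathrm{rec}}_{6}<m^{\mathrm{skew}}_{6}$.
   Context: A matrix is nonnegative if all its coefficients are nonnegative. A nonnegative square matrix is primitive if some power of it has strictly positive coefficients. A matrix is reciprocal if the set of its eigenvalues, counted with multiplicity, is invariant under the transformation $t\mapsto t^{-1}$. A matrix is skew-reciprocal if the set of its eigenvalues, counted with multiplicity, is invariant under the transformation $t\mapsto -t^{-1}$. The spectral radius of a matrix is the maximal modulus of its eigenvalues. *)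

theory Defs
  imports "Jordan_Normal_Form.Spectral_Radius"
begin

definition nonneg_mat :: "'a :: linordered_idom mat \<Rightarrow> bool" where
  "nonneg_mat A \<longleftrightarrow> (\<forall>i < dim_row A. \<forall>j < dim_col A. A $$ (i, j) \<ge> 0)"

definition pos_mat :: "'a :: linordered_idom mat \<Rightarrow> bool" where
  "pos_mat A \<longleftrightarrow> (\<forall>i < dim_row A. \<forall>j < dim_col A. A $$ (i, j) > 0)"

definition primitive_mat :: "'a :: linordered_idom mat \<Rightarrow> bool" where
  "primitive_mat A \<longleftrightarrow> square_mat A \<and> nonneg_mat A \<and> (\<exists>k \<ge> 1. pos_mat (A ^\<^sub>m k))"

(* Algebraic multiplicities. *)
definition eigenvalue_mset :: "complex mat \<Rightarrow> complex multiset" where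
  "eigenvalue_mset A = proots (char_poly A)"

(* The condition on 0 excludes the convention inverse 0 = 0: the maps t \<mapsto> 1/t and
   t \<mapsto> -1/t are only meant for nonzero t. *)
definition reciprocal_mat :: "complex mat \<Rightarrow> bool" where
  "reciprocal_mat A \<longleftrightarrow> square_mat A \<and> 0 \<notin># eigenvalue_mset A \<and>
     image_mset (\<lambda>t. inverse t) (eigenvalue_mset A) = eigenvalue_mset A"

definition skew_reciprocal_mat :: "complex mat \<Rightarrow> bool" where
  "skew_reciprocal_mat A \<longleftrightarrow> square_mat A \<and> 0 \<notin># eigenvalue_mset A \<and>
     image_mset (\<lambda>t. - inverse t) (eigenvalue_mset A) = eigenvalue_mset A"

(* Invertibility is meant over the integers: the inverse is again an integer matrix. *)
definition GL_int :: "nat \<Rightarrow> int mat set" where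
  "GL_int n = {A \<in> carrier_mat n n. invertible_mat A}"

abbreviation complex_mat :: "int mat \<Rightarrow> complex mat" where
  "complex_mat \<equiv> map_mat of_int"

definition skew_radii :: "nat \<Rightarrow> real set" where
  "skew_radii n = {spectral_radius (complex_mat A) | A. A \<in> GL_int n \<and> primitive_mat A \<and>
     skew_reciprocal_mat (complex_mat A) \<and> spectral_radius (complex_mat A) > 1}"

definition rec_radii :: "nat \<Rightarrow> real set" where
  "rec_radii n = {spectral_radius (complex_mat A) | A. A \<in> GL_int n \<and> primitive_mat A \<and>
     reciprocal_mat (complex_mat A) \<and> spectral_radius (complex_mat A) > 1}"

definition m_skew :: "nat \<Rightarrow> real" where
  "m_skew n = (LEAST r. r \<in> skew_radii n)"

definition m_rec :: "nat \<Rightarrow> real" where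
  "m_rec n = (LEAST r. r \<in> rec_radii n)"

end

theory Submission
  imports Defs "HOL-Computational_Algebra.Polynomial_FPS" "HOL-Number_Theory.Cong"
begin

text \<open>For a nonnegative integer matrix \<open>A\<close>, the polynomial \<open>det (1 - t A)\<close> is the signed sum of
  \<open>t ^ (total length)\<close> over the families of pairwise disjoint cycles of the digraph of \<open>A\<close>, which is McMullen's
  clique polynomial. It is positive on \<open>[0, 1 / \<rho>)\<close>, where \<open>\<rho>\<close> is the spectral radius, and then so is the same
  sum over any subset of the cycles. Let \<open>\<phi>\<close> be the golden ratio and suppose that a primitive matrix of size \<open>2 g\<close>
  has \<open>\<rho> ^ g < \<phi>\<^sup>2\<close>. Disjoint cycles have total length at most \<open>2 g\<close>, so at \<open>t = \<phi> powr (- 2 / g)\<close> their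
  product of monomials is at least \<open>\<phi> powr (- 4)\<close>. Testing four or five cycles at a time, positivity leaves only
  digraphs without disjoint cycles and digraphs with three or four cycles and one or two disjoint pairs. For a
  reciprocal matrix the first kind has spectral radius 1, and for the second kind reciprocity makes
  \<open>det (1 - t A) \<le> 0\<close> at this point. Hence \<open>\<rho> ^ g \<ge> \<phi>\<^sup>2\<close> in the reciprocal case, with equality only
  for the polynomial \<open>1 - 3 t ^ g + t ^ (2 g)\<close>.

  On the skew-reciprocal side, the largest root \<open>\<lambda>\<close> of \<open>X ^ (2 g) - X ^ (g + k) - X ^ (g - k) - 1\<close>, where
  \<open>k = 1\<close> for even and \<open>k = 2\<close> for odd \<open>g\<close>, satisfies \<open>\<lambda> ^ g < \<phi>\<^sup>2\<close> as soon as \<open>2 k < g\<close>; for \<open>g = 2\<close> there is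
  equality, but the reciprocal bound is then strict because the trace of every odd power would vanish.
  For \<open>g = 3\<close>, bounds for the traces of the powers leave finitely many skew-reciprocal
  polynomials with \<open>\<rho> < 1.41\<close>, all of them imprimitive, whereas the reciprocal minimum is at most \<open>1.405\<close>.\<close>

section \<open>Determinants and closed walks\<close>

text \<open>The threshold \<open>(3 + sqrt 5) / 2\<close> is the larger root of
  \<open>X^2 - 3 X + 1\<close>, so \<open>X^(2 g) - 3 X^g + 1\<close> vanishes exactly at the
  critical radius. No inequality can exclude this polynomial, hence the reciprocal argument admits
  equality: positivity is known only to the left of the test point, becomes \<open>\<ge> 0\<close>
  at the point itself by continuity, and the estimates then leave a contradiction or this one
  polynomial. Perron-Frobenius theory is avoided: the determinant is 1 at \<open>t = 0\<close>, and
  a later zero would be the inverse of a real eigenvalue exceeding the spectral radius. Passing to a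
  few cycles is essential because their number is not bounded in advance. On the skew-reciprocal
  side \<open>k\<close> must have parity opposite to \<open>g\<close>, so an odd \<open>g\<close>
  needs \<open>k \<ge> 2\<close>; the comparison with the threshold needs
  \<open>2 k \<le> g\<close>, which is what fails at \<open>g = 3\<close>. For \<open>g = 1\<close>
  the polynomial \<open>X^2 - X - 1\<close> serves instead. The minima exist because a bound on the
  spectral radius leaves finitely many integer characteristic polynomials.\<close>

definition pdet :: "('a \<Rightarrow> 'a \<Rightarrow> 'b::comm_ring_1) \<Rightarrow> 'a set \<Rightarrow> 'b" where
  "pdet M S = (\<Sum>\<sigma> | \<sigma> permutes S. of_int (sign \<sigma>) * (\<Prod>i\<in>S. M i (\<sigma> i)))"

text \<open>The determinant with rows \<open>f\<close>, \<open>S\<close> and columns \<open>v\<close>, \<open>S\<close>: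
  expanding its first row extends a path from \<open>f\<close> to \<open>v\<close> by one step.\<close>

definition path_det :: "('a \<Rightarrow> 'a \<Rightarrow> 'b::comm_ring_1) \<Rightarrow> 'a \<Rightarrow> 'a \<Rightarrow> 'a set \<Rightarrow> 'b" where
  "path_det M v f S = (\<Sum>\<sigma> | \<sigma> permutes insert v S. of_int (sign \<sigma>) * (M f (\<sigma> v) * (\<Prod>i\<in>S. M i (\<sigma> i))))"

lemma pdet_empty [simp]: "pdet M {} = 1"
  by (simp add: pdet_def)

lemma pdet_cong:
  assumes "\<And>i j. i \<in> S \<Longrightarrow> j \<in> S \<Longrightarrow> M i j = M' i j"
  shows "pdet M S = pdet M' S"
  unfolding pdet_def
proof (rule sum.cong[OF refl])
  fix \<sigma> assume "\<sigma> \<in> {\<sigma>. \<sigma> permutes S}"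
  then have "(\<Prod>i\<in>S. M i (\<sigma> i)) = (\<Prod>i\<in>S. M' i (\<sigma> i))"
    using assms by (intro prod.cong) (auto simp: permutes_in_image)
  then show "of_int (sign \<sigma>) * (\<Prod>i\<in>S. M i (\<sigma> i)) = of_int (sign \<sigma>) * (\<Prod>i\<in>S. M' i (\<sigma> i))"
    by simp
qed

lemma pdet_insert:
  assumes "finite S" "v \<notin> S"
  shows "pdet M (insert v S) = path_det M v v S"
  using assms by (simp add: pdet_def path_det_def)

text \<open>Permutations are grouped by the column used in row \<open>f\<close>. If it is some
  \<open>b\<close> in \<open>S\<close>, composing with the transposition of \<open>v\<close> and
  \<open>b\<close> makes \<open>b\<close> a fixed point, flips the sign, and leaves row
  \<open>b\<close> in the place of row \<open>f\<close>: the path has moved from \<open>f\<close> to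
  \<open>b\<close>.\<close>

lemma path_det_step:
  assumes S: "finite S" "v \<notin> S"
  shows "path_det M v f S = M f v * pdet M S - (\<Sum>b\<in>S. M f b * path_det M v b (S - {b}))"
proof -
  let ?P = "{\<sigma>. \<sigma> permutes insert v S}"
  let ?F = "\<lambda>\<sigma>. of_int (sign \<sigma>) * (M f (\<sigma> v) * (\<Prod>i\<in>S. M i (\<sigma> i)))"
  have fin: "finite ?P" using S by (simp add: finite_permutations)
  have "path_det M v f S = (\<Sum>b\<in>insert v S. \<Sum>\<sigma> | \<sigma> \<in> ?P \<and> \<sigma> v = b. ?F \<sigma>)"
    unfolding path_det_def
    by (rule sum.group[symmetric]) (use S fin in \<open>auto dest: permutes_in_image[of _ _ v]\<close>)
  also have "\<dots> = (\<Sum>\<sigma> | \<sigma> \<in> ?P \<and> \<sigma> v = v. ?F \<sigma>) + (\<Sum>b\<in>S. \<Sum>\<sigma> | \<sigma> \<in> ?P \<and> \<sigma> v = b. ?F \<sigma>)"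
    using S by simp
  also have "(\<Sum>\<sigma> | \<sigma> \<in> ?P \<and> \<sigma> v = v. ?F \<sigma>) = M f v * pdet M S"
  proof -
    have "{\<sigma>. \<sigma> \<in> ?P \<and> \<sigma> v = v} = {\<sigma>. \<sigma> permutes S}"
      using S permutes_superset[of _ "insert v S" S] permutes_subset[of _ S "insert v S"]
      by (auto simp: permutes_def)
    then show ?thesis
      by (auto simp: pdet_def sum_distrib_left ac_simps intro!: sum.cong simp: permutes_not_in[OF _ S(2)])
  qed
  also have "(\<Sum>b\<in>S. \<Sum>\<sigma> | \<sigma> \<in> ?P \<and> \<sigma> v = b. ?F \<sigma>)
      = (\<Sum>b\<in>S. - (M f b * path_det M v b (S - {b})))"
  proof (rule sum.cong[OF refl])
    fix b assume b: "b \<in> S"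
    then have bv: "b \<noteq> v" using S by auto
    let ?Pb = "{\<tau>. \<tau> permutes insert v (S - {b})}"
    let ?t = "Transposition.transpose v b"
    have swap: "?t permutes insert v S"
      using b by (auto intro: permutes_swap_id)
    have b1: "bij_betw (\<lambda>\<tau>. \<tau> \<circ> ?t) ?Pb {\<sigma>. \<sigma> \<in> ?P \<and> \<sigma> v = b}"
    proof (rule bij_betwI[where g = "\<lambda>\<sigma>. \<sigma> \<circ> ?t"])
      show "(\<lambda>\<tau>. \<tau> \<circ> ?t) \<in> ?Pb \<rightarrow> {\<sigma>. \<sigma> \<in> ?P \<and> \<sigma> v = b}"
      proof
        fix \<tau> assume "\<tau> \<in> ?Pb"
        then have t: "\<tau> permutes insert v (S - {b})" by simp
        then have "\<tau> permutes insert v S" by (rule permutes_subset) auto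
        moreover have "\<tau> b = b" using t bv by (intro permutes_not_in[OF t]) auto
        ultimately show "\<tau> \<circ> ?t \<in> {\<sigma>. \<sigma> \<in> ?P \<and> \<sigma> v = b}"
          using permutes_compose[OF swap] by simp
      qed
      show "(\<lambda>\<sigma>. \<sigma> \<circ> ?t) \<in> {\<sigma>. \<sigma> \<in> ?P \<and> \<sigma> v = b} \<rightarrow> ?Pb"
      proof
        fix \<sigma> assume "\<sigma> \<in> {\<sigma>. \<sigma> \<in> ?P \<and> \<sigma> v = b}"
        then have s: "\<sigma> permutes insert v S" "\<sigma> v = b" by auto
        have "\<sigma> \<circ> ?t permutes insert v S" using permutes_compose[OF swap s(1)] .
        then show "\<sigma> \<circ> ?t \<in> ?Pb" using s(2) b bv
          by (auto intro!: permutes_superset[of _ "insert v S"])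
      qed
    qed (auto simp: fun_eq_iff)
    have "(\<Sum>\<sigma> | \<sigma> \<in> ?P \<and> \<sigma> v = b. ?F \<sigma>) = (\<Sum>\<tau>\<in>?Pb. ?F (\<tau> \<circ> ?t))"
      by (rule sum.reindex_bij_betw[OF b1, symmetric])
    also have "\<dots> = (\<Sum>\<tau>\<in>?Pb. - (M f b * (of_int (sign \<tau>) * (M b (\<tau> v) * (\<Prod>i\<in>S-{b}. M i (\<tau> i))))))"
    proof (rule sum.cong[OF refl])
      fix \<tau> assume "\<tau> \<in> ?Pb"
      then have t: "\<tau> permutes insert v (S - {b})" by simp
      have tb: "\<tau> b = b" using t bv by (intro permutes_not_in[OF t]) auto
      have pt: "permutation \<tau>" unfolding permutation_permutes using t S
        by (intro exI[of _ "insert v (S - {b})"]) auto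
      have sg: "sign (\<tau> \<circ> ?t) = - sign \<tau>"
        using bv by (subst sign_compose[OF pt permutation_swap_id]) (simp add: sign_swap_id)
      have "(\<Prod>i\<in>S. M i ((\<tau> \<circ> ?t) i)) = M b (\<tau> v) * (\<Prod>i\<in>S-{b}. M i ((\<tau> \<circ> ?t) i))"
        using b S by (simp add: prod.remove)
      also have "(\<Prod>i\<in>S-{b}. M i ((\<tau> \<circ> ?t) i)) = (\<Prod>i\<in>S-{b}. M i (\<tau> i))"
        using S by (intro prod.cong) (auto simp: Transposition.transpose_def)
      finally show "?F (\<tau> \<circ> ?t) = - (M f b * (of_int (sign \<tau>) * (M b (\<tau> v) * (\<Prod>i\<in>S-{b}. M i (\<tau> i)))))"
        unfolding sg by (simp add: tb ac_simps)
    qed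
    also have "\<dots> = - (M f b * path_det M v b (S - {b}))"
      by (simp add: path_det_def sum_distrib_left sum_negf)
    finally show "(\<Sum>\<sigma> | \<sigma> \<in> ?P \<and> \<sigma> v = b. ?F \<sigma>) = - (M f b * path_det M v b (S - {b}))" .
  qed
  finally show ?thesis by (simp add: sum_negf)
qed

lemma det_eq_pdet:
  assumes "A \<in> carrier_mat n n"
  shows "det A = pdet (\<lambda>i j. A $$ (i, j)) {0..<n}"
  using det_def'[OF assms] by (simp add: pdet_def)

section \<open>Simple paths and their weights\<close>

fun walk_weight :: "('a \<Rightarrow> 'a \<Rightarrow> nat) \<Rightarrow> 'a \<Rightarrow> 'a list \<Rightarrow> 'a \<Rightarrow> nat" where
  "walk_weight a f [] v = a f v"
| "walk_weight a f (x # xs) v = a f x * walk_weight a x xs v"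

definition dlists :: "'a set \<Rightarrow> 'a list set" where
  "dlists S = {xs. distinct xs \<and> set xs \<subseteq> S}"

lemma finite_dlists [simp]: "finite S \<Longrightarrow> finite (dlists S)"
  unfolding dlists_def using finite_subset_distinct[of S]
  by (metis (no_types, lifting) Collect_cong conj_commute)

lemma dlists_step: "dlists S = insert [] (\<Union>b\<in>S. (#) b ` dlists (S - {b}))"
proof (intro equalityI subsetI)
  fix xs assume "xs \<in> dlists S" 
  then show "xs \<in> insert [] (\<Union>b\<in>S. (#) b ` dlists (S - {b}))"
    by (cases xs) (auto simp: dlists_def)
qed (auto simp: dlists_def)

lemma sum_dlists_step:
  assumes "finite S"
  shows "(\<Sum>xs\<in>dlists S. F xs) = F [] + (\<Sum>b\<in>S. \<Sum>xs\<in>dlists (S - {b}). F (b # xs))"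
proof -
  have "(\<Sum>xs\<in>dlists S. F xs) = F [] + (\<Sum>xs\<in>(\<Union>b\<in>S. (#) b ` dlists (S - {b})). F xs)"
    by (subst dlists_step, subst sum.insert) (use assms in auto)
  also have "(\<Sum>xs\<in>(\<Union>b\<in>S. (#) b ` dlists (S - {b})). F xs)
     = (\<Sum>b\<in>S. \<Sum>xs\<in>(#) b ` dlists (S - {b}). F xs)"
    by (rule sum.UNION_disjoint) (use assms in auto)
  also have "\<dots> = (\<Sum>b\<in>S. \<Sum>xs\<in>dlists (S - {b}). F (b # xs))"
    by (intro sum.cong refl sum.reindex[unfolded o_def]) (auto simp: inj_on_def)
  finally show ?thesis .
qed

definition walk_mat :: "('a \<Rightarrow> 'a \<Rightarrow> nat) \<Rightarrow> real \<Rightarrow> 'a \<Rightarrow> 'a \<Rightarrow> real" where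
  "walk_mat a t i j = (if i = j then 1 else 0) - t * real (a i j)"

text \<open>Iterating \<open>path_det_step\<close> runs through the simple paths from
  \<open>f\<close> to \<open>v\<close>. At each inner arc the minus sign of the expansion cancels
  that of the entry \<open>- t * a\<close>, so every path contributes with the single sign of its
  last arc. The diagonal 1 is seen only if \<open>f = v\<close>.\<close>

lemma path_det_walk:
  assumes "finite S" "v \<notin> S" "f \<notin> S"
  shows "path_det (walk_mat a t) v f S = (if f = v then pdet (walk_mat a t) S else 0)
    - (\<Sum>xs\<in>dlists S. t ^ Suc (length xs) * real (walk_weight a f xs v) * pdet (walk_mat a t) (S - set xs))"
  using assms
proof (induction "card S" arbitrary: S f rule: less_induct)
  case less
  let ?M = "walk_mat a t"
  have IH: "path_det ?M v b (S - {b}) = 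
     - (\<Sum>xs\<in>dlists (S - {b}). t ^ Suc (length xs) * real (walk_weight a b xs v) * pdet ?M (S - {b} - set xs))"
    if "b \<in> S" for b
  proof -
    have "card (S - {b}) < card S" using that less.prems(1) by (meson card_Diff1_less)
    moreover have "b \<noteq> v" using that less.prems by auto
    ultimately show ?thesis using less.hyps[of "S - {b}" b] less.prems by auto
  qed
  have Mb: "?M f b = - t * real (a f b)" if "b \<in> S" for b
    using that less.prems by (auto simp: walk_mat_def)
  have d: "S - insert b (set xs) = S - {b} - set xs" for b xs by auto
  have "path_det ?M v f S = ?M f v * pdet ?M S - (\<Sum>b\<in>S. t * real (a f b) *
     (\<Sum>xs\<in>dlists (S - {b}). t ^ Suc (length xs) * real (walk_weight a b xs v) * pdet ?M (S - {b} - set xs)))"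
    using path_det_step[OF less.prems(1,2), of ?M f] IH Mb by simp
  also have "\<dots> = (if f = v then pdet ?M S else 0) - (\<Sum>xs\<in>dlists S. t ^ Suc (length xs) * real (walk_weight a f xs v) * pdet ?M (S - set xs))"
    by (subst sum_dlists_step[OF less.prems(1)])
      (simp add: walk_mat_def d sum_distrib_left algebra_simps)
  finally show ?case .
qed

lemma pdet_walk_insert:
  assumes "finite S" "v \<notin> S"
  shows "pdet (walk_mat a t) (insert v S) = pdet (walk_mat a t) S
    - (\<Sum>xs\<in>dlists S. t ^ Suc (length xs) * real (walk_weight a v xs v) * pdet (walk_mat a t) (S - set xs))"
  using pdet_insert[OF assms, of "walk_mat a t"] path_det_walk[OF assms assms(2), of a t] by simp

section \<open>Clique polynomials\<close>

text \<open>This is the independence polynomial, at the weights \<open>- z\<close>, of the graph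
  joining the pairs that are not related by \<open>R\<close>. For cycles and disjointness that is
  the graph of meeting cycles.\<close>

definition clique_poly :: "('c \<Rightarrow> 'c \<Rightarrow> bool) \<Rightarrow> ('c \<Rightarrow> real) \<Rightarrow> 'c set \<Rightarrow> real" where
  "clique_poly R z U = (\<Sum>K | K \<subseteq> U \<and> pairwise R K. \<Prod>C\<in>K. - z C)"

lemma clique_poly_empty [simp]: "clique_poly R z {} = 1"
proof -
  have "{K. K \<subseteq> {} \<and> pairwise R K} = {{}}" by auto
  then show ?thesis by (simp add: clique_poly_def)
qed

lemma clique_poly_insert:
  assumes R: "symp R" and U: "finite U" and C: "C \<notin> U"
  shows "clique_poly R z (insert C U) = clique_poly R z U - z C * clique_poly R z {D \<in> U. R C D}"
proof -
  let ?K = "\<lambda>U. {K. K \<subseteq> U \<and> pairwise R K}"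
  let ?V = "{D \<in> U. R C D}"
  have fin: "finite (?K W)" if "finite W" for W
    using that by simp
  have split: "?K (insert C U) = ?K U \<union> insert C ` ?K ?V"
  proof (intro equalityI subsetI)
    fix K assume K: "K \<in> ?K (insert C U)"
    show "K \<in> ?K U \<union> insert C ` ?K ?V"
    proof (cases "C \<in> K")
      case True
      then have "K = insert C (K - {C})" by auto
      moreover have "K - {C} \<in> ?K ?V" using K True C
        by (auto simp: pairwise_def)
      ultimately show ?thesis by blast
    qed (use K in auto)
  next
    fix K assume "K \<in> ?K U \<union> insert C ` ?K ?V"
    then show "K \<in> ?K (insert C U)"
      using R by (auto simp: pairwise_def symp_def subset_iff)
  qed
  have "clique_poly R z (insert C U) = clique_poly R z U + (\<Sum>K\<in>insert C ` ?K ?V. \<Prod>C\<in>K. - z C)"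
    unfolding clique_poly_def split
    by (rule sum.union_disjoint) (use C U fin in auto)
  also have "(\<Sum>K\<in>insert C ` ?K ?V. \<Prod>C\<in>K. - z C) = (\<Sum>K\<in>?K ?V. \<Prod>C\<in>insert C K. - z C)"
    using C by (intro sum.reindex[unfolded o_def] inj_onI) (auto dest!: insert_ident[THEN iffD1, rotated 2])
  also have "\<dots> = (\<Sum>K\<in>?K ?V. - z C * (\<Prod>C\<in>K. - z C))"
    using C U by (intro sum.cong refl prod.insert) (auto intro: finite_subset)
  also have "\<dots> = - z C * clique_poly R z ?V"
    unfolding clique_poly_def by (rule sum_distrib_left[symmetric])
  finally show ?thesis by simp
qed

text \<open>A clique contains at most one of several mutually unrelated elements, so their deletions
  simply add up. In the application \<open>N\<close> consists of the cycles through one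
  vertex.\<close>

lemma clique_poly_Un:
  assumes R: "symp R" and fin: "finite N" "finite U" and dj: "N \<inter> U = {}"
    and N: "\<And>C D. C \<in> N \<Longrightarrow> D \<in> N \<Longrightarrow> \<not> R C D"
  shows "clique_poly R z (N \<union> U) = clique_poly R z U - (\<Sum>C\<in>N. z C * clique_poly R z {D \<in> U. R C D})"
  using fin(1) dj N
proof (induction N rule: finite_induct)
  case (insert C N)
  have "{D \<in> N \<union> U. R C D} = {D \<in> U. R C D}" using insert.prems by auto
  moreover have "clique_poly R z (insert C (N \<union> U)) = clique_poly R z (N \<union> U) - z C * clique_poly R z {D \<in> N \<union> U. R C D}"
    using insert fin by (intro clique_poly_insert[OF R]) auto
  ultimately show ?case using insert by simp
qed simp

lemma clique_poly_eq_1 [simp]: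
  assumes "finite U" "\<And>C. C \<in> U \<Longrightarrow> z C = 0"
  shows "clique_poly R z U = 1"
proof -
  have "(\<Sum>K | K \<subseteq> U \<and> pairwise R K. \<Prod>C\<in>K. - z C) = (\<Sum>K\<in>{{}}. \<Prod>C\<in>K. - z C)"
  proof (rule sum.mono_neutral_right)
    show "\<forall>K\<in>{K. K \<subseteq> U \<and> pairwise R K} - {{}}. (\<Prod>C\<in>K. - z C) = 0"
    proof
      fix K assume K: "K \<in> {K. K \<subseteq> U \<and> pairwise R K} - {{}}"
      then obtain C where "C \<in> K" by auto
      moreover have "finite K" using K assms(1) by (auto intro: finite_subset)
      ultimately show "(\<Prod>C\<in>K. - z C) = 0" using assms(2) K by (intro prod_zero) auto
    qed
  qed (use assms(1) in auto)
  then show ?thesis by (simp add: clique_poly_def)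
qed

lemma continuous_on_clique_poly:
  assumes "\<And>C. continuous_on S (\<lambda>s. z s C)"
  shows "continuous_on S (\<lambda>s. clique_poly R (z s) U)"
  unfolding clique_poly_def using assms by (intro continuous_intros)

lemma nonneg_at_right_end:
  fixes g :: "real \<Rightarrow> real"
  assumes "continuous_on {0..t} g" "0 \<le> t" "\<And>s. 0 \<le> s \<Longrightarrow> s < t \<Longrightarrow> g s > 0" "g 0 > 0"
  shows "g t \<ge> 0"
proof (rule ccontr)
  assume neg: "\<not> g t \<ge> 0"
  then obtain s where "0 \<le> s" "s \<le> t" "g s = 0"
    using IVT2'[of g t 0 0] assms(1,2,4) by auto
  then show False using assms(3)[of s] neg by (cases "s = t") auto
qed

text \<open>The idea is Shearer's: deleting \<open>C\<close> from \<open>U\<close> changes the polynomial by \<open>z C\<close> times that of the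
  neighbours of \<open>C\<close>. At a first zero after the deletion the latter is still nonnegative by induction,
  so the polynomial of \<open>U\<close> itself could not be positive there.\<close>

lemma clique_poly_pos_subset:
  fixes z :: "real \<Rightarrow> 'c \<Rightarrow> real"
  assumes "symp R" "finite U" "U' \<subseteq> U"
    and "\<And>C. continuous_on {0..t} (\<lambda>s. z s C)"
    and "\<And>s C. s \<in> {0..t} \<Longrightarrow> z s C \<ge> 0" and "\<And>C. z 0 C = 0"
    and "\<And>s. s \<in> {0..t} \<Longrightarrow> clique_poly R (z s) U > 0" and "s \<in> {0..t}"
  shows "clique_poly R (z s) U' > 0"
  using assms(2-)
proof (induction "card U" arbitrary: U U' t s rule: less_induct)
  case less
  note R = assms(1)
  show ?case
  proof (cases "U' = U")
    case True
    then show ?thesis using less.prems by simp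
  next
    case False
    then obtain C where C: "C \<in> U" "C \<notin> U'" using less.prems by auto
    define W where "W = U - {C}"
    have UW: "U = insert C W" "C \<notin> W" "finite W" "U' \<subseteq> W" "card W < card U"
      using C less.prems card_Diff1_less[of U C] by (auto simp: W_def)
    let ?X = "{D \<in> W. R C D}"
    define f g where "f s = clique_poly R (z s) W" and "g s = clique_poly R (z s) ?X" for s
    have fg: "clique_poly R (z s) U = f s - z s C * g s" for s
      unfolding UW(1) f_def g_def by (rule clique_poly_insert[OF R UW(3,2)])
    have cf: "continuous_on {0..t} f" and cg: "continuous_on {0..t} g"
      unfolding f_def g_def using less.prems by (intro continuous_on_clique_poly; blast)+
    have f0: "f 0 = 1" and g0: "g 0 = 1" using less.prems UW by (auto simp: f_def g_def)
    have pos: "f s1 > 0" if s1: "s1 \<in> {0..t}" for s1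
    proof (rule ccontr)
      assume neg: "\<not> f s1 > 0"
      let ?Z = "{s \<in> {0..t}. f s = 0}"
      obtain s2 where "0 \<le> s2" "s2 \<le> s1" "f s2 = 0"
        using IVT2'[of f s1 0 0] neg f0 s1 continuous_on_subset[OF cf, of "{0..s1}"] by auto
      then have "s2 \<in> ?Z" using s1 by auto
      moreover have "compact ?Z"
      proof -
        have "closed ?Z"
          using continuous_on_closed_vimage[of "{0..t}" f] cf
          by (auto simp: vimage_def Int_def conj_commute dest!: spec[of _ "{0}"])
        moreover have "{0..t} \<inter> ?Z = ?Z" by blast
        ultimately show ?thesis by (metis compact_Icc compact_Int_closed)
      qed
      ultimately obtain s0 where s0: "s0 \<in> ?Z" "\<And>s. s \<in> ?Z \<Longrightarrow> s0 \<le> s"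
        using continuous_attains_inf[of ?Z "\<lambda>x. x"] by auto
      have fpos: "f s > 0" if ss: "0 \<le> s" "s < s0" for s
      proof (rule ccontr)
        assume "\<not> f s > 0"
        then obtain s' where "0 \<le> s'" "s' \<le> s" "f s' = 0"
          using IVT2'[of f s 0 0] f0 ss s0 continuous_on_subset[OF cf, of "{0..s}"] by auto
        then show False using s0(2)[of s'] ss s0(1) by auto
      qed
      have "g s > 0" if s: "0 \<le> s" "s < s0" for s
      proof -
        have "clique_poly R (z s) ?X > 0"
        proof (rule less.hyps[of W ?X s])
          show "continuous_on {0..s} (\<lambda>s. z s C)" for C
            using less.prems(3)[of C] by (rule continuous_on_subset) (use s s0 in auto)
          show "clique_poly R (z r) W > 0" if "r \<in> {0..s}" for r
            using fpos[of r] that s by (auto simp: f_def)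
        qed (use UW s s0 less.prems in auto)
        then show ?thesis by (simp add: g_def)
      qed
      then have "g s0 \<ge> 0"
        using s0 g0 by (intro nonneg_at_right_end[OF continuous_on_subset[OF cg]]) auto
      then have "clique_poly R (z s0) U \<le> 0"
        using fg[of s0] s0(1) less.prems(4)[of s0 C] by auto
      then show False using less.prems(6)[of s0] s0(1) by auto
    qed
    show ?thesis
      by (rule less.hyps[of W U' t s]) (use UW less.prems pos in \<open>auto simp: f_def\<close>)
  qed
qed

section \<open>The clique polynomial of the cycles of a digraph\<close>

definition cycle_weight :: "('a \<Rightarrow> 'a \<Rightarrow> nat) \<Rightarrow> 'a list \<Rightarrow> nat" where
  "cycle_weight a xs = walk_weight a (hd xs) (tl xs) (hd xs)"

text \<open>A cycle is listed with its maximal vertex first, so every cyclic rotation class occurs once.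
  The second component tells apart the parallel copies of a cycle, of which there are as many
  as the product of the multiplicities of its arcs.\<close>

definition cycles :: "('a::linorder \<Rightarrow> 'a \<Rightarrow> nat) \<Rightarrow> 'a set \<Rightarrow> ('a list \<times> nat) set" where
  "cycles a S = {(xs, i). xs \<noteq> [] \<and> distinct xs \<and> set xs \<subseteq> S \<and> hd xs = Max (set xs) \<and>
     i < cycle_weight a xs}"

definition cdisj :: "'a list \<times> nat \<Rightarrow> 'a list \<times> nat \<Rightarrow> bool" where
  "cdisj C D \<longleftrightarrow> set (fst C) \<inter> set (fst D) = {}"

definition clen :: "'a list \<times> nat \<Rightarrow> nat" where
  "clen C = length (fst C)"

lemma symp_cdisj: "symp cdisj"
  by (auto simp: symp_def cdisj_def)

lemma finite_cycles [simp]: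
  assumes "finite S"
  shows "finite (cycles a S)"
proof -
  have "cycles a S \<subseteq> (SIGMA xs:dlists S. {..<cycle_weight a xs})"
    by (auto simp: cycles_def dlists_def)
  then show ?thesis by (rule finite_subset) (use assms in auto)
qed

text \<open>Since \<open>v\<close> exceeds all of \<open>S\<close>, a cycle through \<open>v\<close>
  is listed from \<open>v\<close> onwards, and its remaining vertices form the inner part of a
  simple path from \<open>v\<close> back to \<open>v\<close>.\<close>

lemma cycles_insert:
  assumes S: "finite S" "\<And>x. x \<in> S \<Longrightarrow> x < v"
  shows "cycles a (insert v S) =
    (\<lambda>(xs, i). (v # xs, i)) ` (SIGMA xs:dlists S. {..<walk_weight a v xs v}) \<union> cycles a S"
proof (intro equalityI subsetI)
  fix C assume C: "C \<in> cycles a (insert v S)"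
  then obtain y ys i where Ci: "C = (y # ys, i)" by (cases C; cases "fst C") (auto simp: cycles_def)
  show "C \<in> (\<lambda>(xs, i). (v # xs, i)) ` (SIGMA xs:dlists S. {..<walk_weight a v xs v}) \<union> cycles a S"
  proof (cases "v \<in> set (y # ys)")
    case True
    then have "Max (set (y # ys)) = v"
      using C S unfolding Ci by (intro Max_eqI) (auto simp: cycles_def intro: less_imp_le)
    then have "y = v" using C by (simp add: Ci cycles_def)
    then show ?thesis using C unfolding Ci
      by (auto simp: cycles_def dlists_def cycle_weight_def image_iff)
  next
    case False
    then show ?thesis using C unfolding Ci by (auto simp: cycles_def)
  qed
next
  fix C assume C: "C \<in> (\<lambda>(xs, i). (v # xs, i)) ` (SIGMA xs:dlists S. {..<walk_weight a v xs v}) \<union> cycles a S"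
  show "C \<in> cycles a (insert v S)"
  proof (cases "C \<in> cycles a S")
    case True
    then show ?thesis by (auto simp: cycles_def)
  next
    case False
    then obtain xs i where "C = (v # xs, i)" "xs \<in> dlists S" "i < walk_weight a v xs v"
      using C by auto
    moreover from this have "Max (set (v # xs)) = v"
      using S by (intro Max_eqI) (auto simp: dlists_def intro: less_imp_le)
    ultimately show ?thesis using S(2)
      by (fastforce simp: cycles_def dlists_def cycle_weight_def)
  qed
qed

text \<open>Adding the largest vertex \<open>v\<close> changes both sides in the same way: the
  cycles through \<open>v\<close> pairwise meet, and the old cycles disjoint from one of them are
  the cycles on the vertices it avoids, to which induction applies.\<close>

theorem pdet_walk_mat_eq_clique_poly:
  assumes "finite S"
  shows "pdet (walk_mat a t) S = clique_poly cdisj (\<lambda>C. t ^ clen C) (cycles a S)"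
  using assms
proof (induction "card S" arbitrary: S rule: less_induct)
  case less
  let ?z = "\<lambda>C::('a list \<times> nat). t ^ clen C"
  show ?case
  proof (cases "S = {}")
    case True
    have "cycles a {} = {}" by (auto simp: cycles_def)
    then show ?thesis using True by simp
  next
    case False
    define v where "v = Max S"
    define W where "W = S - {v}"
    have v: "v \<in> S" using False less.prems by (simp add: v_def)
    have W: "S = insert v W" "v \<notin> W" "finite W" "card W < card S"
      using v less.prems card_Diff1_less[of S v] by (auto simp: W_def)
    have lt: "x < v" if "x \<in> W" for x
      using that less.prems Max_ge[of S x] by (auto simp: W_def v_def less_le)
    let ?I = "SIGMA xs:dlists W. {..<walk_weight a v xs v}"
    let ?f = "\<lambda>(xs, i). (v # xs, i)"
    have fI: "finite ?I" using W by auto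
    have cyc: "cycles a S = ?f ` ?I \<union> cycles a W"
      using cycles_insert[of W v a] W(1,3) lt by blast
    have "clique_poly cdisj ?z (cycles a S) = clique_poly cdisj ?z (cycles a W)
      - (\<Sum>C\<in>?f ` ?I. ?z C * clique_poly cdisj ?z {D \<in> cycles a W. cdisj C D})"
      unfolding cyc
    proof (rule clique_poly_Un[OF symp_cdisj])
      show "finite (?f ` ?I)" using fI by (rule finite_imageI)
      show "finite (cycles a W)" using W by simp
    qed (use W in \<open>auto simp: cdisj_def cycles_def\<close>)
    also have "(\<Sum>C\<in>?f ` ?I. ?z C * clique_poly cdisj ?z {D \<in> cycles a W. cdisj C D})
      = (\<Sum>(xs, i)\<in>?I. t ^ Suc (length xs) * pdet (walk_mat a t) (W - set xs))"
    proof (subst sum.reindex, force simp: inj_on_def, rule sum.cong, rule refl)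
      fix p assume p: "p \<in> ?I"
      obtain xs i where pe: "p = (xs, i)" by (cases p)
      have "{D \<in> cycles a W. cdisj (v # xs, i) D} = cycles a (W - set xs)"
        using W(2) by (auto simp: cycles_def cdisj_def)
      moreover have "card (W - set xs) < card S"
        using W by (meson Diff_subset card_mono le_less_trans)
      ultimately show "((\<lambda>C. ?z C * clique_poly cdisj ?z {D \<in> cycles a W. cdisj C D}) \<circ> ?f) p
        = (case p of (xs, i) \<Rightarrow> t ^ Suc (length xs) * pdet (walk_mat a t) (W - set xs))"
        using less.hyps[of "W - set xs"] W by (simp add: pe clen_def)
    qed
    also have "\<dots> = (\<Sum>xs\<in>dlists W. t ^ Suc (length xs) * real (walk_weight a v xs v) * pdet (walk_mat a t) (W - set xs))"
      using W(3) by (subst sum.Sigma[symmetric]) (auto intro!: sum.cong)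
    finally show ?thesis
      using pdet_walk_insert[OF W(3,2), of a t] less.hyps[OF W(4,3)] W(1) by simp
  qed
qed

section \<open>Cycle configurations with few disjoint pairs\<close>

definition nbrs :: "('c \<Rightarrow> 'c \<Rightarrow> bool) \<Rightarrow> 'c \<Rightarrow> 'c set \<Rightarrow> 'c set" where
  "nbrs R C U = {D \<in> U. R C D}"

lemma nbrs_simps:
  "nbrs R C {} = {}"
  "nbrs R C (insert D U) = (if R C D then insert D (nbrs R C U) else nbrs R C U)"
  by (auto simp: nbrs_def)

lemma mult_one_minus_le: "x * (1 - x) \<le> (1/4 :: real)"
  using zero_le_power2[of "x - 1/2"] by (simp add: power2_eq_square algebra_simps)

lemma mult_one_minus_le2:
  assumes "0 \<le> x" "x \<le> 1" "0 \<le> y" "y \<le> (1::real)"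
  shows "(x * y) * ((1 - x) * (1 - y)) \<le> 1/16"
proof -
  have "(x * (1 - x)) * (y * (1 - y)) \<le> (1/4) * (1/4)"
    using assms by (intro mult_mono mult_one_minus_le mult_nonneg_nonneg) auto
  then show ?thesis by (simp add: algebra_simps)
qed

text \<open>Common end of the star exclusions. The \<open>k\<close> disjoint pairs bound one product
  from below, and the \<open>m\<close> cycles that meet everything bound the complementary one. With
  \<open>c = 0.1458\<close> one has \<open>3 * c * c > 1/16 > 2 * c * c\<close>, so the bound
  excludes exactly \<open>k * m \<ge> 3\<close>.\<close>

lemma product_bound:
  assumes "0 \<le> x" "x \<le> 1" "0 \<le> y" "y \<le> (1::real)"
    and "k * c \<le> x * y" "m * c \<le> (1 - x) * (1 - y)" "0 \<le> k * c" "0 \<le> m * c"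
  shows "k * m * (c * c) \<le> 1/16"
proof -
  have "(k * c) * (m * c) \<le> (x * y) * ((1 - x) * (1 - y))"
    using assms by (intro mult_mono[OF assms(5,6)]) auto
  also have "\<dots> \<le> 1/16" by (rule mult_one_minus_le2) (use assms in auto)
  finally show ?thesis by (simp add: algebra_simps)
qed

text \<open>The relation \<open>R\<close> stands for disjointness of cycles. The constant \<open>0.1458\<close> lies just below
  \<open>((3 - sqrt 5) / 2)\<^sup>2 = 0.14589\<dots>\<close>, the value of \<open>t ^ n\<close> in the application; all the exclusions
  below use that \<open>x (1 - x) \<le> 1/4\<close> and that this number is large enough.\<close>

locale cycle_config =
  fixes R :: "'c \<Rightarrow> 'c \<Rightarrow> bool" and V :: "'c set" and len :: "'c \<Rightarrow> nat" and n :: nat and t :: real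
  assumes symp: "symp R" and finite: "finite V" and irrefl: "C \<in> V \<Longrightarrow> \<not> R C C"
    and len_pos: "C \<in> V \<Longrightarrow> 0 < len C" and len_le: "C \<in> V \<Longrightarrow> len C \<le> n"
    and len2: "C \<in> V \<Longrightarrow> D \<in> V \<Longrightarrow> R C D \<Longrightarrow> len C + len D \<le> n"
    and len3: "C \<in> V \<Longrightarrow> D \<in> V \<Longrightarrow> E \<in> V \<Longrightarrow> R C D \<Longrightarrow> R C E \<Longrightarrow> R D E \<Longrightarrow> len C + len D + len E \<le> n"
    and conn: "C \<in> V \<Longrightarrow> D \<in> V \<Longrightarrow> (C, D) \<in> {(x, y). x \<in> V \<and> y \<in> V \<and> \<not> R x y}\<^sup>*"
    and t: "0 < t" "t < 1" and tn: "0.1458 < t ^ n"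
    and pos: "U \<subseteq> V \<Longrightarrow> clique_poly R (\<lambda>C. t ^ len C) U \<ge> 0"
begin

definition "z C = t ^ len C"

lemma clique_poly_z: "clique_poly R z (insert C U) = clique_poly R z U - z C * clique_poly R z (nbrs R C U)"
  if "finite U" "C \<notin> U"
  using clique_poly_insert[OF symp that] by (simp add: nbrs_def)

lemma pos': "U \<subseteq> V \<Longrightarrow> clique_poly R z U \<ge> 0"
  using pos[of U] unfolding z_def .

lemma R_sym: "R C D \<longleftrightarrow> R D C"
  using symp by (auto dest: sympD)

lemma R_symD: "R C D \<Longrightarrow> R D C" and not_R_symD: "\<not> R C D \<Longrightarrow> \<not> R D C"
  using R_sym by blast+

lemma z_pos: "0 < z C" and z_ge0: "0 \<le> z C"
  using t by (auto simp: z_def)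

lemma z_lt1: "C \<in> V \<Longrightarrow> z C < 1" and z_le1: "C \<in> V \<Longrightarrow> z C \<le> 1"
  using t len_pos[of C] by (auto simp: z_def power_less_one_iff power_le_one)

lemma tn_le: "k \<le> n \<Longrightarrow> 0.1458 \<le> t ^ k"
  using tn power_decreasing[of k n t] t by linarith

lemma z_ge: "C \<in> V \<Longrightarrow> 0.1458 \<le> z C"
  using tn_le len_le by (simp add: z_def)

lemma z2_ge: "C \<in> V \<Longrightarrow> D \<in> V \<Longrightarrow> R C D \<Longrightarrow> 0.1458 \<le> z C * z D"
  using tn_le len2 by (simp add: z_def flip: power_add)

lemma z3_ge: "C \<in> V \<Longrightarrow> D \<in> V \<Longrightarrow> E \<in> V \<Longrightarrow> R C D \<Longrightarrow> R C E \<Longrightarrow> R D E \<Longrightarrow> 0.1458 \<le> z C * z D * z E"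
  using tn_le len3 by (simp add: z_def flip: power_add)

lemmas z_facts = z_ge0 z_le1 z_ge

text \<open>The names of this and the next two exclusions refer to the graph of meeting cycles, the
  complement of \<open>R\<close>. Here \<open>d\<close> meets three pairwise disjoint cycles; the
  contradiction is \<open>0.1458^2 > 1/64\<close>.\<close>

lemma no_claw:
  assumes V: "a \<in> V" "b \<in> V" "c \<in> V" "d \<in> V" and R: "R a b" "R a c" "R b c"
    and nR: "\<not> R a d" "\<not> R b d" "\<not> R c d"
  shows False
proof -
  have ne: "a \<noteq> b" "a \<noteq> c" "b \<noteq> c" "a \<noteq> d" "b \<noteq> d" "c \<noteq> d" using R nR irrefl V R_sym by metis+
  have "clique_poly R z {a, b, c, d} = (1 - z a) * (1 - z b) * (1 - z c) - z d"
    using ne ne[symmetric] R R[THEN R_symD] nR nR[THEN not_R_symD]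
    by (simp add: clique_poly_z nbrs_simps algebra_simps)
  then have q: "0.1458 \<le> (1 - z a) * (1 - z b) * (1 - z c)"
    using pos'[of "{a, b, c, d}"] V z_ge[of d] by simp
  have "0.1458 * 0.1458 \<le> (z a * z b * z c) * ((1 - z a) * (1 - z b) * (1 - z c))"
    using z3_ge[OF V(1-3) R] q by (intro mult_mono) (auto simp: z_ge0)
  also have "\<dots> = ((z a * z b) * ((1 - z a) * (1 - z b))) * (z c * (1 - z c))"
    by (simp add: algebra_simps)
  also have "\<dots> \<le> 1/16 * (1/4)"
    using V z_facts by (intro mult_mono mult_one_minus_le mult_one_minus_le2 mult_nonneg_nonneg) auto
  finally show False by simp
qed

text \<open>Two disjoint pairs that meet each other completely. For each pair the product of the
  \<open>1 - z\<close> is at most \<open>1 / (16 * 0.1458) < 0.43\<close>, whereas positivity asks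
  the two products to sum to at least 1.\<close>

lemma no_four_cycle:
  assumes V: "a \<in> V" "b \<in> V" "c \<in> V" "d \<in> V" and R: "R a b" "R c d"
    and nR: "\<not> R a c" "\<not> R a d" "\<not> R b c" "\<not> R b d"
  shows False
proof -
  have ne: "a \<noteq> b" "a \<noteq> c" "b \<noteq> c" "a \<noteq> d" "b \<noteq> d" "c \<noteq> d" using R nR irrefl V R_sym by metis+
  have "clique_poly R z {a, b, c, d} = (1 - z a) * (1 - z b) + (1 - z c) * (1 - z d) - 1"
    using ne ne[symmetric] R R[THEN R_symD] nR nR[THEN not_R_symD]
    by (simp add: clique_poly_z nbrs_simps algebra_simps)
  then have q: "1 \<le> (1 - z a) * (1 - z b) + (1 - z c) * (1 - z d)"
    using pos'[of "{a, b, c, d}"] V by simp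
  have *: "P \<le> 0.43" if "x \<in> V" "y \<in> V" "R x y" "P = (1 - z x) * (1 - z y)" for x y P
  proof -
    have "0.1458 * ((1 - z x) * (1 - z y)) \<le> (z x * z y) * ((1 - z x) * (1 - z y))"
      using that z2_ge[OF that(1-3)] z_facts by (intro mult_right_mono mult_nonneg_nonneg) auto
    also have "\<dots> \<le> 1/16" using that z_facts by (intro mult_one_minus_le2) auto
    finally have "0.1458 * P \<le> 1/16" using that(4) by simp
    then show ?thesis by simp
  qed
  from *[OF V(1,2) R(1) refl] *[OF V(3,4) R(2) refl] q show False by simp
qed

text \<open>The weights of the pairs \<open>a\<close>, \<open>c\<close> and \<open>b\<close>,
  \<open>d\<close> turn positivity into \<open>0.1458 * (p + s) \<le> p * s\<close> for the
  quantities \<open>p\<close>, \<open>s\<close> introduced below. By the arithmetic-geometric mean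
  inequality \<open>p * s\<close> is then at least \<open>4 * 0.1458^2\<close>, which exceeds the
  upper bound \<open>1/16\<close>.\<close>

lemma no_path:
  assumes V: "a \<in> V" "b \<in> V" "c \<in> V" "d \<in> V" and R: "R a c" "R a d" "R b d"
    and nR: "\<not> R a b" "\<not> R b c" "\<not> R c d"
  shows False
proof -
  have ne: "a \<noteq> b" "a \<noteq> c" "b \<noteq> c" "a \<noteq> d" "b \<noteq> d" "c \<noteq> d" using R nR irrefl V R_sym by metis+
  define x y u v where "x = z a" "y = z d" "u = z c" "v = z b"
  have "clique_poly R z {a, b, c, d} = (1 - x) * (1 - y) - u * (1 - x) - v * (1 - y)"
    using ne ne[symmetric] R R[THEN R_symD] nR nR[THEN not_R_symD]
    by (simp add: clique_poly_z nbrs_simps algebra_simps x_y_u_v_def)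
  then have q: "u * (1 - x) + v * (1 - y) \<le> (1 - x) * (1 - y)"
    using pos'[of "{a, b, c, d}"] V by simp
  have b: "0 < x" "x < 1" "0 < y" "y < 1" "0 < u" "0 < v"
    using V z_pos z_lt1 by (auto simp: x_y_u_v_def)
  have p: "0.1458 \<le> x * u" "0.1458 \<le> x * y" "0.1458 \<le> v * y"
    using z2_ge V R by (auto simp: x_y_u_v_def)
  \<comment> \<open>These remain after multiplying the inequality \<open>q\<close> by
    \<open>x * y\<close>: the factors \<open>x * u\<close> and \<open>v * y\<close>, bounded below
    by disjointness, split off.\<close>
  define p s where "p = y * (1 - x)" and "s = x * (1 - y)"
  define c :: real where "c = 0.1458"
  have ps: "0 < p" "0 < s" using b by (auto simp: p_def s_def)
  have "c * p + c * s \<le> (x * u) * p + (v * y) * s"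
    using p ps by (intro add_mono mult_right_mono) (auto simp: c_def)
  also have "\<dots> = x * y * (u * (1 - x) + v * (1 - y))"
    by (simp add: p_def s_def algebra_simps)
  also have "\<dots> \<le> x * y * ((1 - x) * (1 - y))"
    using q b by (intro mult_left_mono) auto
  also have "\<dots> = p * s" by (simp add: p_def s_def algebra_simps)
  finally have 1: "c * (p + s) \<le> p * s" by (simp add: algebra_simps)
  have "p * s = (x * y) * ((1 - x) * (1 - y))" by (simp add: p_def s_def algebra_simps)
  also have "\<dots> \<le> 1/16" using b by (intro mult_one_minus_le2) auto
  finally have 2: "p * s \<le> 1/16" .
  have "(c * c) * (4 * (p * s)) \<le> (c * c) * ((p + s) * (p + s))"
    using zero_le_power2[of "p - s"]
    by (intro mult_left_mono) (auto simp: c_def power2_eq_square algebra_simps)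
  also have "\<dots> = (c * (p + s)) * (c * (p + s))" by (simp add: algebra_simps)
  also have "\<dots> \<le> (p * s) * (p * s)"
    using ps by (intro mult_mono[OF 1 1]) (auto simp: c_def)
  finally have "4 * (c * c) * (p * s) \<le> (p * s) * (p * s)" by (simp add: algebra_simps)
  then have "4 * (c * c) \<le> p * s"
    using ps by (simp add: mult_le_cancel_right)
  then show False using 2 by (simp add: c_def)
qed

text \<open>In the four star exclusions disjointness is complete bipartite, with sides of the sizes
  given by the two digits, and the remaining cycles meet everything. The polynomial is then a
  product of two linear factors minus the weights of these remaining cycles.\<close>

lemma no_star_31:
  assumes V: "a \<in> V" "b \<in> V" "c \<in> V" "q \<in> V" "d \<in> V"
    and R: "R a q" "R b q" "R c q" and ne0: "a \<noteq> b" "a \<noteq> c" "b \<noteq> c"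
    and nR: "\<not> R a b" "\<not> R a c" "\<not> R b c" "\<not> R a d" "\<not> R b d" "\<not> R c d" "\<not> R q d"
    and ned: "d \<noteq> a" "d \<noteq> b" "d \<noteq> c" "d \<noteq> q"
  shows False
proof -
  have ne: "q \<noteq> a" "q \<noteq> b" "q \<noteq> c" using R irrefl V by metis+
  note facts = ne ne[symmetric] ne0 ne0[symmetric] ned ned[symmetric] R R[THEN R_symD] nR nR[THEN not_R_symD]
  define s where "s = z a + z b + z c"
  have "clique_poly R z {a, b, c} = 1 - s"
    using facts by (simp add: clique_poly_z nbrs_simps s_def)
  then have s: "0 \<le> s" "s \<le> 1"
    using pos'[of "{a, b, c}"] V by (auto simp: s_def z_ge0)
  have "clique_poly R z {a, b, c, q, d} = (1 - s) * (1 - z q) - z d"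
    using facts by (simp add: clique_poly_z nbrs_simps s_def algebra_simps)
  then have q: "1 * 0.1458 \<le> (1 - s) * (1 - z q)"
    using pos'[of "{a, b, c, q, d}"] V z_ge[of d] by simp
  have "3 * 0.1458 \<le> s * z q"
    using z2_ge[OF V(1,4) R(1)] z2_ge[OF V(2,4) R(2)] z2_ge[OF V(3,4) R(3)]
    by (simp add: s_def algebra_simps)
  from product_bound[OF s _ _ this q] V z_facts show False by simp
qed

lemma no_star_22:
  assumes V: "a \<in> V" "b \<in> V" "p \<in> V" "q \<in> V" "d \<in> V"
    and R: "R a p" "R a q" "R b p" "R b q" and ne0: "a \<noteq> b" "p \<noteq> q"
    and nR: "\<not> R a b" "\<not> R p q" "\<not> R a d" "\<not> R b d" "\<not> R p d" "\<not> R q d"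
    and ned: "d \<noteq> a" "d \<noteq> b" "d \<noteq> p" "d \<noteq> q"
  shows False
proof -
  have ne: "p \<noteq> a" "p \<noteq> b" "q \<noteq> a" "q \<noteq> b" using R irrefl V by metis+
  note facts = ne ne[symmetric] ne0 ne0[symmetric] ned ned[symmetric] R R[THEN R_symD] nR nR[THEN not_R_symD]
  define s r where "s = z a + z b" and "r = z p + z q"
  have "clique_poly R z {a, b} = 1 - s" "clique_poly R z {p, q} = 1 - r"
    using facts by (simp_all add: clique_poly_z nbrs_simps s_def r_def)
  then have s: "0 \<le> s" "s \<le> 1" and r: "0 \<le> r" "r \<le> 1"
    using pos'[of "{a, b}"] pos'[of "{p, q}"] V by (auto simp: s_def r_def z_ge0)
  have "clique_poly R z {a, b, p, q, d} = (1 - s) * (1 - r) - z d"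
    using facts by (simp add: clique_poly_z nbrs_simps s_def r_def algebra_simps)
  then have q: "1 * 0.1458 \<le> (1 - s) * (1 - r)"
    using pos'[of "{a, b, p, q, d}"] V z_ge[of d] by simp
  have "4 * 0.1458 \<le> s * r"
    using z2_ge[OF V(1,3) R(1)] z2_ge[OF V(1,4) R(2)] z2_ge[OF V(2,3) R(3)] z2_ge[OF V(2,4) R(4)]
    by (simp add: s_def r_def algebra_simps)
  from product_bound[OF s r this q] show False by simp
qed

lemma no_star_21:
  assumes V: "a \<in> V" "b \<in> V" "q \<in> V" "d \<in> V" "e \<in> V"
    and R: "R a q" "R b q" and ne0: "a \<noteq> b"
    and nR: "\<not> R a b" "\<not> R a d" "\<not> R b d" "\<not> R q d" "\<not> R a e" "\<not> R b e" "\<not> R q e" "\<not> R d e"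
    and ned: "d \<noteq> a" "d \<noteq> b" "d \<noteq> q" "e \<noteq> a" "e \<noteq> b" "e \<noteq> q" "d \<noteq> e"
  shows False
proof -
  have ne: "q \<noteq> a" "q \<noteq> b" using R irrefl V by metis+
  note facts = ne ne[symmetric] ne0 ne0[symmetric] ned ned[symmetric] R R[THEN R_symD] nR nR[THEN not_R_symD]
  define s where "s = z a + z b"
  have "clique_poly R z {a, b} = 1 - s"
    using facts by (simp add: clique_poly_z nbrs_simps s_def)
  then have s: "0 \<le> s" "s \<le> 1"
    using pos'[of "{a, b}"] V by (auto simp: s_def z_ge0)
  have "clique_poly R z {a, b, q, d, e} = (1 - s) * (1 - z q) - z d - z e"
    using facts by (simp add: clique_poly_z nbrs_simps s_def algebra_simps)
  then have q: "2 * 0.1458 \<le> (1 - s) * (1 - z q)"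
    using pos'[of "{a, b, q, d, e}"] V z_ge[of d] z_ge[of e] by simp
  have "2 * 0.1458 \<le> s * z q"
    using z2_ge[OF V(1,3) R(1)] z2_ge[OF V(2,3) R(2)]
    by (simp add: s_def algebra_simps)
  from product_bound[OF s _ _ this q] V z_facts show False by simp
qed

lemma no_star_11:
  assumes V: "a \<in> V" "q \<in> V" "d \<in> V" "e \<in> V" "f \<in> V"
    and R: "R a q"
    and nR: "\<not> R a d" "\<not> R a e" "\<not> R a f" "\<not> R q d" "\<not> R q e" "\<not> R q f" "\<not> R d e" "\<not> R d f" "\<not> R e f"
    and ned: "d \<noteq> a" "e \<noteq> a" "f \<noteq> a" "d \<noteq> q" "e \<noteq> q" "f \<noteq> q" "d \<noteq> e" "d \<noteq> f" "e \<noteq> f"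
  shows False
proof -
  have ne: "q \<noteq> a" using R irrefl V by metis
  note facts = ne ne[symmetric] ned ned[symmetric] R R[THEN R_symD] nR nR[THEN not_R_symD]
  have "clique_poly R z {a, q, d, e, f} = (1 - z a) * (1 - z q) - z d - z e - z f"
    using facts by (simp add: clique_poly_z nbrs_simps algebra_simps)
  then have q: "3 * 0.1458 \<le> (1 - z a) * (1 - z q)"
    using pos'[of "{a, q, d, e, f}"] V z_ge[of d] z_ge[of e] z_ge[of f] by simp
  have "1 * 0.1458 \<le> z a * z q"
    using z2_ge[OF V(1,2) R] by simp
  from product_bound[OF _ _ _ _ this q] V z_facts show False by simp
qed

text \<open>A connected graph without an induced path on four vertices has diameter at most two.
  Along a chain of meeting cycles starting at \<open>C\<close>, a step from distance two to distance
  three would create such a path.\<close>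

lemma common_nbr:
  assumes "C \<in> V" "D \<in> V" "R C D"
  obtains d where "d \<in> V" "\<not> R C d" "\<not> R d D"
proof -
  have "(C, D) \<in> {(x, y). x \<in> V \<and> y \<in> V \<and> \<not> R x y}\<^sup>*"
    using conn assms by blast
  then have "D \<in> V \<longrightarrow> D = C \<or> \<not> R C D \<or> (\<exists>d\<in>V. \<not> R C d \<and> \<not> R d D)"
  proof (induction rule: rtrancl_induct)
    case (step y x)
    then have xy: "x \<in> V" "y \<in> V" "\<not> R y x" by auto
    consider "y = C" | "\<not> R C y" | d where "d \<in> V" "\<not> R C d" "\<not> R d y" "R C y" using step xy by blast
    then show ?case
    proof cases
      case 3
      then show ?thesis using no_path[of C d y x] assms(1) xy by blast
    qed (use xy in blast)+
  qed simp
  then show ?thesis using that assms irrefl by blast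
qed

text \<open>If \<open>d\<close> were disjoint from \<open>e\<close>, every cycle disjoint from
  \<open>d\<close> would be disjoint from both \<open>a\<close> and \<open>b\<close>, else a
  four-cycle or a path arises. A cycle \<open>f\<close> meeting both \<open>d\<close> and
  \<open>e\<close> then completes a path or a claw, whatever its position relative to
  \<open>a\<close> and \<open>b\<close>.\<close>

lemma dominating:
  assumes V: "a \<in> V" "b \<in> V" "d \<in> V" "e \<in> V" and R: "R a b" and nR: "\<not> R a d" "\<not> R b d"
  shows "\<not> R d e"
proof
  assume de: "R d e"
  have 1: "R a x \<and> R b x" if "x \<in> V" "R d x" for x
  proof -
    have "\<not> (\<not> R a x \<and> \<not> R b x)" using no_four_cycle[of a b d x] that V R nR by blast
    moreover have "\<not> (\<not> R a x \<and> R b x)" using no_path[of x a d b] that V R nR R_sym by blast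
    moreover have "\<not> (R a x \<and> \<not> R b x)" using no_path[of x b d a] that V R nR R_sym by blast
    ultimately show ?thesis by blast
  qed
  obtain f where f: "f \<in> V" "\<not> R d f" "\<not> R f e" using common_nbr[OF V(3,4) de] by blast
  have "\<not> (R a f \<and> R b f)" using no_claw[of a b f d] f V R nR R_sym by blast
  moreover have "\<not> (\<not> R a f \<and> R b f)" using 1[OF V(4) de] no_path[of e f a b] f V R nR R_sym
    no_path[of e f d b] de by blast
  moreover have "\<not> (R a f \<and> \<not> R b f)" using 1[OF V(4) de] no_path[of e f d a] f V R nR R_sym de by blast
  moreover have "\<not> (\<not> R a f \<and> \<not> R b f)" using 1[OF V(4) de] no_claw[of a b e f] f V R nR R_sym by blast
  ultimately show False by blast
qed

lemma two_extra:
  assumes V: "a \<in> V" "b \<in> V" "d \<in> V" "e \<in> V" "f \<in> V" and R: "R a b" and nR: "\<not> R a d" "\<not> R b d"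
    and ne: "d \<noteq> a" "d \<noteq> b" "e \<noteq> a" "e \<noteq> b" "e \<noteq> d" "f \<noteq> a" "f \<noteq> b" "f \<noteq> d" "e \<noteq> f"
  shows False
proof -
  have de: "\<not> R d e" "\<not> R d f" using dominating V R nR by blast+
  have L: "\<not> R e a \<or> \<not> R e b" "\<not> R f a \<or> \<not> R f b"
    using no_claw[of a b e d] no_claw[of a b f d] V R nR de R_sym by blast+
  have ef: "\<not> R e f" if "\<not> R e a" "\<not> R e b" "\<not> R f a" "\<not> R f b"
    using no_four_cycle[of a b e f] V R that R_sym by blast
  note ne' = ne ne[symmetric]
  \<comment> \<open>The letters give the positions of \<open>e\<close> and \<open>f\<close>: B meets
    both \<open>a\<close> and \<open>b\<close>, L meets \<open>a\<close> only, R meets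
    \<open>b\<close> only. Being disjoint from both is ruled out by the claw with centre
    \<open>d\<close>.\<close>
  consider (BB) "\<not> R e a" "\<not> R e b" "\<not> R f a" "\<not> R f b"
    | (BL) "\<not> R e a" "\<not> R e b" "\<not> R f a" "R f b"
    | (BR) "\<not> R e a" "\<not> R e b" "R f a" "\<not> R f b"
    | (LB) "\<not> R e a" "R e b" "\<not> R f a" "\<not> R f b"
    | (RB) "R e a" "\<not> R e b" "\<not> R f a" "\<not> R f b"
    | (LL) "\<not> R e a" "R e b" "\<not> R f a" "R f b"
    | (RR) "R e a" "\<not> R e b" "R f a" "\<not> R f b"
    | (LR) "\<not> R e a" "R e b" "R f a" "\<not> R f b"
    | (RL) "R e a" "\<not> R e b" "\<not> R f a" "R f b"
    using L by blast
  then show False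
  proof cases
    case BB
    then show False using no_star_11[of a b d e f] V R nR de ef ne' R_sym by metis
  next
    case BL
    have "\<not> R e f" using no_path[of b e a f] V R BL R_sym by blast
    then show False using no_star_21[of a f b d e] V R nR de BL ne' R_sym by metis
  next
    case BR
    have "\<not> R e f" using no_path[of a e b f] V R BR R_sym by blast
    then show False using no_star_21[of b f a d e] V R nR de BR ne' R_sym by metis
  next
    case LB
    have "\<not> R e f" using no_path[of b f a e] V R LB R_sym by blast
    then show False using no_star_21[of a e b d f] V R nR de LB ne' R_sym by metis
  next
    case RB
    have "\<not> R e f" using no_path[of a f b e] V R RB R_sym by blast
    then show False using no_star_21[of b e a d f] V R nR de RB ne' R_sym by metis
  next
    case LL
    have "\<not> R e f" using no_claw[of e f b d] V nR de LL R_sym by blast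
    then show False using no_star_31[of a e f b d] V R nR de LL ne' R_sym by metis
  next
    case RR
    have "\<not> R e f" using no_claw[of e f a d] V nR de RR R_sym by blast
    then show False using no_star_31[of b e f a d] V R nR de RR ne' R_sym by metis
  next
    case LR
    have "R e f" using no_path[of a e f b] V R LR R_sym by blast
    then show False using no_star_22[of a e b f d] V R nR de LR ne' R_sym by metis
  next
    case RL
    have "R e f" using no_path[of b e f a] V R RL R_sym by blast
    then show False using no_star_22[of b e a f d] V R nR de RL ne' R_sym by metis
  qed
qed

text \<open>In the case \<open>four\<close> the relation between \<open>b\<close> and
  \<open>e\<close> is left open: the disjoint pairs are \<open>a\<close>, \<open>b\<close> alone, or
  \<open>a\<close>, \<open>b\<close> together with \<open>b\<close>, \<open>e\<close>. Exchanging
  the two given cycles arranges that \<open>e\<close> meets \<open>a\<close>.\<close>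

theorem classification:
  assumes "C \<in> V" "D \<in> V" "R C D"
  obtains (three) a b d where "V = {a, b, d}" "R a b" "\<not> R a d" "\<not> R b d" "d \<noteq> a" "d \<noteq> b"
  | (four) a b d e where "V = {a, b, d, e}" "R a b" "\<not> R a d" "\<not> R b d" "\<not> R d e" "\<not> R a e"
      "d \<noteq> a" "d \<noteq> b" "e \<noteq> a" "e \<noteq> b" "e \<noteq> d"
proof -
  obtain d where d: "d \<in> V" "\<not> R C d" "\<not> R D d" using common_nbr[OF assms] R_sym by metis
  have ne: "d \<noteq> C" "d \<noteq> D" using d assms R_sym by blast+
  show ?thesis
  proof (cases "V = {C, D, d}")
    case True
    then show ?thesis using three d ne assms by blast
  next
    case False
    then obtain e where e: "e \<in> V" "e \<noteq> C" "e \<noteq> D" "e \<noteq> d" using assms d by blast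
    have "V \<subseteq> {C, D, d, e}" using two_extra[of C D d e] assms d e ne by blast
    then have Ve: "V = {C, D, d, e}" "V = {D, C, d, e}" using assms d e by blast+
    have de: "\<not> R d e" using dominating[of C D d e] assms d e by blast
    have "\<not> (R C e \<and> R D e)" using no_claw[of C D e d] assms d e de R_sym by blast
    then show ?thesis
    proof (cases "R C e")
      case False
      then show ?thesis using four[OF Ve(1)] assms d de e ne by blast
    next
      case True
      then have "\<not> R D e" using \<open>\<not> (R C e \<and> R D e)\<close> by blast
      then show ?thesis using four[OF Ve(2)] assms d de e ne R_sym by blast
    qed
  qed
qed

end

section \<open>Reciprocal cycle configurations\<close>

lemma poly_eqI_pos:
  fixes p q :: "real poly"
  assumes "\<And>x. x > 0 \<Longrightarrow> poly p x = poly q x"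
  shows "p = q"
proof (rule ccontr)
  assume "p \<noteq> q"
  then have "finite {x. poly (p - q) x = 0}" by (intro poly_roots_finite) simp
  moreover have "{0<..} \<subseteq> {x. poly (p - q) x = 0}" using assms by auto
  ultimately show False using infinite_Ioi[of "0::real"] finite_subset by blast
qed

text \<open>Sorts \<open>Q t / y + y * Q (1 / t)\<close> into one summand for each exponent, so that
  each summand becomes a value of \<open>h\<close>. Primed letters are the monomials at
  \<open>1 / t\<close>.\<close>

lemma split_three:
  "(1 - a - b - d + a * b) / y + y * (1 - a' - b' - d' + a' * b') =
   (1 / y + y * 1) - (a / y + y * a') - (b / y + y * b') - (d / y + y * d') + (a * b / y + y * (a' * b'))"
  for y :: real
  by (simp add: algebra_simps diff_divide_distrib add_divide_distrib)

lemma split_four: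
  "(1 - a - b - d - e + a * b) / y + y * (1 - a' - b' - d' - e' + a' * b') =
   (1 / y + y * 1) - (a / y + y * a') - (b / y + y * b') - (d / y + y * d') - (e / y + y * e')
     + (a * b / y + y * (a' * b'))"
  for y :: real
  by (simp add: algebra_simps diff_divide_distrib add_divide_distrib)

lemma split_pendant:
  "(1 - a - b - d - e + a * b + b * e) / y + y * (1 - a' - b' - d' - e' + a' * b' + b' * e') =
   (1 / y + y * 1) - (a / y + y * a') - (b / y + y * b') - (d / y + y * d') - (e / y + y * e')
     + (a * b / y + y * (a' * b')) + (b * e / y + y * (b' * e'))"
  for y :: real
  by (simp add: algebra_simps diff_divide_distrib add_divide_distrib)

text \<open>Compare the coefficients of \<open>X ^ (B + E)\<close>. The positive term on the left
  must be cancelled by \<open>- X ^ D\<close> or matched by \<open>X ^ (2 * g - (B + E))\<close> on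
  the right. A coincidence with \<open>- X ^ A\<close> does not help, because
  \<open>2 * g - B = A\<close> puts the same term on the other side.\<close>

lemma pendant_exponents:
  fixes A B D E g :: nat
  defines "p \<equiv> 1 - monom 1 A - monom 1 B - monom 1 D - monom 1 E + monom 1 (A + B) + monom (1::real) (B + E)"
    and "q \<equiv> monom 1 (2 * g) - monom 1 (2 * g - A) - monom 1 (2 * g - B) - monom 1 (2 * g - D)
        - monom 1 (2 * g - E) + monom 1 (2 * g - (A + B)) + monom (1::real) (2 * g - (B + E))"
  assumes "p = q" and pos: "0 < A" "0 < B" "0 < E" and AB: "A + B = 2 * g" and BE: "B + E < 2 * g"
  shows "B + E = D \<or> B + E = g"
proof (rule ccontr)
  assume neg: "\<not> (B + E = D \<or> B + E = g)"
  define \<delta> :: "nat \<Rightarrow> real" where "\<delta> i = (if i = B + E then 1 else 0)" for i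
  have cm: "coeff (monom 1 i) (B + E) = \<delta> i" for i by (simp add: \<delta>_def)
  have c1: "coeff 1 (B + E) = \<delta> 0" by (simp add: \<delta>_def)
  have "coeff p (B + E) = coeff q (B + E)" using \<open>p = q\<close> by simp
  then have eq: "\<delta> 0 - \<delta> A - \<delta> B - \<delta> D - \<delta> E + \<delta> (A + B) + \<delta> (B + E) =
    \<delta> (2 * g) - \<delta> (2 * g - A) - \<delta> (2 * g - B) - \<delta> (2 * g - D) - \<delta> (2 * g - E)
      + \<delta> (2 * g - (A + B)) + \<delta> (2 * g - (B + E))"
    unfolding p_def q_def coeff_add coeff_diff cm c1 .
  have z: "\<delta> 0 = 0" "\<delta> B = 0" "\<delta> D = 0" "\<delta> E = 0" "\<delta> (A + B) = 0" "\<delta> (B + E) = 1" "\<delta> (2 * g) = 0"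
    "\<delta> (2 * g - A) = 0" "\<delta> (2 * g - (A + B)) = 0" "\<delta> (2 * g - (B + E)) = 0"
    using neg pos AB BE by (auto simp: \<delta>_def)
  have "2 * g - B = A" using AB by simp
  moreover have "0 \<le> \<delta> i" for i by (simp add: \<delta>_def)
  then have "0 \<le> \<delta> (2 * g - D)" "0 \<le> \<delta> (2 * g - E)" by blast+
  ultimately show False using eq unfolding z by simp
qed

text \<open>With \<open>y = t ^ g\<close> the assumption on \<open>t\<close> says \<open>y + 1/y = 3\<close>. By reciprocity \<open>Q t / y\<close> is half the
  signed sum of the values \<open>h k = t ^ k / y + y / t ^ k\<close> over the exponents \<open>k\<close> of \<open>Q\<close>, and these values lie
  between \<open>h g = 2\<close> and \<open>h 0 = h (2 * g) = 3\<close>.\<close>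

locale reciprocal_config = cycle_config R V len "2 * g" t
  for R :: "'c \<Rightarrow> 'c \<Rightarrow> bool" and V :: "'c set" and len :: "'c \<Rightarrow> nat" and g :: nat and t :: real +
  fixes \<epsilon> :: real
  assumes g: "0 < g" and tg: "(t ^ g)\<^sup>2 = 3 * t ^ g - 1" and eps: "\<epsilon> = 1 \<or> \<epsilon> = -1"
    and recip: "x > 0 \<Longrightarrow> clique_poly R (\<lambda>C. x ^ len C) V = \<epsilon> * x ^ (2 * g) * clique_poly R (\<lambda>C. (1 / x) ^ len C) V"
begin

abbreviation "Q x \<equiv> clique_poly R (\<lambda>C. x ^ len C) V"
definition "h k = t ^ k / t ^ g + t ^ g / t ^ k"

lemma clique_poly_any: "clique_poly R f (insert C U) = clique_poly R f U - f C * clique_poly R f (nbrs R C U)"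
  if "finite U" "C \<notin> U"
  using clique_poly_insert[OF symp that] by (simp add: nbrs_def)

lemma h_ge: "2 \<le> h k" and h_eq: "h k = 2 \<Longrightarrow> k = g"
proof -
  have p: "0 < t ^ k" "0 < t ^ g" "t \<noteq> 0" using t by auto
  have *: "h k - 2 = (t ^ k - t ^ g)\<^sup>2 / (t ^ k * t ^ g)"
    using p by (simp add: h_def field_simps power2_eq_square)
  then show "2 \<le> h k" using p by (smt (verit) divide_nonneg_pos mult_pos_pos zero_le_power2)
  assume "h k = 2"
  then have "t ^ k = t ^ g" using * p by auto
  then show "k = g" using t by (metis linorder_neqE_nat order_less_irrefl power_strict_decreasing)
qed

lemma h_0: "h 0 = 3" and h_2g: "h (2 * g) = 3"
proof -
  have p: "0 < t ^ g" "t \<noteq> 0" using t by auto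
  have "1 / t ^ g + t ^ g = 3" using p tg by (simp add: field_simps power2_eq_square)
  then show "h 0 = 3" "h (2 * g) = 3"
    using p by (auto simp: h_def power2_eq_square mult_2 power_add)
qed

lemma h_le: "h k \<le> 3" if "k \<le> 2 * g"
proof -
  have p: "0 < t ^ k" "0 < t ^ g" "t \<noteq> 0" using t by auto
  have "t ^ (2 * g) \<le> t ^ k" "t ^ k \<le> 1"
    using that t by (auto intro: power_decreasing power_le_one)
  then have "0 \<le> (t ^ k - t ^ (2 * g)) * (1 - t ^ k)" by simp
  also have "t ^ (2 * g) = (t ^ g)\<^sup>2" by (simp add: power_mult[symmetric] mult.commute)
  finally have "t ^ k * t ^ k + (t ^ g)\<^sup>2 \<le> t ^ k * (1 + (t ^ g)\<^sup>2)" by (simp add: algebra_simps)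
  also have "1 + (t ^ g)\<^sup>2 = 3 * t ^ g" using tg by simp
  finally show ?thesis
    using p by (simp add: h_def field_simps power2_eq_square)
qed

lemma h_alt: "h k = t ^ k / t ^ g + t ^ g * (1 / t) ^ k"
  by (simp add: h_def power_one_over)

lemma Q_t_ge: "0 \<le> Q t"
  using pos[of V] by simp

lemma h_sum: "0 \<le> Q t / t ^ g + t ^ g * Q (1 / t)" if "\<epsilon> = 1"
proof -
  have p: "0 < t ^ g" using t by auto
  have "Q t = t ^ g * t ^ g * Q (1 / t)" using recip[of t] t that by (simp add: mult_2 power_add)
  then have "t ^ g * Q (1 / t) = Q t / t ^ g" using p by (simp add: field_simps)
  then show ?thesis using Q_t_ge p by simp
qed

text \<open>The constant coefficient of the functional equation forces
  \<open>\<epsilon> = - 1\<close> and a cycle of full length. Then \<open>Q\<close> vanishes at 1,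
  and \<open>Q 1\<close> is 1 minus the number of cycles.\<close>

lemma Q_no_disjoint:
  assumes "\<And>C D. C \<in> V \<Longrightarrow> D \<in> V \<Longrightarrow> \<not> R C D"
  obtains C where "V = {C}" "len C = 2 * g"
proof -
  have Q: "clique_poly R f V = 1 - (\<Sum>C\<in>V. f C)" for f
    using clique_poly_Un[OF symp finite, of "{}" f] assms by simp
  define p q :: "real poly" where
    "p = 1 - (\<Sum>C\<in>V. monom 1 (len C))" and "q = monom 1 (2 * g) - (\<Sum>C\<in>V. monom 1 (2 * g - len C))"
  have "p = Polynomial.smult \<epsilon> q"
  proof (rule poly_eqI_pos)
    fix x :: real assume x: "x > 0"
    have "x ^ (2 * g) * (1 / x) ^ len C = x ^ (2 * g - len C)" if "C \<in> V" for C
      using len_le[OF that] x by (simp add: power_diff power_divide)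
    then have "x ^ (2 * g) * (1 - (\<Sum>C\<in>V. (1 / x) ^ len C)) = poly q x"
      by (simp add: q_def poly_sum poly_monom right_diff_distrib sum_distrib_left)
    moreover have "1 - (\<Sum>C\<in>V. x ^ len C) = poly p x"
      by (simp add: p_def poly_sum poly_monom)
    ultimately show "poly p x = poly (Polynomial.smult \<epsilon> q) x"
      using recip[OF x] unfolding Q by (simp add: mult.assoc)
  qed
  then have c: "coeff p 0 = \<epsilon> * coeff q 0" by simp
  have cp: "coeff p 0 = 1"
    using len_pos by (simp add: p_def coeff_sum)
  have cq: "coeff q 0 = - real (card {C \<in> V. 2 * g \<le> len C})"
    using g finite by (simp add: q_def coeff_sum sum.If_cases Int_def)
  have e: "\<epsilon> = - 1" using c cp cq eps by auto
  have "1 - real (card V) = - (1 - real (card V))"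
    using recip[of 1] e unfolding Q by simp
  then have "card V = 1" by simp
  then obtain C where C: "V = {C}" by (auto simp: card_1_singleton_iff)
  have "card {C \<in> V. 2 * g \<le> len C} \<noteq> 0" using c cp cq e by simp
  then have "{C \<in> V. 2 * g \<le> len C} \<noteq> {}" by (metis card.empty)
  then show thesis using that[OF C] len_le[of C] C by auto
qed

text \<open>With three cycles the bounds give \<open>3 - 3 * 2 + 3 = 0\<close>, so all of them are
  attained. With four cycles and one disjoint pair the total is at most
  \<open>3 - 4 * 2 + 3 < 0\<close>. With two disjoint pairs a slack of 1 remains, and the
  coefficients of the functional equation are needed.\<close>

lemma Q_disjoint:
  assumes "C \<in> V" "D \<in> V" "R C D"
  shows "Q x = 1 - 3 * x ^ g + x ^ (2 * g)"
  using assms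
proof (cases rule: classification)
  case (three a b d)
  note facts = three three(5,6)[symmetric] three(2)[THEN R_symD] three(3,4)[THEN not_R_symD]
  have ab: "a \<noteq> b" using three irrefl by blast
  have Q: "clique_poly R f V = 1 - f a - f b - f d + f a * f b" for f
    unfolding three(1) using facts ab ab[symmetric] by (simp add: clique_poly_any nbrs_simps algebra_simps)
  \<comment> \<open>The value \<open>Q 1 = - 1\<close> is nonzero, so the functional equation at 1
    fixes the sign. The same works below with the values \<open>- 2\<close> and
    \<open>- 1\<close>.\<close>
  have e: "\<epsilon> = 1" using recip[of 1] eps unfolding Q by auto
  have le: "len a + len b \<le> 2 * g" using len2[of a b] three by auto
  have "0 \<le> h 0 - h (len a) - h (len b) - h (len d) + h (len a + len b)"
    using h_sum[OF e] unfolding Q h_alt power_add power_0 split_three .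
  moreover have "h (len a + len b) \<le> 3" using h_le[OF le] .
  ultimately have "h (len a) = 2" "h (len b) = 2" "h (len d) = 2"
    using h_0 h_ge[of "len a"] h_ge[of "len b"] h_ge[of "len d"] by auto
  then have "len a = g" "len b = g" "len d = g" using h_eq by blast+
  then show ?thesis unfolding Q mult_2 power_add by simp
next
  case (four a b d e)
  note facts = four four(7-11)[symmetric] four(2)[THEN R_symD] four(3-6)[THEN not_R_symD]
  have ab: "a \<noteq> b" using four irrefl by blast
  have V: "a \<in> V" "b \<in> V" "d \<in> V" "e \<in> V" using four by auto
  have le: "len a + len b \<le> 2 * g" using len2[of a b] four V by auto
  show ?thesis
  proof (cases "R b e")
    case False
    have Q: "clique_poly R f V = 1 - f a - f b - f d - f e + f a * f b" for f
      unfolding four(1) using facts ab ab[symmetric] False False[THEN not_R_symD]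
      by (simp add: clique_poly_any nbrs_simps algebra_simps)
    have e: "\<epsilon> = 1" using recip[of 1] eps unfolding Q by auto
    have "0 \<le> h 0 - h (len a) - h (len b) - h (len d) - h (len e) + h (len a + len b)"
      using h_sum[OF e] unfolding Q h_alt power_add power_0 split_four .
    moreover have "h (len a + len b) \<le> 3" using h_le[OF le] .
    ultimately have False
      using h_0 h_ge[of "len a"] h_ge[of "len b"] h_ge[of "len d"] h_ge[of "len e"] by linarith
    then show ?thesis ..
  next
    case True
    define A B D' E where l: "A = len a" "B = len b" "D' = len d" "E = len e"
    have Q: "clique_poly R f V = 1 - f a - f b - f d - f e + f a * f b + f b * f e" for f
      unfolding four(1) using facts ab ab[symmetric] True True[THEN R_symD]
      by (simp add: clique_poly_any nbrs_simps algebra_simps)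
    have e: "\<epsilon> = 1" using recip[of 1] eps unfolding Q by auto
    have le2: "B + E \<le> 2 * g" using len2[of b e] True V l by auto
    have le': "A + B \<le> 2 * g" using le l by simp
    have p0: "0 < A" "0 < B" "0 < D'" "0 < E" and pn: "D' \<le> 2 * g" using len_pos len_le V l by auto
    have hs: "0 \<le> h 0 - h A - h B - h D' - h E + h (A + B) + h (B + E)"
      using h_sum[OF e] unfolding Q h_alt power_add power_0 split_pendant l .
    define p q :: "real poly" where
      "p = 1 - monom 1 A - monom 1 B - monom 1 D' - monom 1 E + monom 1 (A + B) + monom 1 (B + E)"
      and "q = monom 1 (2 * g) - monom 1 (2 * g - A) - monom 1 (2 * g - B) - monom 1 (2 * g - D')
        - monom 1 (2 * g - E) + monom 1 (2 * g - (A + B)) + monom 1 (2 * g - (B + E))"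
    have "p = q"
    proof (rule poly_eqI_pos)
      fix x :: real assume x: "x > 0"
      define i where "i = 1 / x"
      have *: "x ^ (2 * g - k) = x ^ (2 * g) * i ^ k" if "k \<le> 2 * g" for k
        using that x by (simp add: i_def power_diff power_divide)
      have "poly p x = Q x" unfolding Q by (simp add: p_def poly_monom power_add l)
      also have "\<dots> = x ^ (2 * g) * Q i" using recip[OF x] e by (simp add: i_def)
      also have "\<dots> = x ^ (2 * g) - x ^ (2 * g) * i ^ A - x ^ (2 * g) * i ^ B - x ^ (2 * g) * i ^ D'
        - x ^ (2 * g) * i ^ E + x ^ (2 * g) * i ^ (A + B) + x ^ (2 * g) * i ^ (B + E)"
        unfolding Q l power_add by (simp only: algebra_simps mult_1_right)
      also have "\<dots> = poly q x"
        using le' le2 pn by (simp add: q_def poly_monom *)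
      finally show "poly p x = poly q x" .
    qed
    then have c: "coeff p k = coeff q k" for k by simp
    have h: "2 \<le> h A" "2 \<le> h B" "2 \<le> h D'" "2 \<le> h E" "h (A + B) \<le> 3" "h (B + E) \<le> 3"
      using h_ge h_le le' le2 by auto
    note hs' = hs[unfolded h_0]
    have "A < 2 * g" "B < 2 * g" "E < 2 * g" using p0 le' le2 by auto
    \<comment> \<open>Constant coefficients: on the right only exponents equal to
      \<open>2 * g\<close> contribute, and \<open>A\<close>, \<open>B\<close>, \<open>E\<close> are
      smaller because each is part of a disjoint pair.\<close>
    then have c0: "(if A + B = 2 * g then 1 else 0) + (if B + E = 2 * g then 1 else 0)
      - (if D' = 2 * g then 1 else 0) = (1 :: real)"
      using c[of 0] p0 le' le2 pn by (auto simp: p_def q_def split: if_splits)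
    consider "A + B = 2 * g" "B + E = 2 * g" "D' = 2 * g"
      | "A + B = 2 * g" "B + E < 2 * g" "D' < 2 * g" | "A + B < 2 * g" "B + E = 2 * g" "D' < 2 * g"
      using c0 le' le2 pn by (auto split: if_splits)
    then show ?thesis
    proof cases
      case 1
      then have "h A = 2" "h B = 2" "h E = 2" using hs' h h_2g by auto
      then have "len a = g" "len b = g" "len e = g" "len d = 2 * g" using h_eq 1 l by auto
      then have "x ^ len a = x ^ g" "x ^ len b = x ^ g" "x ^ len e = x ^ g" "x ^ len d = x ^ g * x ^ g"
        unfolding mult_2 by (simp_all only: power_add)
      then show ?thesis unfolding Q mult_2 power_add by simp
    next
      case 2
      \<comment> \<open>Either alternative removes the slack and forces \<open>B = E = g\<close>,
        contrary to \<open>B + E < 2 * g\<close>. So this case and its mirror image do not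
        occur.\<close>
      have "B + E = D' \<or> B + E = g"
        using pendant_exponents[of A B D' E g] \<open>p = q\<close> p0 2 by (simp add: p_def q_def)
      then have "B = g \<and> E = g"
      proof
        assume "B + E = D'"
        then show ?thesis using hs' h h_eq[of B] h_eq[of E] 2 h_2g by auto
      next
        assume "B + E = g"
        then have "h (B + E) = 2" using t by (simp add: h_def)
        then show ?thesis using hs' h h_eq[of B] h_eq[of E] by auto
      qed
      then show ?thesis using 2 by simp
    next
      case 3
      have "A + B = D' \<or> A + B = g"
        using pendant_exponents[of E B D' A g] \<open>p = q\<close> p0 3 by (simp add: p_def q_def add_ac)
      then have "A = g \<and> B = g"
      proof
        assume "A + B = D'"
        then show ?thesis using hs' h h_eq[of A] h_eq[of B] 3 h_2g by auto
      next
        assume "A + B = g"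
        then have "h (A + B) = 2" using t by (simp add: h_def)
        then show ?thesis using hs' h h_eq[of A] h_eq[of B] by auto
      qed
      then show ?thesis using 3 by simp
    qed
  qed
qed

end

section \<open>Strongly connected digraphs\<close>

lemma walk_weight_append:
  "walk_weight a f (ys @ y # zs) v = walk_weight a f ys y * walk_weight a y zs v"
proof (induction ys arbitrary: f)
  case Nil
  show ?case by (subst append_Nil, subst walk_weight.simps(2), subst walk_weight.simps(1), rule refl)
next
  case (Cons x xs)
  show ?case by (subst append_Cons, subst walk_weight.simps(2), subst Cons.IH, subst walk_weight.simps(2), rule mult.assoc[symmetric])
qed

definition arcs :: "('a \<Rightarrow> 'a \<Rightarrow> nat) \<Rightarrow> 'a set \<Rightarrow> ('a \<times> 'a) set" where
  "arcs a S = {(i, j). i \<in> S \<and> j \<in> S \<and> 0 < a i j}"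

lemma rtrancl_arcs_path:
  assumes "(j, i) \<in> (arcs a S)\<^sup>*" "j \<in> S"
  shows "j = i \<or> (\<exists>xs. distinct (j # xs) \<and> i \<notin> set (j # xs) \<and> set xs \<subseteq> S \<and> 0 < walk_weight a j xs i)"
  using assms
proof (induction rule: converse_rtrancl_induct)
  case (step j k)
  then have jk: "j \<in> S" "k \<in> S" "0 < a j k" by (auto simp: arcs_def)
  show ?case
  proof (cases "j = i")
    case False
    consider "k = i" | xs where "k \<noteq> i" "distinct (k # xs)" "i \<notin> set (k # xs)" "set xs \<subseteq> S" "0 < walk_weight a k xs i"
      using step.IH jk by auto
    then show ?thesis
    proof cases
      case 1
      then have "distinct [j] \<and> i \<notin> set [j] \<and> set [] \<subseteq> S \<and> 0 < walk_weight a j [] i"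
        using False jk by auto
      then show ?thesis by blast
    next
      case 2
      show ?thesis
      proof (cases "j \<in> set (k # xs)")
        case True
        show ?thesis
        proof (cases "j = k")
          case True
          then show ?thesis using 2 by blast
        next
          case False
          then obtain ys zs where xs: "xs = ys @ j # zs" using True by (auto dest: split_list)
          then have "distinct (j # zs) \<and> i \<notin> set (j # zs) \<and> set zs \<subseteq> S \<and> 0 < walk_weight a j zs i"
            using 2 by (auto simp: walk_weight_append)
          then show ?thesis by blast
        qed
      next
        case False
        then have "distinct (j # k # xs) \<and> i \<notin> set (j # k # xs) \<and> set (k # xs) \<subseteq> S \<and> 0 < walk_weight a j (k # xs) i"
          using 2 jk \<open>j \<noteq> i\<close> by auto
        then show ?thesis by blast
      qed
    qed
  qed simp
qed simp

text \<open>The closed path is rotated to start at its maximal vertex, the normal form of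
  \<open>cycles\<close>; the copy numbered 0 exists because the weight is positive.\<close>

lemma cycle_through_list:
  fixes a :: "'a::linorder \<Rightarrow> 'a \<Rightarrow> nat"
  assumes l: "distinct (x # xs)" "set (x # xs) \<subseteq> S" "0 < walk_weight a x xs x"
  obtains C where "C \<in> cycles a S" "set (fst C) = set (x # xs)"
proof -
  let ?m = "Max (set (x # xs))"
  have "?m \<in> set (x # xs)" by (intro Max_in) auto
  then obtain ys zs where s: "x # xs = ys @ ?m # zs" by (metis split_list)
  have set_eq: "set (?m # zs @ ys) = set (x # xs)" unfolding s[symmetric] by (subst (2) s) auto
  have w: "0 < walk_weight a ?m (zs @ ys) ?m"
  proof (cases ys)
    case Nil
    then have "x = ?m" "xs = zs" using s by auto
    then show ?thesis using l(3) Nil by simp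
  next
    case (Cons y ys')
    then have "y = x" "xs = ys' @ ?m # zs" using s by auto
    then have "walk_weight a x xs x = walk_weight a x ys' ?m * walk_weight a ?m zs x"
      using walk_weight_append by metis
    then show ?thesis using l(3) Cons \<open>y = x\<close> by (simp add: walk_weight_append)
  qed
  have "distinct (ys @ ?m # zs)" using l(1) s by metis
  then have d: "distinct (?m # zs @ ys)" by auto
  have "(?m # zs @ ys, 0) \<in> cycles a S"
    using d w l(2) set_eq unfolding cycles_def cycle_weight_def by simp
  then show ?thesis using that set_eq by (metis fst_conv)
qed

lemma cycle_through_arc:
  fixes a :: "'a::linorder \<Rightarrow> 'a \<Rightarrow> nat"
  assumes "(i, j) \<in> arcs a S" "(j, i) \<in> (arcs a S)\<^sup>*"
  obtains C where "C \<in> cycles a S" "i \<in> set (fst C)" "j \<in> set (fst C)"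
proof -
  have ij: "i \<in> S" "j \<in> S" "0 < a i j" using assms by (auto simp: arcs_def)
  consider "j = i" | xs where "distinct (j # xs)" "i \<notin> set (j # xs)" "set xs \<subseteq> S" "0 < walk_weight a j xs i"
    using rtrancl_arcs_path[OF assms(2) ij(2)] by blast
  then show ?thesis
  proof cases
    case 1
    show ?thesis by (rule cycle_through_list[of i "[]" S a]) (use that 1 ij in auto)
  next
    case 2
    show ?thesis by (rule cycle_through_list[of i "j # xs" S a]) (use that 2 ij in auto)
  qed
qed

text \<open>Every arc lies on a cycle, so the vertices covered by the cycles reachable from
  \<open>C\<close> are closed under arcs. By strong connectivity they include a vertex of
  \<open>D\<close>.\<close>

lemma cycles_connected:
  fixes a :: "'a::linorder \<Rightarrow> 'a \<Rightarrow> nat"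
  assumes sc: "\<And>i j. i \<in> S \<Longrightarrow> j \<in> S \<Longrightarrow> (i, j) \<in> (arcs a S)\<^sup>*"
    and C: "C \<in> cycles a S" and D: "D \<in> cycles a S"
  shows "(C, D) \<in> {(x, y). x \<in> cycles a S \<and> y \<in> cycles a S \<and> \<not> cdisj x y}\<^sup>*" (is "_ \<in> ?r\<^sup>*")
proof -
  define X where "X = {F \<in> cycles a S. (C, F) \<in> ?r\<^sup>*}"
  define W where "W = (\<Union>F\<in>X. set (fst F))"
  have X_step: "F \<in> X" if F: "F \<in> cycles a S" "set (fst F) \<inter> W \<noteq> {}" for F
  proof -
    obtain G where "G \<in> X" "\<not> cdisj G F" using F(2) by (auto simp: W_def cdisj_def)
    then have "(C, G) \<in> ?r\<^sup>*" "(G, F) \<in> ?r" using F(1) by (auto simp: X_def)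
    then have "(C, F) \<in> ?r\<^sup>*" by (rule rtrancl_into_rtrancl)
    then show ?thesis using F(1) by (simp add: X_def)
  qed
  have W: "j \<in> W" if "(i, j) \<in> (arcs a S)\<^sup>*" "i \<in> W" for i j
    using that
  proof (induction rule: rtrancl_induct)
    case (step j k)
    have "(k, j) \<in> (arcs a S)\<^sup>*" using step(2) sc by (auto simp: arcs_def)
    then obtain F where F: "F \<in> cycles a S" "j \<in> set (fst F)" "k \<in> set (fst F)"
      using cycle_through_arc[OF step(2)] by blast
    then show ?case using X_step[of F] step by (auto simp: W_def)
  qed
  have hd: "set (fst F) \<noteq> {} \<and> set (fst F) \<subseteq> S" if "F \<in> cycles a S" for F
    using that by (auto simp: cycles_def)
  obtain i where i: "i \<in> set (fst C)" using hd[OF C] by (meson all_not_in_conv)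
  obtain j where j: "j \<in> set (fst D)" using hd[OF D] by (meson all_not_in_conv)
  have "C \<in> X" using C by (simp add: X_def)
  then have "i \<in> W" using i by (auto simp: W_def)
  then have "j \<in> W" using W[of i j] sc hd[OF C] hd[OF D] i j by blast
  then show ?thesis using X_step[of D] D j by (auto simp: X_def)
qed

lemma cycle_config_cycles:
  fixes a :: "'a::linorder \<Rightarrow> 'a \<Rightarrow> nat"
  assumes S: "finite S" "card S = n"
    and sc: "\<And>i j. i \<in> S \<Longrightarrow> j \<in> S \<Longrightarrow> (i, j) \<in> (arcs a S)\<^sup>*"
    and t: "0 < t" "t < 1" "0.1458 < t ^ n"
    and pos: "\<And>s. 0 \<le> s \<Longrightarrow> s < t \<Longrightarrow> 0 < pdet (walk_mat a s) S"
  shows "cycle_config cdisj (cycles a S) clen n t"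
proof
  let ?V = "cycles a S"
  show "symp (cdisj :: 'a list \<times> nat \<Rightarrow> _)" by (rule symp_cdisj)
  show "finite ?V" using S by simp
  have dist: "clen C = card (set (fst C))" "set (fst C) \<subseteq> S" "set (fst C) \<noteq> {}" "finite (set (fst C))" if "C \<in> ?V" for C
    using that by (auto simp: cycles_def clen_def distinct_card)
  show "\<not> cdisj C C" "0 < clen C" "clen C \<le> n" if "C \<in> ?V" for C
    using dist[OF that] S card_mono[of S "set (fst C)"] by (auto simp: cdisj_def card_gt_0_iff)
  show "clen C + clen D \<le> n" if "C \<in> ?V" "D \<in> ?V" "cdisj C D" for C D
  proof -
    have "clen C + clen D = card (set (fst C) \<union> set (fst D))"
      using that dist by (simp add: card_Un_disjoint cdisj_def)
    also have "\<dots> \<le> n" unfolding S(2)[symmetric] using dist that S(1) by (intro card_mono) auto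
    finally show ?thesis .
  qed
  show "clen C + clen D + clen E \<le> n" if "C \<in> ?V" "D \<in> ?V" "E \<in> ?V" "cdisj C D" "cdisj C E" "cdisj D E" for C D E
  proof -
    have "card (set (fst C) \<union> set (fst D)) = clen C + clen D"
      using that dist by (simp add: card_Un_disjoint cdisj_def)
    moreover have "(set (fst C) \<union> set (fst D)) \<inter> set (fst E) = {}"
      using that by (auto simp: cdisj_def)
    ultimately have "clen C + clen D + clen E = card (set (fst C) \<union> set (fst D) \<union> set (fst E))"
      using that dist by (subst card_Un_disjoint) auto
    also have "\<dots> \<le> n" unfolding S(2)[symmetric] using dist that S(1) by (intro card_mono) auto
    finally show ?thesis .
  qed
  show "(C, D) \<in> {(x, y). x \<in> ?V \<and> y \<in> ?V \<and> \<not> cdisj x y}\<^sup>*" if "C \<in> ?V" "D \<in> ?V" for C D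
    using cycles_connected[OF sc that] .
  show "0 < t" "t < 1" "0.1458 < t ^ n" using t by auto
  \<comment> \<open>The weights are cut off outside \<open>?V\<close> because
    \<open>clique_poly_pos_subset\<close> wants weight 0 at \<open>s = 0\<close> for every element
    of the type, whereas \<open>0 ^ 0 = 1\<close> for the empty list.\<close>
  let ?z = "\<lambda>(s::real) C. if C \<in> ?V then s ^ clen C else 0"
  have zz: "clique_poly cdisj (?z s) U = clique_poly cdisj (\<lambda>C. s ^ clen C) U" if "U \<subseteq> ?V" for s U
    unfolding clique_poly_def using that by (intro sum.cong refl prod.cong) auto
  show "0 \<le> clique_poly cdisj (\<lambda>C. t ^ clen C) U" if U: "U \<subseteq> ?V" for U
  proof (rule nonneg_at_right_end[of t "\<lambda>s. clique_poly cdisj (\<lambda>C. s ^ clen C) U"])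
    show "continuous_on {0..t} (\<lambda>s. clique_poly cdisj (\<lambda>C. s ^ clen C) U)"
      by (intro continuous_on_clique_poly continuous_intros)
    show 1: "0 < clique_poly cdisj (\<lambda>C. s ^ clen C) U" if s: "0 \<le> s" "s < t" for s
    proof -
      have "0 < clique_poly cdisj (?z s) U"
      proof (rule clique_poly_pos_subset[of cdisj ?V U s ?z s])
        show "continuous_on {0..s} (\<lambda>s. ?z s C)" for C
          by (cases "C \<in> ?V") (auto intro!: continuous_intros)
        show "?z 0 C = 0" for C
          using dist(1,3,4)[of C] by (auto simp: card_gt_0_iff)
        show "0 < clique_poly cdisj (?z r) ?V" if "r \<in> {0..s}" for r
          using pos[of r] that s by (simp add: zz pdet_walk_mat_eq_clique_poly[OF S(1)])
      qed (use symp_cdisj U finite_cycles[OF S(1)] s in simp_all)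
      then show ?thesis using zz[OF U] by simp
    qed
    show "0 < clique_poly cdisj (\<lambda>C. 0 ^ clen C :: real) U" using 1[of 0] t by simp
  qed (use t in auto)
qed

theorem reciprocal_bound:
  fixes a :: "'a::linorder \<Rightarrow> 'a \<Rightarrow> nat"
  assumes S: "finite S" "card S = 2 * g" and g: "0 < g"
    and sc: "\<And>i j. i \<in> S \<Longrightarrow> j \<in> S \<Longrightarrow> (i, j) \<in> (arcs a S)\<^sup>*"
    and t: "0 < t" "t ^ g = (3 - sqrt 5) / 2"
    and pos: "\<And>s. 0 \<le> s \<Longrightarrow> s < t \<Longrightarrow> 0 < pdet (walk_mat a s) S"
    and recip: "\<epsilon> = 1 \<or> \<epsilon> = -1"
      "\<And>x. x > 0 \<Longrightarrow> pdet (walk_mat a x) S = \<epsilon> * x ^ (2 * g) * pdet (walk_mat a (1 / x)) S"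
  shows "(\<forall>x. pdet (walk_mat a x) S = 1 - x ^ (2 * g)) \<or>
    (\<forall>x. pdet (walk_mat a x) S = 1 - 3 * x ^ g + x ^ (2 * g))"
proof -
  have y2: "(t ^ g)\<^sup>2 = 3 * t ^ g - 1"
    unfolding t(2) by (simp add: power2_eq_square field_simps)
  \<comment> \<open>Precise enough for the constant of the locale: \<open>t ^ g > 0.38195\<close>
    gives \<open>t ^ (2 * g) = 3 * t ^ g - 1 > 0.14585\<close>.\<close>
  have s5: "sqrt 5 < 2.2361" by (rule real_less_lsqrt) (auto simp: power2_eq_square)
  have s5': "1 < sqrt 5" by simp
  have y1: "t ^ g < 1" and yl: "0.38195 < t ^ g" unfolding t(2) using s5 s5' by (auto simp: field_simps)
  have t1: "t < 1" using y1 one_le_power[of t g] by linarith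
  have "t ^ (2 * g) = (t ^ g)\<^sup>2" by (simp add: power_mult[symmetric] mult.commute)
  then have tn: "0.1458 < t ^ (2 * g)" using y2 yl by simp
  have "cycle_config cdisj (cycles a S) clen (2 * g) t"
  proof (rule cycle_config_cycles)
    show "finite S" "card S = 2 * g" "0 < t" "t < 1" by fact+
    show "1458 / 10 ^ 4 < t ^ (2 * g)" by (rule tn)
    show "(i, j) \<in> (arcs a S)\<^sup>*" if "i \<in> S" "j \<in> S" for i j using sc that .
    show "0 < pdet (walk_mat a s) S" if "0 \<le> s" "s < t" for s using pos that .
  qed
  then interpret cycle_config cdisj "cycles a S" clen "2 * g" t .
  note Q = pdet_walk_mat_eq_clique_poly[OF S(1)]
  interpret reciprocal_config cdisj "cycles a S" clen g t \<epsilon>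
  proof
    show "clique_poly cdisj (\<lambda>C. x ^ clen C) (cycles a S) =
        \<epsilon> * x ^ (2 * g) * clique_poly cdisj (\<lambda>C. (1 / x) ^ clen C) (cycles a S)" if "0 < x" for x
      using recip(2)[OF that] unfolding Q .
    show "0 < g" by (rule g)
    show "(t ^ g)\<^sup>2 = 3 * t ^ g - 1" by (rule y2)
    show "\<epsilon> = 1 \<or> \<epsilon> = - 1" by (rule recip(1))
  qed
  show ?thesis
  proof (cases "\<exists>C\<in>cycles a S. \<exists>D\<in>cycles a S. cdisj C D")
    case True
    then have "pdet (walk_mat a x) S = 1 - 3 * x ^ g + x ^ (2 * g)" for x
      unfolding Q using Q_disjoint by blast
    then show ?thesis by blast
  next
    case False
    then obtain C where "cycles a S = {C}" "clen C = 2 * g" using Q_no_disjoint by blast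
    moreover have "clique_poly cdisj f {C} = 1 - f C" for f
      using clique_poly_insert[OF symp, of "{}" C f] by simp
    ultimately show ?thesis unfolding Q by simp
  qed
qed

section \<open>Eigenvalues, power sums and traces\<close>

definition lin_prod :: "'a::comm_ring_1 list \<Rightarrow> 'a poly" where
  "lin_prod es = (\<Prod>e\<leftarrow>es. [:- e, 1:])"

lemma lin_prod_simps [simp]: "lin_prod [] = 1" "lin_prod (e # es) = [:- e, 1:] * lin_prod es"
  by (simp_all add: lin_prod_def)

lemma lin_prod_neq_0 [simp]: "lin_prod (es :: 'a::idom list) \<noteq> 0"
  by (induction es) (simp_all del: mult_pCons_left)

lemma proots_lin_prod [simp]: "proots (lin_prod (es :: 'a::idom list)) = mset es"
  by (induction es) (simp_all add: proots_mult del: mult_pCons_left)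

lemma poly_lin_prod: "poly (lin_prod es) x = (\<Prod>e\<leftarrow>es. x - e)"
  by (induction es) (simp_all del: mult_pCons_left)

lemma degree_lin_prod [simp]: "degree (lin_prod (es :: 'a::idom list)) = length es"
  by (induction es) (simp_all add: degree_mult_eq del: mult_pCons_left)

lemma char_poly_lin_prod:
  fixes A :: "complex mat"
  assumes "A \<in> carrier_mat n n"
  obtains es where "char_poly A = lin_prod es" "length es = n"
  using char_poly_factorized[OF assms] unfolding lin_prod_def by blast

lemma prod_list_const: "(\<Prod>x\<leftarrow>xs. c) = (c :: 'a::comm_monoid_mult) ^ length xs"
  by (induction xs) simp_all

text \<open>The parameter \<open>s\<close> treats both symmetries at once: \<open>s = 1\<close> is
  the reciprocal and \<open>s = - 1\<close> the skew-reciprocal case.\<close>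

lemma lin_prod_invert:
  fixes s x :: "'a::field"
  assumes "0 \<notin> set es" "x \<noteq> 0"
  shows "x ^ length es * poly (lin_prod es) (s / x)
    = poly (lin_prod es) 0 * poly (lin_prod (map (\<lambda>e. s * inverse e) es)) x"
  using assms
proof (induction es)
  case (Cons e es)
  then have e: "e \<noteq> 0" by auto
  have "x ^ length (e # es) * poly (lin_prod (e # es)) (s / x)
    = (x * (s / x - e)) * (x ^ length es * poly (lin_prod es) (s / x))"
    by (simp add: algebra_simps)
  also have "x * (s / x - e) = (- e) * (x - s * inverse e)"
    using Cons.prems e by (simp add: field_simps)
  finally show ?case using Cons by (simp add: algebra_simps)
qed simp

lemma poly_eqI_nonzero:
  fixes p q :: "'a::field_char_0 poly"
  assumes "\<And>x. x \<noteq> 0 \<Longrightarrow> poly p x = poly q x"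
  shows "p = q"
proof (rule ccontr)
  assume "p \<noteq> q"
  then have "finite {x. poly (p - q) x = 0}" by (intro poly_roots_finite) simp
  moreover have "- {0} \<subseteq> {x. poly (p - q) x = 0}" using assms by auto
  ultimately have "finite (- {0::'a})" by (rule finite_subset[rotated])
  then show False by (simp add: finite_compl infinite_UNIV_char_0)
qed

lemma invariant_imp_poly:
  fixes s x :: "'a::field"
  assumes "0 \<notin> set es" "x \<noteq> 0" "image_mset (\<lambda>t. s * inverse t) (mset es) = mset es"
  shows "x ^ length es * poly (lin_prod es) (s / x) = poly (lin_prod es) 0 * poly (lin_prod es) x"
proof -
  have "poly (lin_prod (map (\<lambda>e. s * inverse e) es)) x = (\<Prod>e\<in>#image_mset (\<lambda>e. s * inverse e) (mset es). x - e)"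
    by (simp add: poly_lin_prod prod_mset_prod_list[symmetric] image_mset.compositionality o_def)
  also have "\<dots> = poly (lin_prod es) x"
    unfolding assms(3) by (simp add: poly_lin_prod prod_mset_prod_list[symmetric])
  finally show ?thesis using lin_prod_invert[OF assms(1,2), of s] by simp
qed

lemma poly_imp_invariant:
  fixes s c :: "'a::field_char_0"
  assumes "poly (lin_prod es) 0 \<noteq> 0" "c \<noteq> 0"
    and "\<And>x. x \<noteq> 0 \<Longrightarrow> x ^ length es * poly (lin_prod es) (s / x) = c * poly (lin_prod es) x"
  shows "image_mset (\<lambda>t. s * inverse t) (mset es) = mset es"
proof -
  have 0: "0 \<notin> set es"
    using assms(1) by (auto simp: poly_lin_prod prod_list_zero_iff)
  have "Polynomial.smult c (lin_prod es)
      = Polynomial.smult (poly (lin_prod es) 0) (lin_prod (map (\<lambda>e. s * inverse e) es))"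
    by (rule poly_eqI_nonzero) (use assms(3) lin_prod_invert[OF 0] in simp)
  then have "proots (lin_prod es) = proots (lin_prod (map (\<lambda>e. s * inverse e) es))"
    using assms(1,2) by (metis proots_smult)
  then show ?thesis by simp
qed

section \<open>Traces of powers and Newton's identities\<close>

definition mtrace :: "'a::comm_monoid_add mat \<Rightarrow> 'a" where
  "mtrace A = (\<Sum>i<dim_row A. A $$ (i, i))"

lemma mtrace_comm:
  fixes A B :: "'a::comm_semiring_0 mat"
  assumes "A \<in> carrier_mat n n" "B \<in> carrier_mat n n"
  shows "mtrace (A * B) = mtrace (B * A)"
proof -
  have "mtrace (A * B) = (\<Sum>i<n. \<Sum>j<n. A $$ (i, j) * B $$ (j, i))"
    using assms by (auto simp: mtrace_def scalar_prod_def lessThan_atLeast0 intro!: sum.cong)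
  also have "\<dots> = (\<Sum>j<n. \<Sum>i<n. B $$ (j, i) * A $$ (i, j))"
    by (subst sum.swap) (simp add: mult.commute)
  also have "\<dots> = mtrace (B * A)"
    using assms by (auto simp: mtrace_def scalar_prod_def lessThan_atLeast0 intro!: sum.cong)
  finally show ?thesis .
qed

lemma upper_triangular_pow:
  fixes B :: "'a::comm_ring_1 mat"
  assumes B: "B \<in> carrier_mat n n" "upper_triangular B"
  shows "upper_triangular (B ^\<^sub>m k) \<and> (\<forall>i<n. (B ^\<^sub>m k) $$ (i, i) = (B $$ (i, i)) ^ k)"
proof (induction k)
  case 0
  then show ?case using B by simp
next
  case (Suc k)
  let ?P = "B ^\<^sub>m k"
  have P: "?P \<in> carrier_mat n n" using B by simp
  have z: "?P $$ (i, l) * B $$ (l, j) = 0" if "i < n" "j < n" "l < n" "j < i \<or> (j = i \<and> l \<noteq> i)" for i j l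
  proof (cases "l < i")
    case True
    then show ?thesis using Suc P that upper_triangularD[of ?P l i] by auto
  next
    case False
    then have "j < l" using that by auto
    then show ?thesis using B that upper_triangularD[of B j l] by auto
  qed
  have ent: "(?P * B) $$ (i, j) = (\<Sum>l<n. ?P $$ (i, l) * B $$ (l, j))" if "i < n" "j < n" for i j
    using P B that by (simp add: scalar_prod_def lessThan_atLeast0)
  have "upper_triangular (?P * B)"
  proof
    fix i j assume "j < i" "i < dim_row (?P * B)"
    then show "(?P * B) $$ (i, j) = 0" using P B z ent[of i j] by simp
  qed
  moreover have "(?P * B) $$ (i, i) = B $$ (i, i) ^ Suc k" if "i < n" for i
  proof -
    have "(?P * B) $$ (i, i) = (\<Sum>l\<in>{i}. ?P $$ (i, l) * B $$ (l, i))"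
      unfolding ent[OF that that] using that z by (intro sum.mono_neutral_right) auto
    then show ?thesis using Suc that by (simp add: mult.commute)
  qed
  ultimately show ?case by simp
qed

text \<open>By Schur triangularisation: the trace is invariant under similarity, and the diagonal of
  a power of a triangular matrix consists of the powers of its diagonal.\<close>

lemma mtrace_pow_eq_power_sum:
  fixes A :: "complex mat"
  assumes A: "A \<in> carrier_mat n n" and es: "char_poly A = lin_prod es"
  shows "mtrace (A ^\<^sub>m k) = (\<Sum>e\<leftarrow>es. e ^ k)"
proof -
  obtain B where B: "B \<in> carrier_mat n n" "upper_triangular B" "similar_mat A B"
    using schur_decomposition_exists[OF A es[unfolded lin_prod_def]] by blast
  then obtain P Q where wit: "similar_mat_wit A B P Q" by (auto simp: similar_mat_def)
  have PQ: "P \<in> carrier_mat n n" "Q \<in> carrier_mat n n" "Q * P = 1\<^sub>m n"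
    using similar_mat_witD2[OF A wit] by auto
  have Bk: "B ^\<^sub>m k \<in> carrier_mat n n" using B by simp
  have "mtrace (A ^\<^sub>m k) = mtrace (P * (B ^\<^sub>m k) * Q)"
    using similar_mat_wit_pow_id[OF wit] by simp
  also have "\<dots> = mtrace (Q * (P * (B ^\<^sub>m k)))"
    using PQ Bk by (intro mtrace_comm[of _ n]) auto
  also have "Q * (P * (B ^\<^sub>m k)) = B ^\<^sub>m k"
    using PQ Bk by (subst assoc_mult_mat[symmetric, OF PQ(2,1) Bk]) (simp add: left_mult_one_mat[OF Bk])
  also have "mtrace (B ^\<^sub>m k) = (\<Sum>i<n. B $$ (i, i) ^ k)"
    using B upper_triangular_pow[OF B(1,2), of k] by (simp add: mtrace_def)
  also have "\<dots> = (\<Sum>e\<leftarrow>diag_mat B. e ^ k)"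
    using B by (simp add: diag_mat_def sum_list_sum_nth lessThan_atLeast0 o_def)
  also have "\<dots> = (\<Sum>e\<in>#mset (diag_mat B). e ^ k)"
    by (simp add: sum_mset_sum_list[symmetric])
  also have "mset (diag_mat B) = mset es"
  proof -
    have "lin_prod (diag_mat B) = lin_prod es"
      using char_poly_upper_triangular[OF B(1,2)] char_poly_similar[OF B(3)] es by (simp add: lin_prod_def)
    then show ?thesis by (metis proots_lin_prod)
  qed
  also have "(\<Sum>e\<in>#mset es. e ^ k) = (\<Sum>e\<leftarrow>es. e ^ k)"
    by (simp add: sum_mset_sum_list[symmetric])
  finally show ?thesis .
qed

lemma power_sum_recurrence:
  fixes es :: "'a::idom list"
  shows "(\<Sum>i\<le>length es. coeff (lin_prod es) i * (\<Sum>e\<leftarrow>es. e ^ (k + i))) = 0"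
proof -
  have "(\<Sum>i\<le>length es. coeff (lin_prod es) i * (\<Sum>e\<leftarrow>xs. e ^ (k + i)))
      = (\<Sum>e\<leftarrow>xs. e ^ k * poly (lin_prod es) e)" for xs
    by (induction xs) (simp_all add: poly_altdef power_add sum_distrib_left algebra_simps sum.distrib)
  moreover have "(\<Sum>e\<leftarrow>xs. e ^ k * poly (lin_prod es) e) = 0" if "set xs \<subseteq> set es" for xs
    using that by (induction xs) (auto simp: poly_lin_prod prod_list_zero_iff)
  ultimately show ?thesis by simp
qed

text \<open>Logarithmic derivative of the product: each factor contributes
  \<open>- e / (1 - e X)\<close>, a geometric series. Its coefficients yield Newton's identities,
  the product being the reversed polynomial of \<open>lin_prod es\<close>.\<close>

lemma newton_fps:
  fixes es :: "'a::field list"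
  shows "fps_deriv (\<Prod>e\<leftarrow>es. 1 - fps_const e * fps_X)
    = - (\<Prod>e\<leftarrow>es. 1 - fps_const e * fps_X) * Abs_fps (\<lambda>k. \<Sum>e\<leftarrow>es. e ^ Suc k)"
proof (induction es)
  case Nil
  then show ?case by (simp add: fps_eq_iff)
next
  case (Cons e es)
  let ?q = "\<Prod>e\<leftarrow>es. 1 - fps_const e * fps_X" and ?l = "1 - fps_const e * fps_X"
  let ?G = "Abs_fps (\<lambda>k. \<Sum>e\<leftarrow>es. e ^ Suc k)" and ?g = "Abs_fps (\<lambda>k. e ^ Suc k)"
  have g: "?l * ?g = fps_const e"
  proof (rule fps_ext)
    show "fps_nth (?l * ?g) n = fps_nth (fps_const e) n" for n
      by (cases n) (simp_all add: left_diff_distrib mult.assoc)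
  qed
  have s: "Abs_fps (\<lambda>k. \<Sum>e\<leftarrow>e # es. e ^ Suc k) = ?g + ?G"
    by (rule fps_ext) simp
  have "fps_deriv (?l * ?q) = ?l * fps_deriv ?q - fps_const e * ?q"
    by (simp add: algebra_simps)
  also have "\<dots> = ?l * (- ?q * ?G) - (?l * ?g) * ?q"
    by (simp only: Cons.IH g)
  also have "\<dots> = - (?l * ?q) * (?g + ?G)"
    by (simp only: ring_distribs minus_mult_left[symmetric] mult_minus_right) (simp add: ac_simps)
  finally show ?case by (simp only: list.map prod_list.Cons s[unfolded list.map])
qed

lemma newton_identity:
  fixes es :: "'a::field_char_0 list"
  assumes "k < length es"
  shows "of_nat (Suc k) * coeff (lin_prod es) (length es - Suc k)
    = - (\<Sum>j\<le>k. coeff (lin_prod es) (length es - j) * (\<Sum>e\<leftarrow>es. e ^ Suc (k - j)))"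
proof -
  have r: "(\<Prod>e\<leftarrow>es. 1 - fps_const e * fps_X) = fps_of_poly (reflect_poly (lin_prod es))"
  proof (induction es)
    case (Cons e es)
    have "reflect_poly [:- e, 1:] = [:1, - e:]"
      by (rule poly_eqI) (auto simp: coeff_reflect_poly coeff_pCons split: nat.splits)
    then have "reflect_poly (lin_prod (e # es)) = [:1, - e:] * reflect_poly (lin_prod es)"
      unfolding lin_prod_simps reflect_poly_mult by simp
    then show ?case using Cons by (simp add: fps_of_poly_mult fps_of_poly_simps algebra_simps fps_of_poly_linear)
  qed simp
  have c: "fps_nth (\<Prod>e\<leftarrow>es. 1 - fps_const e * fps_X) j = coeff (lin_prod es) (length es - j)"
    if "j \<le> length es" for j
    unfolding r using that by (simp add: coeff_reflect_poly)
  have "fps_nth (fps_deriv (\<Prod>e\<leftarrow>es. 1 - fps_const e * fps_X)) k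
    = fps_nth (- (\<Prod>e\<leftarrow>es. 1 - fps_const e * fps_X) * Abs_fps (\<lambda>k. \<Sum>e\<leftarrow>es. e ^ Suc k)) k"
    unfolding newton_fps ..
  then show ?thesis
    using assms c[of "Suc k"] by (simp add: fps_mult_nth c sum_negf atMost_atLeast0)
qed

section \<open>Primitive matrices\<close>

definition nat_entries :: "int mat \<Rightarrow> nat \<Rightarrow> nat \<Rightarrow> nat" where
  "nat_entries A i j = nat (A $$ (i, j))"

lemma nonneg_matD: "nonneg_mat A \<Longrightarrow> A \<in> carrier_mat n m \<Longrightarrow> i < n \<Longrightarrow> j < m \<Longrightarrow> 0 \<le> A $$ (i, j)"
  by (auto simp: nonneg_mat_def)

lemma pos_matD: "pos_mat A \<Longrightarrow> A \<in> carrier_mat n m \<Longrightarrow> i < n \<Longrightarrow> j < m \<Longrightarrow> 0 < A $$ (i, j)"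
  by (auto simp: pos_mat_def)

lemma mult_mat_entry:
  "A \<in> carrier_mat n n \<Longrightarrow> B \<in> carrier_mat n n \<Longrightarrow> i < n \<Longrightarrow> j < n \<Longrightarrow>
    (A * B) $$ (i, j) = (\<Sum>l<n. A $$ (i, l) * B $$ (l, j))"
  by (simp add: scalar_prod_def lessThan_atLeast0)

lemma nonneg_mat_mult:
  assumes "A \<in> carrier_mat n n" "B \<in> carrier_mat n n" "nonneg_mat A" "nonneg_mat B"
  shows "nonneg_mat (A * B)"
  unfolding nonneg_mat_def
proof (intro allI impI)
  fix i j assume ij: "i < dim_row (A * B)" "j < dim_col (A * B)"
  then have "(A * B) $$ (i, j) = (\<Sum>l<n. A $$ (i, l) * B $$ (l, j))"
    using assms by (intro mult_mat_entry) auto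
  also have "\<dots> \<ge> 0"
    using ij assms nonneg_matD by (intro sum_nonneg mult_nonneg_nonneg) (auto simp: nonneg_mat_def)
  finally show "0 \<le> (A * B) $$ (i, j)" .
qed

lemma nonneg_mat_pow:
  fixes A :: "'a::linordered_idom mat"
  assumes A: "A \<in> carrier_mat n n" "nonneg_mat A"
  shows "nonneg_mat (A ^\<^sub>m k)"
proof (induction k)
  case 0
  then show ?case by (auto simp: nonneg_mat_def one_mat_def)
next
  case (Suc k)
  then show ?case using A nonneg_mat_mult[of "A ^\<^sub>m k" n A] by simp
qed

lemma pow_pos_imp_arcs_rtrancl:
  assumes A: "A \<in> carrier_mat n n" "nonneg_mat A" and "i < n" "j < n" "0 < (A ^\<^sub>m k) $$ (i, j)"
  shows "(i, j) \<in> (arcs (nat_entries A) {0..<n})\<^sup>*"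
  using assms(3-)
proof (induction k arbitrary: j)
  case 0
  then show ?case using A by (auto split: if_splits)
next
  case (Suc k)
  have P: "A ^\<^sub>m k \<in> carrier_mat n n" using A by simp
  have "0 < (\<Sum>l<n. (A ^\<^sub>m k) $$ (i, l) * A $$ (l, j))"
    using Suc.prems mult_mat_entry[OF P A(1)] by simp
  then have "\<not> (\<forall>l\<in>{..<n}. (A ^\<^sub>m k) $$ (i, l) * A $$ (l, j) \<le> 0)"
    using sum_nonpos[of "{..<n}" "\<lambda>l. (A ^\<^sub>m k) $$ (i, l) * A $$ (l, j)"] by force
  then obtain l where l: "l < n" "0 < (A ^\<^sub>m k) $$ (i, l) * A $$ (l, j)"
    by (auto simp: not_le)
  moreover have "0 \<le> (A ^\<^sub>m k) $$ (i, l)" "0 \<le> A $$ (l, j)"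
    using nonneg_matD[OF nonneg_mat_pow[OF A] P] nonneg_matD[OF A(2,1)] Suc.prems l by auto
  ultimately have "0 < (A ^\<^sub>m k) $$ (i, l)" "0 < A $$ (l, j)"
    by (auto simp: zero_less_mult_iff)
  then have "(i, l) \<in> (arcs (nat_entries A) {0..<n})\<^sup>*" "(l, j) \<in> arcs (nat_entries A) {0..<n}"
    using Suc l by (auto simp: arcs_def nat_entries_def)
  then show ?case by (rule rtrancl_into_rtrancl)
qed

lemma primitive_arcs_rtrancl:
  assumes "A \<in> carrier_mat n n" "primitive_mat A" "i \<in> {0..<n}" "j \<in> {0..<n}"
  shows "(i, j) \<in> (arcs (nat_entries A) {0..<n})\<^sup>*"
proof -
  obtain k where "pos_mat (A ^\<^sub>m k)" using assms by (auto simp: primitive_mat_def)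
  then show ?thesis
    using assms pow_pos_imp_arcs_rtrancl[of A n i j k] pos_matD[of "A ^\<^sub>m k" n n i j]
    by (auto simp: primitive_mat_def)
qed

text \<open>One positive power makes all later ones positive: a zero column of \<open>A\<close>
  would survive in every power of positive exponent, so each column has a positive entry and
  multiplication by \<open>A\<close> preserves positivity.\<close>

lemma primitive_pow_pos:
  fixes A :: "int mat"
  assumes A: "A \<in> carrier_mat n n" "primitive_mat A" and n: "0 < n"
  obtains k where "\<And>m. m \<ge> k \<Longrightarrow> pos_mat (A ^\<^sub>m m)"
proof -
  have nn: "nonneg_mat A" using A by (simp add: primitive_mat_def)
  obtain k where k: "k \<ge> 1" "pos_mat (A ^\<^sub>m k)" using A by (auto simp: primitive_mat_def)
  obtain k' where k': "k = Suc k'" using k by (cases k) auto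
  have P: "A ^\<^sub>m m \<in> carrier_mat n n" for m using A by simp
  have col: "\<exists>l<n. 0 < A $$ (l, j)" if "j < n" for j
  proof (rule ccontr)
    assume "\<not> (\<exists>l<n. 0 < A $$ (l, j))"
    then have "A $$ (l, j) = 0" if "l < n" for l
      using nonneg_matD[OF nn A(1) that \<open>j < n\<close>] that by force
    then have "(A ^\<^sub>m k) $$ (0, j) = 0"
      using mult_mat_entry[OF P A(1) n \<open>j < n\<close>, of k'] by (simp add: k')
    then show False using pos_matD[OF k(2) P n \<open>j < n\<close>] by simp
  qed
  have "pos_mat (A ^\<^sub>m (k + m))" for m
  proof (induction m)
    case (Suc m)
    have "0 < (A ^\<^sub>m (k + m) * A) $$ (i, j)" if ij: "i < n" "j < n" for i j
    proof -
      obtain l where "l < n" "0 < A $$ (l, j)" using col ij by blast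
      then have "0 < (\<Sum>l<n. (A ^\<^sub>m (k + m)) $$ (i, l) * A $$ (l, j))"
        using pos_matD[OF Suc P] nonneg_matD[OF nn A(1)] ij
        by (intro sum_pos2[of _ l]) (auto simp: less_imp_le)
      then show ?thesis using mult_mat_entry[OF P A(1) ij] by simp
    qed
    then show ?case using A unfolding pos_mat_def by simp
  qed (use k in simp)
  then show thesis using that[of k] le_Suc_ex by metis
qed

lemma mtrace_of_int:
  "mtrace (map_mat of_int A :: 'a::ring_1 mat) = of_int (mtrace A)" if "A \<in> carrier_mat n n"
  using that by (simp add: mtrace_def)

lemma mtrace_pow_of_int:
  assumes "A \<in> carrier_mat n n"
  shows "mtrace ((complex_mat A) ^\<^sub>m k) = of_int (mtrace (A ^\<^sub>m k))"
  by (subst of_int_hom.mat_hom_pow[OF assms, symmetric]) (rule mtrace_of_int[of _ n], use assms in simp)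

lemma primitive_mtrace_pos:
  fixes A :: "int mat"
  assumes A: "A \<in> carrier_mat n n" "primitive_mat A" and n: "0 < n"
  obtains k where "\<And>m. m \<ge> k \<Longrightarrow> 0 < mtrace (A ^\<^sub>m m)"
proof -
  obtain k where k: "\<And>m. m \<ge> k \<Longrightarrow> pos_mat (A ^\<^sub>m m)" using primitive_pow_pos[OF assms] by blast
  have "0 < mtrace (A ^\<^sub>m m)" if "m \<ge> k" for m
    unfolding mtrace_def using k[OF that] A n by (intro sum_pos) (auto simp: pos_mat_def lessThan_empty_iff)
  then show thesis using that by blast
qed

section \<open>Characteristic polynomial and spectral radius\<close>

definition real_char_poly :: "int mat \<Rightarrow> real poly" where
  "real_char_poly A = char_poly (map_mat of_int A)"

lemma complex_char_poly:
  assumes "A \<in> carrier_mat n n"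
  shows "char_poly (complex_mat A) = map_poly of_real (real_char_poly A)"
proof -
  have "complex_mat A = map_mat of_real (map_mat of_int A :: real mat)"
    by (rule eq_matI) auto
  then show ?thesis
    unfolding real_char_poly_def using of_real_hom.char_poly_hom[of "map_mat of_int A" n] assms by simp
qed

lemma real_root_imp_complex_root:
  assumes "A \<in> carrier_mat n n"
  shows "poly (char_poly (complex_mat A)) (of_real x) = of_real (poly (real_char_poly A) x)"
  unfolding complex_char_poly[OF assms] by simp

lemma root_le_spectral_radius:
  assumes "A \<in> carrier_mat n n" "poly (char_poly A) z = 0"
  shows "norm z \<le> spectral_radius A"
proof (cases "n = 0")
  case True
  then show ?thesis using assms degree_monic_char_poly[OF assms(1)] by (auto elim!: degree_eq_zeroE)
next
  case False
  then show ?thesis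
    using assms spectrum_root_char_poly[OF assms(1)] by (intro spectral_radius_mem_max(2)[OF assms(1)]) auto
qed

lemma spectral_radius_root:
  assumes "A \<in> carrier_mat n n" "0 < n"
  obtains z where "poly (char_poly A) z = 0" "norm z = spectral_radius A"
  using spectral_radius_mem_max(1)[OF assms] spectrum_root_char_poly[OF assms(1)] by auto

lemma pdet_walk_mat_char_poly:
  assumes A: "A \<in> carrier_mat n n" "nonneg_mat A" and s: "s \<noteq> 0"
  shows "pdet (walk_mat (nat_entries A) s) {0..<n} = s ^ n * poly (real_char_poly A) (1 / s)"
proof -
  let ?B = "map_mat of_int A :: real mat"
  let ?M = "mat n n (\<lambda>(i, j). walk_mat (nat_entries A) s i j)"
  have B: "?B \<in> carrier_mat n n" using A by simp
  have M: "?M = s \<cdot>\<^sub>m (- char_matrix ?B (1 / s))"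
    using A s by (intro eq_matI) (auto simp: char_matrix_def walk_mat_def nat_entries_def nonneg_mat_def right_diff_distrib)
  have "pdet (walk_mat (nat_entries A) s) {0..<n} = pdet (\<lambda>i j. ?M $$ (i, j)) {0..<n}"
    by (rule pdet_cong) simp
  also have "\<dots> = det ?M" by (rule det_eq_pdet[symmetric]) simp
  also have "\<dots> = s ^ n * det (- char_matrix ?B (1 / s))"
    unfolding M det_smult using B by (simp add: char_matrix_def)
  finally show ?thesis
    using char_poly_matrix[OF B] by (simp add: real_char_poly_def)
qed

lemma pdet_walk_mat_0:
  fixes S :: "'a::linorder set"
  assumes "finite S"
  shows "pdet (walk_mat a 0) S = 1"
proof -
  have "clen C \<noteq> 0" if "C \<in> cycles a S" for C
    using that by (auto simp: cycles_def clen_def)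
  then show ?thesis
    unfolding pdet_walk_mat_eq_clique_poly[OF assms] using assms by (intro clique_poly_eq_1) auto
qed

text \<open>Starting from 1 at \<open>s = 0\<close>, the determinant can lose positivity only
  through a zero \<open>r \<le> s\<close>; then \<open>1 / r\<close> is an eigenvalue larger than
  the spectral radius.\<close>

lemma pdet_walk_mat_pos:
  assumes A: "A \<in> carrier_mat n n" "nonneg_mat A" and s: "0 \<le> s" "s * spectral_radius (complex_mat A) < 1"
  shows "0 < pdet (walk_mat (nat_entries A) s) {0..<n}"
proof (rule ccontr)
  let ?f = "\<lambda>s. pdet (walk_mat (nat_entries A) s) {0..<n}"
  assume neg: "\<not> 0 < ?f s"
  have "continuous_on {0..s} ?f"
    unfolding pdet_walk_mat_eq_clique_poly[OF finite_atLeastLessThan]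
    by (intro continuous_on_clique_poly continuous_intros)
  then obtain r where r: "0 \<le> r" "r \<le> s" "?f r = 0"
    using IVT2'[of ?f s 0 0] neg s(1) pdet_walk_mat_0[of "{0..<n}" "nat_entries A"] by auto
  then have r0: "r \<noteq> 0" using pdet_walk_mat_0[of "{0..<n}" "nat_entries A"] by auto
  then have "poly (real_char_poly A) (1 / r) = 0"
    using r(3) pdet_walk_mat_char_poly[OF A r0] by simp
  then have "poly (char_poly (complex_mat A)) (of_real (1 / r)) = 0"
    using real_root_imp_complex_root[OF A(1), of "1 / r"] by simp
  then have "norm (complex_of_real (1 / r)) \<le> spectral_radius (complex_mat A)"
    using A(1) by (intro root_le_spectral_radius[of _ n]) auto
  then have "1 / r \<le> spectral_radius (complex_mat A)" using r by (simp add: norm_divide)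
  then have "1 \<le> r * spectral_radius (complex_mat A)" using r r0 by (simp add: field_simps)
  also have "\<dots> \<le> s * spectral_radius (complex_mat A)"
    using r r0 \<open>1 / r \<le> _\<close> by (intro mult_right_mono) (auto intro: order_trans[of 0 "1 / r"])
  finally show False using s by simp
qed

section \<open>The bound for reciprocal matrices\<close>

lemma carrier_GL_int: "A \<in> GL_int n \<Longrightarrow> A \<in> carrier_mat n n"
  by (simp add: GL_int_def)

lemma eigenvalue_mset_lin_prod: "char_poly A = lin_prod es \<Longrightarrow> eigenvalue_mset A = mset es"
  by (simp add: eigenvalue_mset_def)

lemma real_char_poly_invert:
  assumes A: "A \<in> carrier_mat n n" and "0 \<notin># eigenvalue_mset (complex_mat A)"
    and "image_mset (\<lambda>t. of_real s * inverse t) (eigenvalue_mset (complex_mat A)) = eigenvalue_mset (complex_mat A)"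
    and "x \<noteq> 0"
  shows "x ^ n * poly (real_char_poly A) (s / x) = poly (real_char_poly A) 0 * poly (real_char_poly A) x"
proof -
  have cA: "complex_mat A \<in> carrier_mat n n" using A by simp
  obtain es where es: "char_poly (complex_mat A) = lin_prod es" "length es = n"
    using char_poly_lin_prod[OF cA] .
  have "of_real x ^ length es * poly (lin_prod es) (of_real s / of_real x) = poly (lin_prod es) 0 * poly (lin_prod es) (complex_of_real x)"
    by (rule invariant_imp_poly) (use assms es in \<open>simp_all add: eigenvalue_mset_lin_prod[OF es(1)]\<close>)
  then have "complex_of_real (x ^ n * poly (real_char_poly A) (s / x)) = of_real (poly (real_char_poly A) 0 * poly (real_char_poly A) x)"
    using es real_root_imp_complex_root[OF A, of "s / x"] real_root_imp_complex_root[OF A, of x]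
      real_root_imp_complex_root[OF A, of 0] by simp
  then show ?thesis by (simp only: of_real_eq_iff)
qed

lemma real_char_poly_neq_0: "real_char_poly A \<noteq> 0" if "A \<in> carrier_mat n n"
  using degree_monic_char_poly[of "map_mat of_int A :: real mat" n] that unfolding real_char_poly_def by auto

text \<open>The weak inequality between \<open>t\<close> and the spectral radius serves two
  purposes: a strict one leads to the lower bound, and equality gives the polynomial that has to be
  excluded for \<open>g = 2\<close>.\<close>

lemma reciprocal_char_poly:
  assumes A: "A \<in> carrier_mat (2 * g) (2 * g)" "primitive_mat A" "reciprocal_mat (complex_mat A)" and g: "0 < g"
    and \<rho>: "1 < spectral_radius (complex_mat A)"
    and t: "0 < t" "t ^ g = (3 - sqrt 5) / 2" "t * spectral_radius (complex_mat A) \<le> 1"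
  shows "real_char_poly A = monom 1 (2 * g) - monom 3 g + 1"
proof -
  let ?a = "nat_entries A" and ?p = "real_char_poly A"
  let ?f = "\<lambda>s. pdet (walk_mat ?a s) {0..<2 * g}"
  have nn: "nonneg_mat A" using A by (simp add: primitive_mat_def)
  note f = pdet_walk_mat_char_poly[OF A(1) nn]
  have inv: "x ^ (2 * g) * poly ?p (1 / x) = poly ?p 0 * poly ?p x" if "x \<noteq> 0" for x
    using A that unfolding reciprocal_mat_def by (intro real_char_poly_invert) auto
  \<comment> \<open>Inverting \<open>x\<close> twice multiplies \<open>poly ?p x\<close> by the
    square of the constant term; a point where the polynomial does not vanish gives the
    claim.\<close>
  have "poly ?p 0 * poly ?p 0 = 1"
  proof -
    have "finite {x. poly ?p x = 0}" using real_char_poly_neq_0[OF A(1)] by (rule poly_roots_finite)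
    then obtain x where x: "x > 0" "poly ?p x \<noteq> 0"
      using infinite_Ioi[of "0::real"] by (metis (mono_tags, lifting) finite_subset greaterThan_iff mem_Collect_eq subsetI)
    have "poly ?p x = (1 / x) ^ (2 * g) * poly ?p (1 / (1 / x)) * x ^ (2 * g)"
      using x by (simp add: power_divide)
    also have "\<dots> = poly ?p 0 * (x ^ (2 * g) * poly ?p (1 / x))"
      using inv[of "1 / x"] x by simp
    also have "\<dots> = poly ?p 0 * poly ?p 0 * poly ?p x"
      using inv[of x] x by simp
    finally show ?thesis using x by simp
  qed
  then have eps: "poly ?p 0 = 1 \<or> poly ?p 0 = - 1" by (simp add: square_eq_1_iff)
  have r: "?f x = poly ?p 0 * x ^ (2 * g) * ?f (1 / x)" if "x > 0" for x
  proof -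
    have "?f x = poly ?p 0 * poly ?p x" using f[of x] inv[of x] that by simp
    also have "\<dots> = poly ?p 0 * (x ^ (2 * g) * ?f (1 / x))"
      using f[of "1 / x"] that by (simp add: power_divide)
    finally show ?thesis by simp
  qed
  have pos: "0 < ?f s" if "0 \<le> s" "s < t" for s
  proof (rule pdet_walk_mat_pos[OF A(1) nn that(1)])
    have "s * spectral_radius (complex_mat A) < t * spectral_radius (complex_mat A)"
      using that \<rho> by simp
    then show "s * spectral_radius (complex_mat A) < 1" using t by simp
  qed
  have alt: "(\<forall>x. ?f x = 1 - x ^ (2 * g)) \<or> (\<forall>x. ?f x = 1 - 3 * x ^ g + x ^ (2 * g))"
  proof (rule reciprocal_bound)
    show "(i, j) \<in> (arcs ?a {0..<2 * g})\<^sup>*" if "i \<in> {0..<2 * g}" "j \<in> {0..<2 * g}" for i j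
      using primitive_arcs_rtrancl[OF A(1,2) that] .
    show "0 < pdet (walk_mat ?a s) {0..<2 * g}" if "0 \<le> s" "s < t" for s using pos[OF that] .
    show "?f x = poly ?p 0 * x ^ (2 * g) * ?f (1 / x)" if "x > 0" for x using r[OF that] .
  qed (use g t eps in auto)
  have p: "poly ?p x = x ^ (2 * g) * ?f (1 / x)" if "x > 0" for x
    using f[of "1 / x"] that by (simp add: power_divide)
  show ?thesis
  proof (cases "\<forall>x. ?f x = 1 - x ^ (2 * g)")
    case True
    have "?p = monom 1 (2 * g) - 1"
    proof (rule poly_eqI_pos)
      fix x :: real assume x: "x > 0"
      have "x ^ (2 * g) * (1 / x) ^ (2 * g) = 1" using x by (simp add: power_divide)
      then show "poly ?p x = poly (monom 1 (2 * g) - 1) x"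
        unfolding p[OF x] True[rule_format] by (simp add: poly_monom right_diff_distrib del: power_one_over)
    qed
    then have cp: "char_poly (complex_mat A) = monom 1 (2 * g) - 1"
      unfolding complex_char_poly[OF A(1)] by (intro poly_eqI) (auto simp: coeff_map_poly)
    obtain z where z: "poly (char_poly (complex_mat A)) z = 0" "norm z = spectral_radius (complex_mat A)"
      using spectral_radius_root[of "complex_mat A" "2 * g"] A(1) g by auto
    then have "z ^ (2 * g) = 1" unfolding cp by (simp add: poly_monom)
    then have "norm z ^ (2 * g) = 1" by (metis norm_one norm_power)
    moreover have "1 < norm z ^ (2 * g)" using z \<rho> g by (intro one_less_power) auto
    ultimately show ?thesis by simp
  next
    case False
    then have *: "?f x = 1 - 3 * x ^ g + x ^ (2 * g)" for x using alt by blast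
    show ?thesis
    proof (rule poly_eqI_pos)
      fix x :: real assume x: "x > 0"
      have "x ^ (2 * g) * (1 / x) ^ g = x ^ g" using x by (simp add: mult_2 power_add power_divide)
      moreover have "x ^ (2 * g) * (1 / x) ^ (2 * g) = 1" using x by (simp add: power_divide)
      ultimately show "poly ?p x = poly (monom 1 (2 * g) - monom 3 g + 1) x"
        unfolding p[OF x] * by (simp add: poly_monom right_diff_distrib distrib_left mult.left_commute[of _ 3] del: power_one_over)
    qed
  qed
qed

text \<open>A smaller radius would force the extremal polynomial, but that one has
  \<open>1 / t\<close> as a root.\<close>

lemma reciprocal_spectral_radius_ge:
  assumes A: "A \<in> carrier_mat (2 * g) (2 * g)" "primitive_mat A" "reciprocal_mat (complex_mat A)" and g: "0 < g"
    and \<rho>: "1 < spectral_radius (complex_mat A)"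
    and t: "0 < t" "t ^ g = (3 - sqrt 5) / 2"
  shows "1 / t \<le> spectral_radius (complex_mat A)"
proof (rule ccontr)
  assume "\<not> 1 / t \<le> spectral_radius (complex_mat A)"
  then have lt: "spectral_radius (complex_mat A) < 1 / t" by simp
  then have "t * spectral_radius (complex_mat A) \<le> 1" using t(1) by (simp add: field_simps)
  then have p: "real_char_poly A = monom 1 (2 * g) - monom 3 g + 1"
    using reciprocal_char_poly[OF A g \<rho> t] by simp
  define y where "y = (3 - sqrt 5) / 2"
  have "y * y = 3 * y - 1" by (simp add: y_def field_simps)
  moreover have "sqrt 5 < 3" by (rule real_less_lsqrt) auto
  then have "y > 0" by (simp add: y_def)
  ultimately have "(1 / y)\<^sup>2 - 3 * (1 / y) + 1 = 0" by (simp add: field_simps power2_eq_square)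
  then have "((1 / t) ^ g)\<^sup>2 - 3 * (1 / t) ^ g + 1 = 0" unfolding power_one_over t(2) y_def .
  then have "poly (real_char_poly A) (1 / t) = 0"
    unfolding p by (simp add: poly_monom power_mult[symmetric] mult.commute)
  then have "poly (char_poly (complex_mat A)) (of_real (1 / t)) = 0"
    using real_root_imp_complex_root[OF A(1), of "1 / t"] by simp
  then have "norm (complex_of_real (1 / t)) \<le> spectral_radius (complex_mat A)"
    using A(1) by (intro root_le_spectral_radius[of _ "2 * g"]) auto
  then show False using lt t(1) by (simp add: norm_divide)
qed

section \<open>Trace estimates\<close>

lemma complex_char_poly_int:
  assumes "A \<in> carrier_mat n n"
  shows "char_poly (complex_mat A) = map_poly of_int (char_poly A)"
  using of_int_hom.char_poly_hom[OF assms] .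

lemma real_char_poly_int:
  assumes "A \<in> carrier_mat n n"
  shows "real_char_poly A = map_poly of_int (char_poly A)"
  unfolding real_char_poly_def using of_int_hom.char_poly_hom[OF assms] .

lemma int_recurrence:
  fixes A :: "int mat"
  assumes A: "A \<in> carrier_mat n n"
  shows "(\<Sum>i\<le>n. coeff (char_poly A) i * mtrace (A ^\<^sub>m (k + i))) = 0"
proof -
  have cA: "complex_mat A \<in> carrier_mat n n" using A by simp
  obtain es where es: "char_poly (complex_mat A) = lin_prod es" "length es = n"
    using char_poly_lin_prod[OF cA] .
  have N: "(\<Sum>e\<leftarrow>es. e ^ k) = of_int (mtrace (A ^\<^sub>m k))" for k
    using mtrace_pow_eq_power_sum[OF cA es(1), of k] mtrace_pow_of_int[OF A, of k] by simp
  have c: "coeff (lin_prod es) i = of_int (coeff (char_poly A) i)" for i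
    unfolding es(1)[symmetric] complex_char_poly_int[OF A] by (simp add: coeff_map_poly)
  have "complex_of_int (\<Sum>i\<le>n. coeff (char_poly A) i * mtrace (A ^\<^sub>m (k + i))) = of_int 0"
    using power_sum_recurrence[of es k] unfolding N c es(2) by simp
  then show ?thesis by (simp only: of_int_eq_iff)
qed

lemma int_newton:
  fixes A :: "int mat"
  assumes A: "A \<in> carrier_mat n n" and k: "k < n"
  shows "int (Suc k) * coeff (char_poly A) (n - Suc k)
    = - (\<Sum>j\<le>k. coeff (char_poly A) (n - j) * mtrace (A ^\<^sub>m Suc (k - j)))"
proof -
  have cA: "complex_mat A \<in> carrier_mat n n" using A by simp
  obtain es where es: "char_poly (complex_mat A) = lin_prod es" "length es = n"
    using char_poly_lin_prod[OF cA] .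
  have N: "(\<Sum>e\<leftarrow>es. e ^ k) = of_int (mtrace (A ^\<^sub>m k))" for k
    using mtrace_pow_eq_power_sum[OF cA es(1), of k] mtrace_pow_of_int[OF A, of k] by simp
  have c: "coeff (lin_prod es) i = of_int (coeff (char_poly A) i)" for i
    unfolding es(1)[symmetric] complex_char_poly_int[OF A] by (simp add: coeff_map_poly)
  have "complex_of_int (int (Suc k) * coeff (char_poly A) (n - Suc k))
    = of_int (- (\<Sum>j\<le>k. coeff (char_poly A) (n - j) * mtrace (A ^\<^sub>m Suc (k - j))))"
    using newton_identity[of k es] k unfolding N c es(2) by (simp del: pow_mat.simps)
  then show ?thesis by (simp only: of_int_eq_iff)
qed

lemma char_poly_monic: "coeff (char_poly A) n = 1" if "A \<in> carrier_mat n n"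
  using degree_monic_char_poly[OF that] by simp

lemma primitive_mtrace_nonzero:
  fixes A :: "int mat"
  assumes "A \<in> carrier_mat n n" "primitive_mat A" "0 < n" and "\<And>k. mtrace (A ^\<^sub>m (m * k + 1)) = 0" "0 < m"
  shows False
proof -
  obtain k where "\<And>m. m \<ge> k \<Longrightarrow> 0 < mtrace (A ^\<^sub>m m)" using primitive_mtrace_pos[OF assms(1-3)] by blast
  moreover have "k \<le> m * k + 1" using assms(5) by (cases m) auto
  ultimately have "0 < mtrace (A ^\<^sub>m (m * k + 1))" by blast
  then show False using assms(4)[of k] by simp
qed

lemma reciprocal_spectral_radius_4:
  assumes A: "A \<in> carrier_mat 4 4" "primitive_mat A" "reciprocal_mat (complex_mat A)"
    and \<rho>: "1 < spectral_radius (complex_mat A)"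
    and t: "0 < t" "t ^ 2 = (3 - sqrt 5) / 2"
  shows "1 / t < spectral_radius (complex_mat A)"
proof (rule ccontr)
  assume "\<not> 1 / t < spectral_radius (complex_mat A)"
  then have "t * spectral_radius (complex_mat A) \<le> 1" using t(1) by (simp add: field_simps)
  then have "real_char_poly A = monom 1 4 - monom 3 2 + 1"
    using reciprocal_char_poly[of A 2 t] A \<rho> t by simp
  then have "real_of_int (coeff (char_poly A) i) = coeff (monom 1 4 - monom 3 2 + 1 :: real poly) i" for i
    unfolding real_char_poly_int[OF A(1)] by (metis coeff_map_poly of_int_0)
  then have c: "coeff (char_poly A) 0 = 1" "coeff (char_poly A) 1 = 0" "coeff (char_poly A) 2 = - 3"
    "coeff (char_poly A) 3 = 0" "coeff (char_poly A) 4 = 1"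
    by (simp_all add: eq_neg_iff_add_eq_0 flip: of_int_eq_iff[where 'a = real])
  let ?M = "\<lambda>k. mtrace (A ^\<^sub>m k)"
  have m1: "?M 1 = 0" using int_newton[OF A(1), of 0] c by (simp del: pow_mat.simps)
  have m3: "?M 3 = 0" using int_newton[OF A(1), of 2] c m1
    by (simp del: pow_mat.simps add: atMost_Suc numeral_2_eq_2 numeral_3_eq_3)
  have rec: "?M (k + 4) = 3 * ?M (k + 2) - ?M k" for k
    using int_recurrence[OF A(1), of k] c by (simp del: pow_mat.simps add: eval_nat_numeral atMost_Suc)
  have "?M (2 * k + 1) = 0 \<and> ?M (2 * k + 3) = 0" for k
  proof (induction k)
    case (Suc k)
    then show ?case using rec[of "2 * k + 1"] by (simp del: pow_mat.simps add: eval_nat_numeral)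
  qed (use m1 m3 in simp)
  then show False using primitive_mtrace_nonzero[OF A(1,2), of 2] by simp
qed

section \<open>Lower and upper bounds for traces of powers\<close>

lemma pow_mat_add:
  fixes A :: "'a::semiring_1 mat"
  assumes "A \<in> carrier_mat n n"
  shows "A ^\<^sub>m (k + l) = A ^\<^sub>m k * A ^\<^sub>m l"
proof (induction l)
  case (Suc l)
  have "A ^\<^sub>m k * A ^\<^sub>m l * A = A ^\<^sub>m k * (A ^\<^sub>m l * A)"
    using assms by (intro assoc_mult_mat[of _ n n _ n _ n]) auto
  then show ?case using Suc by simp
qed (use assms in simp)

lemma pow_mat_mult:
  fixes A :: "'a::semiring_1 mat"
  assumes "A \<in> carrier_mat n n"
  shows "A ^\<^sub>m (k * m) = (A ^\<^sub>m k) ^\<^sub>m m"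
proof (induction m)
  case (Suc m)
  have "A ^\<^sub>m (k * Suc m) = A ^\<^sub>m (k * m + k)" by (simp add: add.commute)
  then show ?case using Suc pow_mat_add[OF assms] by simp
qed (use assms in simp)

lemma mtrace_nonneg: "nonneg_mat A \<Longrightarrow> A \<in> carrier_mat n n \<Longrightarrow> 0 \<le> mtrace A"
  unfolding mtrace_def by (intro sum_nonneg) (auto simp: nonneg_mat_def)

text \<open>Integrality enters here: a nonnegative integer is at most its \<open>m\<close>-th power,
  which is the contribution to \<open>A ^\<^sub>m m\<close> of repeating a loop \<open>m\<close>
  times.\<close>

lemma mtrace_pow_ge:
  fixes A :: "int mat"
  assumes A: "A \<in> carrier_mat n n" "nonneg_mat A" and m: "0 < m"
  shows "mtrace A \<le> mtrace (A ^\<^sub>m m)"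
proof -
  have P: "A ^\<^sub>m m \<in> carrier_mat n n" for m using A by simp
  have d: "(A $$ (i, i)) ^ m \<le> (A ^\<^sub>m m) $$ (i, i)" if i: "i < n" for i m
  proof (induction m)
    case (Suc m)
    have "(A $$ (i, i)) ^ Suc m \<le> (A ^\<^sub>m m) $$ (i, i) * A $$ (i, i)"
      using Suc nonneg_matD[OF A(2,1) i i] by (simp add: mult.commute mult_left_mono)
    also have "\<dots> \<le> (\<Sum>l<n. (A ^\<^sub>m m) $$ (i, l) * A $$ (l, i))"
      using nonneg_matD[OF nonneg_mat_pow[OF A] P] nonneg_matD[OF A(2,1)] i
      by (intro member_le_sum mult_nonneg_nonneg) auto
    also have "\<dots> = (A ^\<^sub>m Suc m) $$ (i, i)" using mult_mat_entry[OF P A(1) i i] by simp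
    finally show ?case .
  qed (use A that in simp)
  have "A $$ (i, i) \<le> (A ^\<^sub>m m) $$ (i, i)" if i: "i < n" for i
  proof -
    have "A $$ (i, i) \<le> (A $$ (i, i)) ^ m"
      using nonneg_matD[OF A(2,1) i i] m by (cases "A $$ (i, i) = 0") (auto intro: self_le_power)
    then show ?thesis using d[OF i, of m] by simp
  qed
  then show ?thesis using A unfolding mtrace_def by (auto intro!: sum_mono)
qed

lemma mtrace_pow_mult_ge:
  fixes A :: "int mat"
  assumes A: "A \<in> carrier_mat n n" "nonneg_mat A" and m: "0 < m"
  shows "mtrace (A ^\<^sub>m k) \<le> mtrace (A ^\<^sub>m (k * m))"
  using mtrace_pow_ge[of "A ^\<^sub>m k" n m] nonneg_mat_pow[OF A] A m pow_mat_mult[OF A(1)] by simp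

lemma add_inverse_le:
  fixes x r :: real
  assumes "1 / r \<le> x" "x \<le> r" "0 < r"
  shows "x + inverse x \<le> r + 1 / r"
proof -
  have x: "x > 0" using assms by (smt (verit) divide_pos_pos)
  have "1 \<le> x * r" using assms x by (simp add: field_simps)
  then have "0 \<le> (r - x) * (x * r - 1) / (x * r)" using assms x by (intro divide_nonneg_pos mult_nonneg_nonneg) auto
  also have "\<dots> = (r + 1 / r) - (x + inverse x)" using assms x by (simp add: field_simps)
  finally show ?thesis by simp
qed

lemma norm_sum_list_le: "norm (\<Sum>x\<leftarrow>xs. f x :: 'a::real_normed_vector) \<le> (\<Sum>x\<leftarrow>xs. norm (f x))"
  by (induction xs) (auto intro: norm_triangle_mono)

text \<open>The moduli are invariant under inversion, so the sum of their \<open>k\<close>-th powers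
  is the average of itself and the sum of the inverses. Each \<open>x + 1 / x\<close> with
  \<open>1 / r ^ k \<le> x \<le> r ^ k\<close> is largest at the ends, which nearly halves the naive
  bound \<open>n * r ^ k\<close> for large \<open>r ^ k\<close>.\<close>

lemma mtrace_pow_le:
  fixes A :: "int mat"
  assumes A: "A \<in> carrier_mat n n" "skew_reciprocal_mat (complex_mat A)"
    and r: "0 < r" "spectral_radius (complex_mat A) \<le> r"
  shows "2 * real_of_int (mtrace (A ^\<^sub>m k)) \<le> n * (r ^ k + 1 / r ^ k)"
proof -
  have cA: "complex_mat A \<in> carrier_mat n n" using A by simp
  obtain es where es: "char_poly (complex_mat A) = lin_prod es" "length es = n"
    using char_poly_lin_prod[OF cA] .
  have inv: "0 \<notin> set es" "image_mset (\<lambda>t. - inverse t) (mset es) = mset es"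
    using A(2) by (auto simp: skew_reciprocal_mat_def eigenvalue_mset_lin_prod[OF es(1)])
  have le: "norm e \<le> r" if "e \<in> set es" for e
  proof -
    have "poly (char_poly (complex_mat A)) e = 0"
      unfolding es(1) using that by (auto simp: poly_lin_prod prod_list_zero_iff)
    then show ?thesis using root_le_spectral_radius[OF cA] r by force
  qed
  have ge: "1 / r \<le> norm e" if e: "e \<in> set es" for e
  proof -
    have "- inverse e \<in># image_mset (\<lambda>t. - inverse t) (mset es)" using e by auto
    then have "- inverse e \<in> set es" unfolding inv(2) by simp
    then have "inverse (norm e) \<le> r" using le[of "- inverse e"] by (simp add: norm_inverse)
    moreover have "0 < norm e" using e inv(1) by auto
    ultimately show ?thesis using r by (simp add: field_simps)
  qed
  have "of_int (mtrace (A ^\<^sub>m k)) = (\<Sum>e\<leftarrow>es. e ^ k)"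
    using mtrace_pow_eq_power_sum[OF cA es(1), of k] mtrace_pow_of_int[OF A(1), of k] by simp
  then have "norm (complex_of_int (mtrace (A ^\<^sub>m k))) \<le> (\<Sum>e\<leftarrow>es. norm (e ^ k))"
    using norm_sum_list_le by metis
  then have 1: "real_of_int (mtrace (A ^\<^sub>m k)) \<le> (\<Sum>e\<leftarrow>es. norm e ^ k)"
    by (simp add: norm_power)
  have "(\<Sum>e\<leftarrow>es. norm e ^ k) = (\<Sum>e\<in>#image_mset (\<lambda>t. - inverse t) (mset es). norm e ^ k)"
    unfolding inv(2) by (simp add: sum_mset_sum_list[symmetric])
  also have "\<dots> = (\<Sum>e\<leftarrow>es. inverse (norm e ^ k))"
    by (simp add: image_mset.compositionality o_def norm_inverse power_inverse sum_mset_sum_list[symmetric])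
  finally have "2 * (\<Sum>e\<leftarrow>es. norm e ^ k) = (\<Sum>e\<leftarrow>es. norm e ^ k + inverse (norm e ^ k))"
    by (simp add: sum_list_addf)
  also have "\<dots> \<le> (\<Sum>e\<leftarrow>es. r ^ k + 1 / r ^ k)"
  proof (rule sum_list_mono)
    fix e assume e: "e \<in> set es"
    have "(1 / r) ^ k \<le> norm e ^ k" using ge[OF e] r by (intro power_mono) auto
    moreover have "norm e ^ k \<le> r ^ k" using le[OF e] by (intro power_mono) auto
    ultimately show "norm e ^ k + inverse (norm e ^ k) \<le> r ^ k + 1 / r ^ k"
      using r by (intro add_inverse_le) (auto simp: power_divide)
  qed
  also have "\<dots> = n * (r ^ k + 1 / r ^ k)" using es(2) by (simp add: sum_list_triv)
  finally show ?thesis using 1 by simp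
qed

lemma skew_coefficients:
  fixes a b c d e f :: int and p :: "real poly"
  assumes p: "p = [:of_int f, of_int e, of_int d, of_int c, of_int b, of_int a, 1:]"
    and inv: "\<And>x. x \<noteq> 0 \<Longrightarrow> x ^ 6 * poly p (- 1 / x) = poly p 0 * poly p x"
  shows "f * f = 1" "- a = f * e" "b = f * d" "- c = f * c"
proof -
  have "Polynomial.smult (of_int f) p = [:1, - of_int a, of_int b, - of_int c, of_int d, - of_int e, of_int f:]"
  proof (rule poly_eqI_nonzero)
    fix x :: real assume x: "x \<noteq> 0"
    have "poly (Polynomial.smult (of_int f) p) x = x ^ 6 * poly p (- 1 / x)"
      using inv[OF x] unfolding poly_smult by (simp only: p poly_pCons mult_zero_left add_0_right)
    also have "\<dots> = poly [:1, - of_int a, of_int b, - of_int c, of_int d, - of_int e, of_int f:] x"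
      using x by (simp add: p field_simps eval_nat_numeral)
    finally show "poly (Polynomial.smult (of_int f) p) x
      = poly [:1, - of_int a, of_int b, - of_int c, of_int d, - of_int e, of_int f:] x" .
  qed
  then have "real_of_int (f * f) = of_int 1" "real_of_int (f * e) = of_int (- a)" "real_of_int (f * d) = of_int b"
      "real_of_int (f * c) = of_int (- c)"
    by (simp_all add: p)
  then show "f * f = 1" "- a = f * e" "b = f * d" "- c = f * c"
    by (simp_all only: of_int_eq_iff)
qed

section \<open>Skew-reciprocal matrices of size six\<close>

text \<open>For a characteristic polynomial \<open>X^6 + a X^5 + b X^4 + c X^3 + d X^2 + e X + f\<close> everything is
  determined by \<open>f\<close> and the first three traces \<open>m1\<close>, \<open>m2\<close>, \<open>m3\<close>. The last condition is
  \<open>10 ^ 12\<close> times the value at \<open>1.41\<close>.\<close>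

definition skew_six_check :: "int \<Rightarrow> int \<Rightarrow> int \<Rightarrow> int \<Rightarrow> bool" where
  "skew_six_check f m1 m2 m3 \<longleftrightarrow>
    (let a = - m1; b = (m1 * m1 - m2) div 2; c = (m1 * m2 - m3 - b * m1) div 3; d = f * b; e = f * m1;
         m4 = m1 * m3 - 4 * d - b * m2 - c * m1; m5 = m1 * m4 - 5 * e - b * m3 - c * m2 - d * m1
     in (a = 0 \<and> (c = 0 \<or> b = 0)) \<or> m1 * m1 - m2 \<noteq> 2 * b \<or> m1 * m2 - m3 - b * m1 \<noteq> 3 * c \<or> - c \<noteq> f * c
       \<or> m4 < m2 \<or> 12 < m4 \<or> m5 < m1 \<or> 17 < m5
       \<or> 7858047974841 + 5573083670100 * a + 3952541610000 * b + 2803221000000 * c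
           + 1988100000000 * d + 1410000000000 * e + 1000000000000 * f \<le> 0)"

lemma skew_six_check:
  "\<forall>f\<in>set [1, -1]. \<forall>m1\<in>set [0..6]. \<forall>m2\<in>set [0..7]. \<forall>m3\<in>set [0..9]. skew_six_check f m1 m2 m3"
  by code_simp


text \<open>Together with the symmetry of the coefficients, the conclusion says that the polynomial
  is one in \<open>X^2\<close> or one in \<open>X^3\<close>: \<open>a = 0\<close> gives
  \<open>e = 0\<close>, and \<open>b = 0\<close> gives \<open>d = 0\<close>.\<close>

lemma skew_six_enumeration:
  fixes a b c d e f m1 m2 m3 m4 m5 :: int
  assumes skew: "f * f = 1" "- a = f * e" "b = f * d" "- c = f * c"
    and newton: "a = - m1" "2 * b = - (m2 + a * m1)" "3 * c = - (m3 + a * m2 + b * m1)"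
      "4 * d = - (m4 + a * m3 + b * m2 + c * m1)" "5 * e = - (m5 + a * m4 + b * m3 + c * m2 + d * m1)"
    and bounds: "0 \<le> m1" "m1 \<le> 6" "m1 \<le> m2" "m2 \<le> 7" "m1 \<le> m3" "m3 \<le> 9" "m2 \<le> m4" "m4 \<le> 12"
      "m1 \<le> m5" "m5 \<le> 17"
    and pos: "0 < 7858047974841 + 5573083670100 * a + 3952541610000 * b + 2803221000000 * c
           + 1988100000000 * d + 1410000000000 * e + 1000000000000 * f"
  shows "a = 0 \<and> (c = 0 \<or> b = 0)"
proof -
  have f: "f = 1 \<or> f = - 1" using skew(1) by (simp add: square_eq_1_iff)
  have e: "e = f * m1" and d: "d = f * b" using f skew newton(1) by auto
  have b: "b = (m1 * m1 - m2) div 2" using newton(1,2) by simp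
  have c: "c = (m1 * m2 - m3 - b * m1) div 3" using newton(1,3) by simp
  have m4: "m4 = m1 * m3 - 4 * d - b * m2 - c * m1" using newton(1,4) by simp
  have m5: "m5 = m1 * m4 - 5 * e - b * m3 - c * m2 - d * m1" using newton(1,5) by simp
  have "f \<in> set [1, -1]" "m1 \<in> set [0..6]" "m2 \<in> set [0..7]" "m3 \<in> set [0..9]" using f bounds by auto
  then have "skew_six_check f m1 m2 m3" using skew_six_check by blast
  then show ?thesis
    unfolding skew_six_check_def Let_def b[symmetric] c[symmetric] d[symmetric] e[symmetric] newton(1)[symmetric]
      m4[symmetric] m5[symmetric]
    using bounds pos skew newton by auto
qed

lemma skew_spectral_radius_6:
  assumes A: "A \<in> carrier_mat 6 6" "primitive_mat A" "skew_reciprocal_mat (complex_mat A)"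
  shows "1.41 \<le> spectral_radius (complex_mat A)"
proof (rule ccontr)
  assume "\<not> 1.41 \<le> spectral_radius (complex_mat A)"
  then have \<rho>: "spectral_radius (complex_mat A) < 141 / 100" by simp
  have nn: "nonneg_mat A" using A by (simp add: primitive_mat_def)
  define M where "M k = mtrace (A ^\<^sub>m k)" for k
  define cf where "cf i = coeff (char_poly A) i" for i
  have cf6: "cf 6 = 1" unfolding cf_def by (rule char_poly_monic[OF A(1)])
  have cf_real: "coeff (real_char_poly A) i = of_int (cf i)" for i
    unfolding cf_def real_char_poly_int[OF A(1)] by (simp add: coeff_map_poly)
  have deg: "degree (real_char_poly A) = 6"
    unfolding real_char_poly_def using degree_monic_char_poly[of "map_mat of_int A :: real mat" 6] A by simp
  have p: "real_char_poly A = [:of_int (cf 0), of_int (cf 1), of_int (cf 2), of_int (cf 3), of_int (cf 4), of_int (cf 5), 1:]"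
  proof (rule poly_eqI)
    fix i :: nat
    consider "i = 0" | "i = 1" | "i = 2" | "i = 3" | "i = 4" | "i = 5" | "i = 6" | "6 < i" by linarith
    then show "coeff (real_char_poly A) i = coeff [:of_int (cf 0), of_int (cf 1), of_int (cf 2), of_int (cf 3), of_int (cf 4), of_int (cf 5), 1:] i"
    proof cases
      case 8
      then have "coeff (real_char_poly A) i = 0" using deg by (intro coeff_eq_0) simp
      moreover have "coeff [:of_int (cf 0), of_int (cf 1), of_int (cf 2), of_int (cf 3), of_int (cf 4), of_int (cf 5), 1::real:] i = 0"
        using 8 by (intro coeff_eq_0) simp
      ultimately show ?thesis by simp
    qed (use cf6 in \<open>simp_all add: cf_real eval_nat_numeral\<close>)
  qed
  have inv: "x ^ 6 * poly (real_char_poly A) (- 1 / x) = poly (real_char_poly A) 0 * poly (real_char_poly A) x"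
    if "x \<noteq> 0" for x
    using A(3) that unfolding skew_reciprocal_mat_def by (intro real_char_poly_invert[OF A(1)]) auto
  note skew = skew_coefficients[OF p inv]
  have newton: "int (Suc k) * cf (6 - Suc k) = - (\<Sum>j\<le>k. cf (6 - j) * M (Suc (k - j)))" if "k < 6" for k
    unfolding cf_def M_def by (rule int_newton[OF A(1) that])
  have n: "cf 5 = - M 1" "2 * cf 4 = - (M 2 + cf 5 * M 1)" "3 * cf 3 = - (M 3 + cf 5 * M 2 + cf 4 * M 1)"
      "4 * cf 2 = - (M 4 + cf 5 * M 3 + cf 4 * M 2 + cf 3 * M 1)"
      "5 * cf 1 = - (M 5 + cf 5 * M 4 + cf 4 * M 3 + cf 3 * M 2 + cf 2 * M 1)"
    using newton[of 0] newton[of 1] newton[of 2] newton[of 3] newton[of 4] cf6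
    by (simp_all add: eval_nat_numeral atMost_Suc)
  have ge: "M k \<le> M (k * m)" if "0 < m" for k m
    unfolding M_def by (rule mtrace_pow_mult_ge[OF A(1) nn that])
  have M0: "0 \<le> M 1" unfolding M_def by (rule mtrace_nonneg[OF nonneg_mat_pow[OF A(1) nn]]) (use A in simp)
  have le: "2 * real_of_int (M k) \<le> 6 * ((141 / 100) ^ k + 1 / (141 / 100) ^ k)" for k
    unfolding M_def using mtrace_pow_le[OF A(1,3), of "141 / 100" k] \<rho> by simp
  \<comment> \<open>The bounds \<open>3 * (1.41^k + 1.41^(-k))\<close> for \<open>k\<close> from 1
    to 5 are about 6.36, 7.47, 9.48, 12.62 and 17.26.\<close>
  have "real_of_int (M 1) < 7" "real_of_int (M 2) < 8" "real_of_int (M 3) < 10" "real_of_int (M 4) < 13" "real_of_int (M 5) < 18"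
    using le[of 1] le[of 2] le[of 3] le[of 4] le[of 5] by (simp_all add: field_simps)
  then have ub: "M 1 \<le> 6" "M 2 \<le> 7" "M 3 \<le> 9" "M 4 \<le> 12" "M 5 \<le> 17" by linarith+
  \<comment> \<open>The point \<open>1.41\<close> lies beyond every real eigenvalue, so the
    characteristic polynomial is positive there. This sharpens the trace bounds.\<close>
  have "0 < pdet (walk_mat (nat_entries A) (100 / 141)) {0..<6}"
    by (rule pdet_walk_mat_pos[OF A(1) nn]) (use \<rho> in simp_all)
  then have "0 < poly (real_char_poly A) (141 / 100)"
    using pdet_walk_mat_char_poly[OF A(1) nn, of "100 / 141"] by (simp add: zero_less_mult_iff)
  then have "0 < real_of_int (7858047974841 + 5573083670100 * cf 5 + 3952541610000 * cf 4 + 2803221000000 * cf 3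
           + 1988100000000 * cf 2 + 1410000000000 * cf 1 + 1000000000000 * cf 0)"
    unfolding p by (simp add: field_simps)
  then have pos: "0 < 7858047974841 + 5573083670100 * cf 5 + 3952541610000 * cf 4 + 2803221000000 * cf 3
           + 1988100000000 * cf 2 + 1410000000000 * cf 1 + 1000000000000 * cf 0" by linarith
  have fin: "cf 5 = 0 \<and> (cf 3 = 0 \<or> cf 4 = 0)"
    by (rule skew_six_enumeration[OF skew n M0 _ _ _ _ _ _ _ _ _ pos])
      (use ub ge[of 2 1] ge[of 3 1] ge[of 5 1] ge[of 2 2] in simp_all)
  then have c5: "cf 5 = 0" and c1: "cf 1 = 0" using skew by auto
  have rec: "(\<Sum>i\<le>6. cf i * M (k + i)) = 0" for k
    unfolding cf_def M_def by (rule int_recurrence[OF A(1)])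
  have rec: "M (k + 6) = - (cf 4 * M (k + 4) + cf 3 * M (k + 3) + cf 2 * M (k + 2) + cf 0 * M k)" for k
    using rec[of k] c5 c1 cf6 by (simp add: eval_nat_numeral atMost_Suc)
  show False
  proof (cases "cf 3 = 0")
    case True
    have m: "M 1 = 0" "M 3 = 0" "M 5 = 0" using n True c5 c1 by auto
    have "M (2 * k + 1) = 0 \<and> M (2 * k + 3) = 0 \<and> M (2 * k + 5) = 0" for k
    proof (induction k)
      case (Suc k)
      then show ?case using rec[of "2 * k + 1"] True by (simp add: eval_nat_numeral)
    qed (use m in simp)
    then show False using primitive_mtrace_nonzero[OF A(1,2), of 2] by (simp add: M_def)
  next
    case False
    then have c: "cf 4 = 0" "cf 2 = 0" using fin skew by auto
    \<comment> \<open>For a polynomial in \<open>X^3\<close> the recurrence has steps of three, so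
      two initial zeros kill all traces with exponent 1 modulo 3.\<close>
    have m: "M 1 = 0" "M 4 = 0" using n c c5 c1 by auto
    have "M (3 * k + 1) = 0 \<and> M (3 * k + 4) = 0" for k
    proof (induction k)
      case (Suc k)
      then show ?case using rec[of "3 * k + 1"] c by (simp add: eval_nat_numeral)
    qed (use m in simp)
    then show False using primitive_mtrace_nonzero[OF A(1,2), of 3] by (simp add: M_def)
  qed
qed

section \<open>Hessenberg matrices\<close>

text \<open>The ones above the diagonal form the path through all vertices in order, and
  \<open>b\<close> prescribes the loops and back arcs. The example matrices are thus given by their
  back arcs, and \<open>hess_poly\<close> consists of the characteristic polynomials of the leading
  blocks.\<close>

definition hess_mat :: "(nat \<Rightarrow> nat \<Rightarrow> 'a) \<Rightarrow> nat \<Rightarrow> 'a::comm_ring_1 mat" where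
  "hess_mat b n = mat n n (\<lambda>(i, j). if j = Suc i then 1 else if j \<le> i then b i j else 0)"

fun hess_poly :: "(nat \<Rightarrow> nat \<Rightarrow> 'a::comm_ring_1) \<Rightarrow> nat \<Rightarrow> 'a poly" where
  "hess_poly b 0 = 1"
| "hess_poly b (Suc k) = monom 1 1 * hess_poly b k - (\<Sum>j\<le>k. [:b k j:] * hess_poly b j)"

declare hess_poly.simps(2) [simp del]

lemma hess_mat_carrier [simp]: "hess_mat b n \<in> carrier_mat n n"
  by (simp add: hess_mat_def)

lemma dim_hess_mat [simp]: "dim_row (hess_mat b n) = n" "dim_col (hess_mat b n) = n"
  by (simp_all add: hess_mat_def)

text \<open>The polynomials \<open>hess_poly b 0, \<dots>, hess_poly b (n - 1)\<close> form a vector which \<open>X - H\<close> maps to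
  \<open>hess_poly b n\<close> times the last unit vector. Using it as the first column of a unitriangular matrix
  reduces the determinant to a single cofactor.\<close>

lemma char_poly_hess_mat:
  fixes b :: "nat \<Rightarrow> nat \<Rightarrow> 'a::idom"
  assumes n: "0 < n"
  shows "char_poly (hess_mat b n) = hess_poly b n"
proof -
  let ?X = "monom 1 1 :: 'a poly"
  define M where "M = char_poly_matrix (hess_mat b n)"
  define U where "U = mat n n (\<lambda>(i, j). if j = 0 then hess_poly b i else if i = j then 1 else 0)"
  define N where "N = M * U"
  have M: "M \<in> carrier_mat n n" and U: "U \<in> carrier_mat n n"
    by (simp_all add: M_def U_def)
  have N: "N \<in> carrier_mat n n" unfolding N_def using M U by (rule mult_carrier_mat)
  have Me: "M $$ (i, j) = (if i = j then ?X else 0) - (if j = Suc i then 1 else if j \<le> i then [:b i j:] else 0)"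
    if "i < n" "j < n" for i j
    using that by (simp add: M_def char_poly_matrix_def hess_mat_def monom_altdef one_pCons)
  have Ne: "N $$ (i, j) = (\<Sum>l<n. M $$ (i, l) * U $$ (l, j))" if "i < n" "j < n" for i j
    unfolding N_def using mult_mat_entry[OF M U that] .
  have N1: "N $$ (i, j) = M $$ (i, j)" if "i < n" "j < n" "j \<noteq> 0" for i j
  proof -
    have "N $$ (i, j) = (\<Sum>l\<in>{j}. M $$ (i, l) * U $$ (l, j))"
      unfolding Ne[OF that(1,2)] using that by (intro sum.mono_neutral_right) (auto simp: U_def)
    then show ?thesis using that by (simp add: U_def)
  qed
  have row: "N $$ (i, 0) = ?X * hess_poly b i - (if Suc i < n then hess_poly b (Suc i) else 0)
      - (\<Sum>l\<le>i. [:b i l:] * hess_poly b l)" if i: "i < n" for i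
  proof -
    have "N $$ (i, 0) = (\<Sum>l<n. (if i = l then ?X * hess_poly b l else 0)
      - (if l = Suc i then hess_poly b l else 0) - (if l \<le> i then [:b i l:] * hess_poly b l else 0))"
      unfolding Ne[OF i n] using i by (intro sum.cong refl) (auto simp: U_def Me algebra_simps)
    also have "\<dots> = ?X * hess_poly b i - (if Suc i < n then hess_poly b (Suc i) else 0)
      - (\<Sum>l | l < n \<and> l \<le> i. [:b i l:] * hess_poly b l)"
      using i by (simp add: sum_subtractf sum.delta' sum.If_cases Int_def)
    also have "{l. l < n \<and> l \<le> i} = {..i}" using i by auto
    finally show ?thesis .
  qed
  have N0: "N $$ (i, 0) = (if i = n - 1 then hess_poly b n else 0)" if i: "i < n" for i
  proof (cases "Suc i < n")
    case True
    then show ?thesis unfolding row[OF i] by (simp add: hess_poly.simps(2))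
  next
    case False
    then have "n = Suc i" using i by simp
    then show ?thesis unfolding row[OF i] by (simp add: hess_poly.simps(2))
  qed
  have "det U = prod_list (diag_mat U)"
    by (rule det_lower_triangular[OF _ U]) (simp add: U_def)
  also have "diag_mat U = map (\<lambda>i. 1) [0..<n]"
    using U by (auto simp: diag_mat_def U_def)
  finally have detU: "det U = 1" by (simp add: prod_list_const)
  let ?D = "mat_delete N (n - 1) 0"
  have D: "?D \<in> carrier_mat (n - 1) (n - 1)" using N by (intro carrier_matI) (auto simp: mat_delete_def)
  have De: "?D $$ (i, j) = M $$ (i, Suc j)" if "i < n - 1" "j < n - 1" for i j
    using that N N1[of i "Suc j"] by (simp add: mat_delete_def insert_index_def)
  have "det ?D = prod_list (diag_mat ?D)"
    by (rule det_lower_triangular[OF _ D]) (use De in \<open>simp add: Me\<close>)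
  also have "diag_mat ?D = map (\<lambda>i. - 1) [0..<n - 1]"
    using D De by (auto simp: diag_mat_def Me)
  finally have detD: "det ?D = (- 1) ^ (n - 1)" by (simp add: prod_list_const)
  have "char_poly (hess_mat b n) = det N"
    unfolding N_def det_mult[OF M U] detU by (simp add: char_poly_def M_def)
  also have "\<dots> = (\<Sum>i<n. N $$ (i, 0) * cofactor N i 0)"
    by (rule laplace_expansion_column[OF N n])
  also have "\<dots> = (\<Sum>i<n. if i = n - 1 then hess_poly b n * cofactor N i 0 else 0)"
    by (intro sum.cong refl) (simp add: N0)
  also have "\<dots> = hess_poly b n * cofactor N (n - 1) 0"
    using n by simp
  also have "cofactor N (n - 1) 0 = 1"
    unfolding cofactor_def detD by (simp flip: power_mult_distrib)
  finally show ?thesis by simp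
qed

section \<open>Criteria for primitivity and for integral invertibility\<close>

lemma pow_pos_trans:
  fixes A :: "int mat"
  assumes A: "A \<in> carrier_mat n n" "nonneg_mat A" and ijl: "i < n" "j < n" "l < n"
    and pos: "0 < (A ^\<^sub>m k) $$ (i, j)" "0 < (A ^\<^sub>m m) $$ (j, l)"
  shows "0 < (A ^\<^sub>m (k + m)) $$ (i, l)"
proof -
  have P: "A ^\<^sub>m k \<in> carrier_mat n n" for k using A by simp
  have "0 < (\<Sum>r<n. (A ^\<^sub>m k) $$ (i, r) * (A ^\<^sub>m m) $$ (r, l))"
    using nonneg_matD[OF nonneg_mat_pow[OF A] P] ijl pos by (intro sum_pos2[of _ j]) auto
  then show ?thesis using mult_mat_entry[OF P P ijl(1,3)] pow_mat_add[OF A(1)] by simp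
qed

lemma pow_pos_power:
  fixes A :: "int mat"
  assumes A: "A \<in> carrier_mat n n" "nonneg_mat A" and v: "v < n" "0 < (A ^\<^sub>m c) $$ (v, v)"
  shows "0 < (A ^\<^sub>m (u * c)) $$ (v, v)"
proof (induction u)
  case (Suc u)
  then show ?case using pow_pos_trans[OF A v(1,1,1) v(2), of "u * c"] by simp
qed (use A v in simp)

text \<open>The coin problem with the crude bound \<open>c * d\<close>: the multiple of
  \<open>c\<close> is fixed modulo \<open>d\<close> by inverting \<open>c\<close>, with a factor
  below \<open>d\<close>, and the rest is a nonnegative multiple of \<open>d\<close>.\<close>

lemma coprime_representation:
  fixes c d m :: nat
  assumes "coprime c d" "0 < c" "0 < d" "c * d \<le> m"
  obtains u w where "m = u * c + w * d"
proof -
  obtain x where "[c * x = Suc 0] (mod d)" using cong_solve_coprime_nat assms(1) by blast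
  then have "[c * x * m = Suc 0 * m] (mod d)" by (rule cong_scalar_right)
  then have "[c * (x * m) = m] (mod d)" by (simp add: mult.assoc)
  moreover have "[c * ((x * m) mod d) = c * (x * m)] (mod d)"
    by (intro cong_scalar_left) (simp add: cong_def)
  ultimately have c: "[c * ((x * m) mod d) = m] (mod d)" by (metis cong_trans)
  have "c * ((x * m) mod d) \<le> c * d" using assms(3) by (intro mult_le_mono2 less_imp_le mod_less_divisor)
  then have le: "c * ((x * m) mod d) \<le> m" using assms(4) by (rule le_trans)
  then have "d dvd m - c * ((x * m) mod d)" using c by (simp add: cong_altdef_nat cong_sym_eq)
  then obtain w where "m - c * ((x * m) mod d) = d * w" by (auto elim: dvdE)
  then have "m = (x * m) mod d * c + w * d" using le by (simp add: algebra_simps)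
  then show thesis using that by blast
qed

text \<open>Any two vertices are joined through \<open>v\<close>. Closed walks at \<open>v\<close>
  of coprime lengths realise every long waiting time there, which lets all pairs share the one
  exponent \<open>K\<close>.\<close>

lemma primitive_criterion:
  fixes A :: "int mat"
  assumes A: "A \<in> carrier_mat n n" "nonneg_mat A" and v: "v < n"
    and c: "0 < (A ^\<^sub>m c) $$ (v, v)" "0 < (A ^\<^sub>m d) $$ (v, v)" "coprime c d" "0 < c" "0 < d"
    and to_v: "\<And>i. i < n \<Longrightarrow> \<exists>k. 0 < (A ^\<^sub>m k) $$ (i, v)"
    and from_v: "\<And>j. j < n \<Longrightarrow> \<exists>k. 0 < (A ^\<^sub>m k) $$ (v, j)"
  shows "primitive_mat A"
proof -
  obtain f where f: "\<And>i. i < n \<Longrightarrow> 0 < (A ^\<^sub>m f i) $$ (i, v)" using to_v by metis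
  obtain h where h: "\<And>j. j < n \<Longrightarrow> 0 < (A ^\<^sub>m h j) $$ (v, j)" using from_v by metis
  define K where "K = c * d + (\<Sum>i<n. f i) + (\<Sum>j<n. h j)"
  have "0 < (A ^\<^sub>m K) $$ (i, j)" if ij: "i < n" "j < n" for i j
  proof -
    have "f i \<le> (\<Sum>i<n. f i)" "h j \<le> (\<Sum>j<n. h j)" using ij by (auto intro: member_le_sum)
    define m where "m = K - f i - h j"
    have m: "K = f i + m + h j" "c * d \<le> m"
      using \<open>f i \<le> _\<close> \<open>h j \<le> _\<close> unfolding m_def K_def by linarith+
    obtain u w where "m = u * c + w * d" using coprime_representation[OF c(3-5) m(2)] .
    then have "0 < (A ^\<^sub>m m) $$ (v, v)"
      using pow_pos_trans[OF A v v v pow_pos_power[OF A v c(1)] pow_pos_power[OF A v c(2)]] by simp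
    then show ?thesis unfolding m(1)
      using pow_pos_trans[OF A ij(1) v ij(2) pow_pos_trans[OF A ij(1) v v f[OF ij(1)]] h[OF ij(2)]] by blast
  qed
  moreover have "dim_row (A ^\<^sub>m K) = n" "dim_col (A ^\<^sub>m K) = n"
    using pow_carrier_mat[OF A(1), of K] by (rule carrier_matD)+
  ultimately have "pos_mat (A ^\<^sub>m K)" unfolding pos_mat_def by metis
  moreover have "0 < c * d" using c by simp
  then have "1 \<le> K" unfolding K_def by linarith
  ultimately show ?thesis using A by (auto simp: primitive_mat_def)
qed

lemma hess_forward:
  fixes b :: "nat \<Rightarrow> nat \<Rightarrow> int"
  assumes nn: "nonneg_mat (hess_mat b n)" and "i \<le> j" "j < n"
  shows "0 < (hess_mat b n ^\<^sub>m (j - i)) $$ (i, j)"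
  using assms(2,3)
proof (induction "j - i" arbitrary: j)
  case 0
  then show ?case by simp
next
  case (Suc k)
  then obtain j' where j': "j = Suc j'" "i \<le> j'" by (cases j) auto
  have "0 < (hess_mat b n ^\<^sub>m (j' - i)) $$ (i, j')" using Suc j' by simp
  moreover have "0 < (hess_mat b n ^\<^sub>m 1) $$ (j', j)" using Suc j' by (simp add: hess_mat_def)
  ultimately have "0 < (hess_mat b n ^\<^sub>m (j' - i + 1)) $$ (i, j)"
    using Suc j' by (intro pow_pos_trans[OF hess_mat_carrier nn]) auto
  then show ?case using j' by (simp add: Suc_diff_le)
qed

lemma hess_back:
  fixes b :: "nat \<Rightarrow> nat \<Rightarrow> int"
  assumes nn: "nonneg_mat (hess_mat b n)" and "j \<le> i" "i < n" "0 < b i j" "j \<le> l" "l < n"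
  shows "0 < (hess_mat b n ^\<^sub>m (Suc (l - j))) $$ (i, l)"
proof -
  have "0 < (hess_mat b n ^\<^sub>m 1) $$ (i, j)" using assms by (simp add: hess_mat_def)
  then have "0 < (hess_mat b n ^\<^sub>m (1 + (l - j))) $$ (i, l)"
    using assms hess_forward[OF nn assms(5,6)] by (intro pow_pos_trans[OF hess_mat_carrier nn]) auto
  then show ?thesis by simp
qed

lemma nonneg_hess_mat: "nonneg_mat (hess_mat b n)" if "\<And>i j. 0 \<le> b i j" for b :: "nat \<Rightarrow> nat \<Rightarrow> int"
  using that by (auto simp: nonneg_mat_def hess_mat_def)

text \<open>The determinant is its own inverse, so \<open>det A\<close> times the adjugate is an
  integral inverse. Squaring the constant term covers both signs.\<close>

lemma GL_int_char_poly:
  fixes A :: "int mat"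
  assumes A: "A \<in> carrier_mat n n" and c: "poly (char_poly A) 0 * poly (char_poly A) 0 = 1"
  shows "A \<in> GL_int n"
proof -
  have "poly (char_poly A) 0 = det (- A)"
    unfolding char_poly_def by (rule poly_det_cong[of _ n]) (use A in \<open>auto simp: char_poly_matrix_def\<close>)
  also have "- A = (- 1) \<cdot>\<^sub>m A" using A by (intro eq_matI) auto
  finally have "poly (char_poly A) 0 = (- 1) ^ n * det A" using A by simp
  then have "((- 1) ^ n * det A) * ((- 1) ^ n * det A) = 1" using c by simp
  moreover have "(- 1 :: int) ^ n * (- 1) ^ n = 1" by (simp flip: power_mult_distrib)
  then have "((- 1) ^ n * det A) * ((- 1) ^ n * det A) = det A * det A"
    by (metis mult.assoc mult.left_commute mult_1)
  ultimately have d: "det A * det A = 1" by simp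
  let ?B = "det A \<cdot>\<^sub>m adj_mat A"
  have B: "?B \<in> carrier_mat n n" and adj: "adj_mat A \<in> carrier_mat n n" using adj_mat(1)[OF A] by auto
  have "A * ?B = 1\<^sub>m n"
    unfolding mult_smult_distrib[OF A adj] adj_mat(2)[OF A] using d by (intro eq_matI) auto
  moreover have "?B * A = 1\<^sub>m n"
    unfolding mult_smult_assoc_mat[OF adj A] adj_mat(3)[OF A] using d by (intro eq_matI) auto
  ultimately have "invertible_mat A"
    using A B unfolding invertible_mat_def inverts_mat_def by (auto intro!: exI[of _ ?B])
  then show ?thesis using A by (simp add: GL_int_def)
qed

section \<open>Skew-reciprocal companion matrices\<close>

lemma spectral_radius_gt_1I:
  assumes A: "A \<in> carrier_mat n n" and x: "1 < T" "poly (real_char_poly A) 1 < 0" "0 \<le> poly (real_char_poly A) T"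
  shows "1 < spectral_radius (complex_mat A)"
proof -
  obtain r where r: "1 \<le> r" "r \<le> T" "poly (real_char_poly A) r = 0"
    using IVT[of "poly (real_char_poly A)" 1 0 T] x by auto
  then have "1 < r" using x(2) by (cases "r = 1") auto
  moreover have "poly (char_poly (complex_mat A)) (of_real r) = 0"
    using real_root_imp_complex_root[OF A, of r] r by simp
  then have "norm (complex_of_real r) \<le> spectral_radius (complex_mat A)"
    using A by (intro root_le_spectral_radius[of _ n]) auto
  ultimately show ?thesis by simp
qed

lemma eigenvalue_mset_invariantI:
  assumes A: "A \<in> carrier_mat n n" and s: "s = 1 \<or> s = -1" and c: "c \<noteq> 0"
    and p0: "poly (char_poly (complex_mat A)) 0 \<noteq> 0"
    and inv: "\<And>x. x \<noteq> 0 \<Longrightarrow> x ^ n * poly (char_poly (complex_mat A)) (s / x) = c * poly (char_poly (complex_mat A)) x"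
  shows "0 \<notin># eigenvalue_mset (complex_mat A)"
    and "image_mset (\<lambda>t. s * inverse t) (eigenvalue_mset (complex_mat A)) = eigenvalue_mset (complex_mat A)"
proof -
  have cA: "complex_mat A \<in> carrier_mat n n" using A by simp
  obtain es where es: "char_poly (complex_mat A) = lin_prod es" "length es = n"
    using char_poly_lin_prod[OF cA] .
  note e = eigenvalue_mset_lin_prod[OF es(1)]
  show "0 \<notin># eigenvalue_mset (complex_mat A)"
    using p0 unfolding es(1) e by (auto simp: poly_lin_prod prod_list_zero_iff)
  show "image_mset (\<lambda>t. s * inverse t) (eigenvalue_mset (complex_mat A)) = eigenvalue_mset (complex_mat A)"
    unfolding e by (rule poly_imp_invariant[OF _ c]) (use p0 inv es in auto)
qed

text \<open>All back arcs leave the last vertex, so any two cycles meet and the one belonging to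
  \<open>j\<close> has length \<open>n - j\<close>. This yields the polynomial \<open>X^n\<close>
  minus the sum of the \<open>X^j\<close>.\<close>

definition companion_coeff :: "nat set \<Rightarrow> nat \<Rightarrow> nat \<Rightarrow> nat \<Rightarrow> int" where
  "companion_coeff J n i j = (if Suc i = n \<and> j \<in> J then 1 else 0)"

abbreviation "companion_mat J n \<equiv> hess_mat (companion_coeff J n) n"

lemma hess_poly_companion:
  assumes "k < n"
  shows "hess_poly (companion_coeff J n) k = monom 1 k"
  using assms
proof (induction k)
  case (Suc k)
  then show ?case by (simp add: hess_poly.simps(2) companion_coeff_def mult_monom)
qed (simp add: one_pCons monom_0)

lemma char_poly_companion_mat:
  assumes "J \<subseteq> {..<n}" "0 < n"
  shows "char_poly (companion_mat J n) = monom 1 n - (\<Sum>j\<in>J. monom 1 j)"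
proof -
  obtain m where m: "n = Suc m" using assms(2) by (cases n) auto
  have "(\<Sum>j\<le>m. [:companion_coeff J n m j:] * hess_poly (companion_coeff J n) j) = (\<Sum>j\<le>m. if j \<in> J then monom 1 j else 0)"
    by (intro sum.cong refl) (auto simp: hess_poly_companion m companion_coeff_def)
  also have "\<dots> = (\<Sum>j\<in>J. monom 1 j)"
    using assms(1) m by (simp add: sum.If_cases inf.absorb2 lessThan_Suc_atMost)
  finally show ?thesis
    unfolding char_poly_hess_mat[OF assms(2)]
    by (subst (2) m) (simp only: hess_poly.simps(2), simp add: hess_poly_companion m mult_monom)
qed

lemma companion_mat_poly:
  fixes x :: "'a::field_char_0"
  assumes "J \<subseteq> {..<n}" "0 < n"
  shows "poly (map_poly of_int (char_poly (companion_mat J n))) x = x ^ n - (\<Sum>j\<in>J. x ^ j)"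
proof -
  have "finite J" using assms finite_subset by blast
  have "map_poly of_int (char_poly (companion_mat J n)) = (monom 1 n - (\<Sum>j\<in>J. monom 1 j) :: 'a poly)"
    unfolding char_poly_companion_mat[OF assms]
    by (rule poly_eqI) (auto simp: coeff_map_poly coeff_sum intro!: sum.cong)
  then show ?thesis by (simp add: poly_monom poly_sum)
qed

text \<open>The back arc to 0 makes the digraph strongly connected, and \<open>i\<close>,
  \<open>j\<close> supply closed walks of coprime lengths at the last vertex.\<close>

lemma companion_mat_primitive:
  assumes J: "J \<subseteq> {..<n}" "0 \<in> J" "i \<in> J" "j \<in> J" "coprime (n - i) (n - j)"
  shows "primitive_mat (companion_mat J n)"
proof (rule primitive_criterion[OF hess_mat_carrier, of _ _ "n - 1" "n - i" "n - j"])
  have n: "0 < n" using J by auto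
  show nn: "nonneg_mat (companion_mat J n)" by (rule nonneg_hess_mat) (simp add: companion_coeff_def)
  have bk: "0 < (companion_mat J n ^\<^sub>m (Suc (l - i))) $$ (n - 1, l)" if "i \<in> J" "i \<le> l" "l < n" for i l
    using hess_back[OF nn, of i "n - 1" l] that J(1) n by (auto simp: companion_coeff_def)
  show "0 < (companion_mat J n ^\<^sub>m (n - i)) $$ (n - 1, n - 1)" "0 < (companion_mat J n ^\<^sub>m (n - j)) $$ (n - 1, n - 1)"
    using bk[OF J(3), of "n - 1"] bk[OF J(4), of "n - 1"] J by (auto simp: Suc_diff_le[symmetric] subset_iff)
  show "\<exists>k. 0 < (companion_mat J n ^\<^sub>m k) $$ (l, n - 1)" if "l < n" for l
    using hess_forward[OF nn, of l "n - 1"] that by (intro exI[of _ "n - 1 - l"]) simp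
  show "\<exists>k. 0 < (companion_mat J n ^\<^sub>m k) $$ (n - 1, l)" if "l < n" for l
    using bk[OF J(2) le0 that] by blast
qed (use J in auto)

text \<open>Cauchy's root bound by scaling: with \<open>norm z = q * T\<close> and
  \<open>q \<ge> 1\<close>, the left side grows by \<open>q ^ n\<close> but every term on the right
  by at most \<open>q ^ (n - 1)\<close>.\<close>

lemma companion_mat_root_bound:
  fixes z :: complex
  assumes J: "J \<subseteq> {..<n}" "finite J" and z: "z ^ n = (\<Sum>j\<in>J. z ^ j)" and T: "0 < T" "T \<le> norm z"
  shows "T ^ n \<le> (\<Sum>j\<in>J. T ^ j)" and "T < norm z \<Longrightarrow> J \<noteq> {} \<Longrightarrow> T ^ n < (\<Sum>j\<in>J. T ^ j)"
proof -
  define q where "q = norm z / T"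
  have q: "1 \<le> q" "norm z = q * T" using T by (simp_all add: q_def)
  have "(q * T) ^ n \<le> (\<Sum>j\<in>J. norm z ^ j)"
    unfolding q(2)[symmetric] norm_power[symmetric] z by (rule sum_norm_le[of J, OF order_refl])
  also have "\<dots> \<le> (\<Sum>j\<in>J. q ^ (n - 1) * T ^ j)"
    unfolding q(2) power_mult_distrib using J(1) q(1) T
    by (intro sum_mono mult_right_mono power_increasing) auto
  also have "\<dots> = q ^ (n - 1) * (\<Sum>j\<in>J. T ^ j)" by (simp add: sum_distrib_left)
  finally have le: "q ^ n * T ^ n \<le> q ^ (n - 1) * (\<Sum>j\<in>J. T ^ j)" by (simp add: power_mult_distrib)
  have *: "q * T ^ n \<le> (\<Sum>j\<in>J. T ^ j)" if "0 < n"
  proof -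
    have "q ^ (n - 1) * (q * T ^ n) = q ^ n * T ^ n" using that by (cases n) auto
    then have "q ^ (n - 1) * (q * T ^ n) \<le> q ^ (n - 1) * (\<Sum>j\<in>J. T ^ j)" using le by (rule ord_eq_le_trans)
    then show ?thesis using q(1) by simp
  qed
  have n0: "0 < n"
  proof (rule ccontr)
    assume "\<not> 0 < n"
    then show False using J z by simp
  qed
  have Tq: "T ^ n \<le> q * T ^ n" using q(1) T by simp
  show "T ^ n \<le> (\<Sum>j\<in>J. T ^ j)" using *[OF n0] Tq by simp
  show "T ^ n < (\<Sum>j\<in>J. T ^ j)" if "T < norm z"
  proof -
    have "1 < q" using that T by (simp add: q_def)
    then have "T ^ n < q * T ^ n" using T by simp
    then show ?thesis using *[OF n0] by simp
  qed
qed

lemma sum_zero_power: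
  assumes "finite J" "0 \<in> J"
  shows "(\<Sum>j\<in>J. 0 ^ j) = (1::'a::semiring_1)"
proof -
  have "(\<Sum>j\<in>J. 0 ^ j) = (\<Sum>j\<in>{0}. 0 ^ j :: 'a)"
    using assms by (intro sum.mono_neutral_right) (auto simp: zero_power)
  then show ?thesis by simp
qed

text \<open>A test point \<open>T\<close> suffices to bound the radius from above. Two elements of
  \<open>J\<close> make the polynomial negative at 1, which puts a real root between 1 and
  \<open>T\<close>.\<close>

lemma companion_mat_skew_radius:
  assumes J: "J \<subseteq> {..<n}" "0 \<in> J" "2 \<le> card J" "i \<in> J" "j \<in> J" "coprime (n - i) (n - j)"
    and skew: "\<And>x::complex. x \<noteq> 0 \<Longrightarrow> x ^ n * ((- 1 / x) ^ n - (\<Sum>j\<in>J. (- 1 / x) ^ j)) = c * (x ^ n - (\<Sum>j\<in>J. x ^ j))"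
    and c: "c \<noteq> 0" and T: "1 < T" "(\<Sum>j\<in>J. T ^ j) \<le> T ^ n"
  shows "\<exists>r\<in>skew_radii n. r \<le> T \<and> ((\<Sum>j\<in>J. T ^ j) < T ^ n \<longrightarrow> r < T)"
proof -
  let ?A = "companion_mat J n"
  have n: "0 < n" and fin: "finite J" using J by (auto intro: finite_subset)
  note s0 = sum_zero_power[OF fin J(2)]
  have A: "?A \<in> carrier_mat n n" by simp
  have rp: "poly (real_char_poly ?A) x = x ^ n - (\<Sum>j\<in>J. x ^ j)" for x
    unfolding real_char_poly_int[OF A] by (rule companion_mat_poly[OF J(1) n])
  have cp: "poly (char_poly (complex_mat ?A)) x = x ^ n - (\<Sum>j\<in>J. x ^ j)" for x
    unfolding complex_char_poly_int[OF A] by (rule companion_mat_poly[OF J(1) n])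
  have prim: "primitive_mat ?A" by (rule companion_mat_primitive[OF J(1,2,4,5,6)])
  have "poly (char_poly ?A) 0 = - 1"
  proof -
    have "real_of_int (poly (char_poly ?A) 0) = poly (real_char_poly ?A) 0"
      unfolding real_char_poly_int[OF A] by (metis of_int_0 of_int_hom.poly_map_poly)
    also have "\<dots> = real_of_int (- 1)" unfolding rp s0 using n by simp
    finally show ?thesis by (simp only: of_int_eq_iff)
  qed
  then have GL: "?A \<in> GL_int n" using GL_int_char_poly[OF A] by simp
  have nz: "poly (char_poly (complex_mat ?A)) 0 \<noteq> 0" using n by (simp add: cp s0 zero_power)
  have iv: "x ^ n * poly (char_poly (complex_mat ?A)) (- 1 / x) = c * poly (char_poly (complex_mat ?A)) x"
    if "x \<noteq> 0" for x using skew[OF that] unfolding cp .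
  have sk: "skew_reciprocal_mat (complex_mat ?A)"
    using eigenvalue_mset_invariantI[where s = "- 1", OF A _ c nz iv] by (simp add: skew_reciprocal_mat_def)
  have gt: "1 < spectral_radius (complex_mat ?A)"
    using J(3) T by (intro spectral_radius_gt_1I[OF A T(1)]) (auto simp: rp)
  have mem: "spectral_radius (complex_mat ?A) \<in> skew_radii n"
    unfolding skew_radii_def using GL prim sk gt by blast
  obtain z where z: "poly (char_poly (complex_mat ?A)) z = 0" "norm z = spectral_radius (complex_mat ?A)"
    using spectral_radius_root[of "complex_mat ?A" n] n by auto
  then have zz: "z ^ n = (\<Sum>j\<in>J. z ^ j)" unfolding cp by simp
  note b = companion_mat_root_bound[OF J(1) fin zz]
  have "norm z \<le> T"
  proof (rule ccontr)
    assume "\<not> norm z \<le> T"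
    then show False using b(2)[of T] J(2) T by force
  qed
  moreover have "norm z < T" if "(\<Sum>j\<in>J. T ^ j) < T ^ n"
  proof (rule ccontr)
    assume "\<not> norm z < T"
    then show False using b(1)[of T] that T by force
  qed
  ultimately show ?thesis using mem z(2) by auto
qed

section \<open>Reciprocal matrices with small spectral radius\<close>

text \<open>The Collatz-Wielandt bound: compare an eigenvector \<open>x\<close> with the positive
  vector \<open>v\<close> at an index where \<open>norm (x $ i) / v i\<close> is largest.\<close>

lemma spectral_radius_le_vector:
  fixes A :: "int mat" and v :: "nat \<Rightarrow> real"
  assumes A: "A \<in> carrier_mat n n" "nonneg_mat A" and n: "0 < n"
    and v: "\<And>i. i < n \<Longrightarrow> 0 < v i" "\<And>i. i < n \<Longrightarrow> (\<Sum>j<n. of_int (A $$ (i, j)) * v j) \<le> \<mu> * v i"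
  shows "spectral_radius (complex_mat A) \<le> \<mu>"
proof -
  have cA: "complex_mat A \<in> carrier_mat n n" using A by simp
  obtain z where z: "poly (char_poly (complex_mat A)) z = 0" "norm z = spectral_radius (complex_mat A)"
    using spectral_radius_root[OF cA n] .
  then obtain x where "eigenvector (complex_mat A) x z"
    using eigenvalue_root_char_poly[OF cA, of z] by (auto simp: eigenvalue_def)
  then have x: "x \<in> carrier_vec n" "x \<noteq> 0\<^sub>v n" "complex_mat A *\<^sub>v x = z \<cdot>\<^sub>v x"
    using A by (auto simp: eigenvector_def)
  define r where "r i = norm (x $ i) / v i" for i
  obtain i where i: "i < n" "\<And>j. j < n \<Longrightarrow> r j \<le> r i"
  proof -
    have "finite (r ` {..<n})" "r ` {..<n} \<noteq> {}" using n by auto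
    then obtain i where "i < n" "r i = Max (r ` {..<n})" using Max_in by (metis imageE lessThan_iff)
    moreover from this have "r j \<le> r i" if "j < n" for j using that by (auto intro: Max_ge)
    ultimately show thesis using that by blast
  qed
  have "0 < r i"
  proof (rule ccontr)
    assume "\<not> 0 < r i"
    have "x $ j = 0" if "j < n" for j
    proof -
      have "r j \<le> 0" using i(2)[OF that] \<open>\<not> 0 < r i\<close> by linarith
      then show ?thesis using v(1)[OF that] by (simp add: r_def divide_le_0_iff)
    qed
    then have "x = 0\<^sub>v n" using x(1) by (intro eq_vecI) auto
    then show False using x(2) by simp
  qed
  have "(complex_mat A *\<^sub>v x) $ i = (\<Sum>j<n. of_int (A $$ (i, j)) * x $ j)"
    using A x(1) i(1) by (simp add: scalar_prod_def lessThan_atLeast0)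
  then have "z * x $ i = (\<Sum>j<n. of_int (A $$ (i, j)) * x $ j)" using x i(1) by simp
  then have "norm z * norm (x $ i) = norm (\<Sum>j<n. of_int (A $$ (i, j)) * x $ j)"
    by (simp only: norm_mult[symmetric])
  also have "\<dots> \<le> (\<Sum>j<n. norm (of_int (A $$ (i, j)) * x $ j))" by (rule norm_sum)
  also have "\<dots> \<le> (\<Sum>j<n. r i * (of_int (A $$ (i, j)) * v j))"
  proof (rule sum_mono)
    fix j assume j: "j \<in> {..<n}"
    then have "norm (x $ j) \<le> r i * v j" using i(2)[of j] v(1)[of j] by (simp add: r_def field_simps)
    moreover have "0 \<le> A $$ (i, j)" using nonneg_matD[OF A(2,1) i(1)] j by simp
    ultimately show "norm (of_int (A $$ (i, j)) * x $ j) \<le> r i * (of_int (A $$ (i, j)) * v j)"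
      by (simp add: norm_mult mult.left_commute[of "r i"] mult_left_mono)
  qed
  also have "\<dots> \<le> r i * (\<mu> * v i)"
    unfolding sum_distrib_left[symmetric] using v(2)[OF i(1)] \<open>0 < r i\<close> by (intro mult_left_mono) auto
  also have "\<dots> = \<mu> * norm (x $ i)" using v(1)[OF i(1)] by (simp add: r_def)
  finally have "norm z * norm (x $ i) \<le> \<mu> * norm (x $ i)" .
  moreover have "0 < norm (x $ i)" using \<open>0 < r i\<close> v(1)[OF i(1)] by (simp add: r_def zero_less_divide_iff)
  ultimately show ?thesis using z(2) by simp
qed

text \<open>The digraph of this matrix has three cycles, of lengths \<open>g + 1\<close>, \<open>g\<close> and \<open>g - 1\<close>; only the first and
  the last are disjoint.\<close>

definition lt_coeff :: "nat \<Rightarrow> nat \<Rightarrow> nat \<Rightarrow> int" where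
  "lt_coeff g i j = (if i = g \<and> j = 0 \<or> i = Suc g \<and> j = 2 \<or> i = 2 * g - 1 \<and> j = Suc g then 1 else 0)"

abbreviation "lt_mat g \<equiv> hess_mat (lt_coeff g) (2 * g)"

lemma hess_poly_lt_1: "k \<le> g \<Longrightarrow> 2 \<le> g \<Longrightarrow> hess_poly (lt_coeff g) k = monom 1 k"
proof (induction k)
  case (Suc k)
  then have "lt_coeff g k j = 0" if "j \<le> k" for j using that by (auto simp: lt_coeff_def)
  then show ?case using Suc by (simp add: hess_poly.simps(2) mult_monom)
qed (simp add: one_pCons monom_0)

lemma hess_poly_lt_2: "hess_poly (lt_coeff g) (Suc g) = monom 1 (Suc g) - 1" if g: "2 \<le> g"
proof -
  have "(\<Sum>j\<le>g. [:lt_coeff g g j:] * hess_poly (lt_coeff g) j) = (\<Sum>j\<le>g. if j = 0 then 1 else 0)"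
    using g by (intro sum.cong refl) (auto simp: lt_coeff_def one_pCons)
  then show ?thesis using g by (simp add: hess_poly.simps(2) hess_poly_lt_1 mult_monom)
qed

lemma hess_poly_lt_3:
  "hess_poly (lt_coeff g) (g + 2 + k) = monom 1 (g + 2 + k) - monom 1 (1 + k) - monom 1 (2 + k)"
  if g: "3 \<le> g" and k: "g + 2 + k < 2 * g"
  using k
proof (induction k)
  case 0
  have "(\<Sum>j\<le>Suc g. [:lt_coeff g (Suc g) j:] * hess_poly (lt_coeff g) j) = (\<Sum>j\<le>Suc g. if j = 2 then monom 1 2 else 0)"
    using g 0 by (intro sum.cong refl) (auto simp: lt_coeff_def one_pCons hess_poly_lt_1)
  then have "hess_poly (lt_coeff g) (Suc (Suc g)) = monom 1 1 * (monom 1 (Suc g) - 1) - monom 1 2"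
    unfolding hess_poly.simps(2)[of _ "Suc g"] using g by (simp add: hess_poly_lt_2)
  then show ?case by (simp add: mult_monom right_diff_distrib numeral_2_eq_2)
next
  case (Suc k)
  have "(\<Sum>j\<le>g + 2 + k. [:lt_coeff g (g + 2 + k) j:] * hess_poly (lt_coeff g) j) = 0"
    using g Suc.prems by (intro sum.neutral ballI) (auto simp: lt_coeff_def)
  then show ?case using Suc by (simp add: hess_poly.simps(2) mult_monom right_diff_distrib)
qed

text \<open>This is a Lanneau-Thiffeault polynomial, known from pseudo-Anosov maps of small
  dilatation. Its last term comes from the one disjoint pair, of total length
  \<open>2 * g\<close>.\<close>

lemma char_poly_lt_mat:
  assumes g: "2 \<le> g"
  shows "char_poly (lt_mat g) = monom 1 (2 * g) - monom 1 (g + 1) - monom 1 g - monom 1 (g - 1) + 1"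
proof (cases "g = 2")
  \<comment> \<open>For \<open>g = 2\<close> the rows \<open>Suc g\<close> and
    \<open>2 * g - 1\<close> coincide, so two back arcs leave the same vertex and the general
    recursion does not apply.\<close>
  case True
  have "(\<Sum>j\<le>3. [:lt_coeff 2 3 j:] * hess_poly (lt_coeff 2) j) = hess_poly (lt_coeff 2) 2 + hess_poly (lt_coeff 2) 3"
    by (simp add: lt_coeff_def eval_nat_numeral one_pCons[symmetric])
  then have "hess_poly (lt_coeff 2) (Suc 3) = monom 1 1 * (monom 1 3 - 1) - (monom 1 2 + (monom 1 3 - 1))"
    using hess_poly_lt_2[of 2] hess_poly_lt_1[of 2 2] by (simp add: hess_poly.simps(2) eval_nat_numeral)
  then have "hess_poly (lt_coeff 2) 4 = monom 1 4 - monom 1 3 - monom 1 2 - monom 1 1 + 1"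
    by (simp add: mult_monom algebra_simps)
  then show ?thesis unfolding True using char_poly_hess_mat[of 4 "lt_coeff 2"] by simp
next
  case False
  then have g3: "3 \<le> g" using g by simp
  define m where "m = 2 * g - 1"
  have m: "2 * g = Suc m" "Suc g < m" using g3 by (auto simp: m_def)
  have "(\<Sum>j\<le>m. [:lt_coeff g m j:] * hess_poly (lt_coeff g) j) = (\<Sum>j\<le>m. if j = Suc g then hess_poly (lt_coeff g) (Suc g) else 0)"
    using m by (intro sum.cong refl) (auto simp: lt_coeff_def one_pCons m_def)
  also have "\<dots> = monom 1 (Suc g) - 1" using m g by (simp add: hess_poly_lt_2)
  finally have "hess_poly (lt_coeff g) (Suc m) = monom 1 1 * hess_poly (lt_coeff g) m - (monom 1 (Suc g) - 1)"
    unfolding hess_poly.simps(2) by simp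
  moreover have "hess_poly (lt_coeff g) m = monom 1 m - monom 1 (g - 2) - monom 1 (g - 1)"
  proof -
    have "g + 2 + (g - 3) = m" "1 + (g - 3) = g - 2" "2 + (g - 3) = g - 1" using g3 by (auto simp: m_def)
    then show ?thesis using hess_poly_lt_3[OF g3, of "g - 3"] m by simp
  qed
  ultimately have "hess_poly (lt_coeff g) (2 * g) = monom 1 1 * (monom 1 m - monom 1 (g - 2) - monom 1 (g - 1)) - (monom 1 (Suc g) - 1)"
    unfolding m(1) by simp
  also have "\<dots> = monom 1 (2 * g) - monom 1 (g - 1) - monom 1 g - monom 1 (Suc g) + 1"
  proof -
    have "Suc m = 2 * g" "Suc (g - 2) = g - 1" "Suc (g - 1) = g" using g3 m by auto
    then show ?thesis by (simp add: mult_monom right_diff_distrib)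
  qed
  finally show ?thesis using g by (subst char_poly_hess_mat) (auto simp: algebra_simps)
qed

text \<open>Vertex \<open>g\<close> lies on the cycles of lengths \<open>g + 1\<close> and
  \<open>g\<close>, which are consecutive and hence coprime.\<close>

lemma lt_mat_primitive:
  assumes g: "2 \<le> g"
  shows "primitive_mat (lt_mat g)"
proof (rule primitive_criterion[OF hess_mat_carrier, of _ _ g "Suc g" g])
  show nn: "nonneg_mat (lt_mat g)" by (rule nonneg_hess_mat) (simp add: lt_coeff_def)
  note P = hess_mat_carrier[of "lt_coeff g" "2 * g"]
  have b0: "0 < (lt_mat g ^\<^sub>m (Suc l)) $$ (g, l)" if "l < 2 * g" for l
    using hess_back[OF nn, of 0 g l] that by (simp add: lt_coeff_def)
  have f: "0 < (lt_mat g ^\<^sub>m 1) $$ (g, Suc g)"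
    using hess_forward[OF nn, of g "Suc g"] g by simp
  have b1: "0 < (lt_mat g ^\<^sub>m (g - 1)) $$ (Suc g, g)"
  proof -
    have "0 < (lt_mat g ^\<^sub>m (Suc (g - 2))) $$ (Suc g, g)"
      using hess_back[OF nn, of 2 "Suc g" g] g by (simp del: pow_mat.simps add: lt_coeff_def)
    moreover have "Suc (g - 2) = g - 1" using g by simp
    ultimately show ?thesis by (simp only:)
  qed
  show "0 < (lt_mat g ^\<^sub>m Suc g) $$ (g, g)" using b0[of g] g by simp
  show "0 < (lt_mat g ^\<^sub>m g) $$ (g, g)"
    using pow_pos_trans[OF P nn, of g "Suc g" g 1 "g - 1"] f b1 g by simp
  show "coprime (Suc g) g" by simp
  show "\<exists>k. 0 < (lt_mat g ^\<^sub>m k) $$ (g, l)" if "l < 2 * g" for l using b0[OF that] by blast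
  show "\<exists>k. 0 < (lt_mat g ^\<^sub>m k) $$ (l, g)" if l: "l < 2 * g" for l
  proof (cases "l \<le> g")
    case True
    then show ?thesis using hess_forward[OF nn True] g by auto
  next
    case False
    have "0 < (lt_mat g ^\<^sub>m (2 * g - 1 - l)) $$ (l, 2 * g - 1)"
      using l by (intro hess_forward[OF nn]) auto
    moreover have "0 < (lt_mat g ^\<^sub>m (Suc 0)) $$ (2 * g - 1, Suc g)"
      using hess_back[OF nn, of "Suc g" "2 * g - 1" "Suc g"] g by (simp add: lt_coeff_def)
    ultimately have *: "0 < (lt_mat g ^\<^sub>m (2 * g - 1 - l + Suc 0)) $$ (l, Suc g)"
      by (rule pow_pos_trans[OF P nn l, rotated 2]) (use l g in simp_all)
    have "0 < (lt_mat g ^\<^sub>m (2 * g - 1 - l + Suc 0 + (g - 1))) $$ (l, g)"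
      by (rule pow_pos_trans[OF P nn l _ _ * b1]) (use g in simp_all)
    then show ?thesis by blast
  qed
qed (use g in auto)

section \<open>Existence of the minima and comparison\<close>

lemma rec_radii_memI:
  assumes A: "A \<in> carrier_mat n n" "primitive_mat A" and n: "0 < n" and q: "char_poly A = q" "poly q 0 = 1"
    and inv: "\<And>x::complex. x \<noteq> 0 \<Longrightarrow> x ^ n * poly (map_poly of_int q) (1 / x) = poly (map_poly of_int q) x"
    and sgn: "poly (map_poly of_int q) (1::real) < 0" "0 \<le> poly (map_poly of_int q) T" and T: "1 < (T::real)"
  shows "spectral_radius (complex_mat A) \<in> rec_radii n"
proof -
  have cq: "char_poly (complex_mat A) = map_poly of_int q" using complex_char_poly_int[OF A(1)] q by simp
  have rq: "real_char_poly A = map_poly of_int q" using real_char_poly_int[OF A(1)] q by simp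
  have GL: "A \<in> GL_int n" using GL_int_char_poly[OF A(1)] q by simp
  have nz: "poly (char_poly (complex_mat A)) 0 \<noteq> 0"
  proof -
    have "poly (map_poly of_int q) (of_int 0) = complex_of_int (poly q 0)" by (rule of_int_hom.poly_map_poly)
    then show ?thesis unfolding cq using q by simp
  qed
  have iv: "x ^ n * poly (char_poly (complex_mat A)) (1 / x) = 1 * poly (char_poly (complex_mat A)) x" if "x \<noteq> 0" for x
    using inv[OF that] unfolding cq by simp
  have "reciprocal_mat (complex_mat A)"
    using eigenvalue_mset_invariantI[where s = 1, OF A(1) _ _ nz iv] A(1) by (auto simp: reciprocal_mat_def)
  moreover have "1 < spectral_radius (complex_mat A)"
    by (rule spectral_radius_gt_1I[OF A(1) T]) (use sgn rq in simp_all)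
  ultimately show ?thesis unfolding rec_radii_def using GL A by blast
qed

lemma lt_poly:
  fixes x :: "'a::field_char_0"
  assumes "2 \<le> g"
  shows "poly (map_poly of_int (char_poly (lt_mat g))) x = x ^ (2 * g) - x ^ (g + 1) - x ^ g - x ^ (g - 1) + 1"
proof -
  have "map_poly of_int (char_poly (lt_mat g)) =
    (monom 1 (2 * g) - monom 1 (g + 1) - monom 1 g - monom 1 (g - 1) + 1 :: 'a poly)"
    unfolding char_poly_lt_mat[OF assms] by (rule poly_eqI) (simp add: coeff_map_poly)
  then show ?thesis by (simp add: poly_monom)
qed

lemma lt_mat_rec_radii:
  assumes g: "2 \<le> g"
  shows "spectral_radius (complex_mat (lt_mat g)) \<in> rec_radii (2 * g)"
proof (rule rec_radii_memI[OF hess_mat_carrier lt_mat_primitive[OF g] _ refl])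
  show "poly (char_poly (lt_mat g)) 0 = 1"
    unfolding char_poly_lt_mat[OF g] using g by (simp add: poly_monom zero_power)
  show "x ^ (2 * g) * poly (map_poly of_int (char_poly (lt_mat g))) (1 / x) = poly (map_poly of_int (char_poly (lt_mat g))) x"
    if x: "x \<noteq> 0" for x :: complex
  proof -
    have *: "x ^ (2 * g) * (1 / x) ^ k = x ^ (2 * g - k)" if "k \<le> 2 * g" for k
      using that x by (simp add: power_diff power_divide)
    have e: "2 * g - (g + 1) = g - 1" "2 * g - g = g" "2 * g - (g - 1) = g + 1" using g by auto
    have "x ^ (2 * g) * poly (map_poly of_int (char_poly (lt_mat g))) (1 / x) =
      x ^ (2 * g) * (1 / x) ^ (2 * g) - x ^ (2 * g) * (1 / x) ^ (g + 1) - x ^ (2 * g) * (1 / x) ^ g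
        - x ^ (2 * g) * (1 / x) ^ (g - 1) + x ^ (2 * g)"
      unfolding lt_poly[OF g] by (simp only: right_diff_distrib distrib_left mult_1_right)
    also have "\<dots> = 1 - x ^ (g - 1) - x ^ g - x ^ (g + 1) + x ^ (2 * g)"
      using g by (subst (1 2 3 4) *) (simp_all add: e)
    finally show ?thesis unfolding lt_poly[OF g] by simp
  qed
  show "poly (map_poly of_int (char_poly (lt_mat g))) (1::real) < 0"
    unfolding lt_poly[OF g] by simp
  have "2 * g = (g - 1) + (g + 1)" using g by simp
  then have "(2::real) ^ (2 * g) = 2 ^ (g - 1) * 2 ^ (g + 1)" by (simp only: power_add)
  moreover have "(2::real) ^ (g - 1) * 2 ^ 3 \<le> 2 ^ (g - 1) * 2 ^ (g + 1)"
    using g by (intro mult_left_mono power_increasing) auto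
  moreover have "(2::real) ^ g = 2 * 2 ^ (g - 1)" "(2::real) ^ (g + 1) = 4 * 2 ^ (g - 1)"
    using g by (cases g; simp)+
  ultimately show "0 \<le> poly (map_poly of_int (char_poly (lt_mat g))) (2::real)"
    unfolding lt_poly[OF g] by simp
qed (use g in simp_all)

definition cat_coeff :: "nat \<Rightarrow> nat \<Rightarrow> int" where
  "cat_coeff i j = (if i = 0 then 2 else 1)"

lemma cat_mat_rec_radii: "spectral_radius (complex_mat (hess_mat cat_coeff 2)) \<in> rec_radii 2"
proof (rule rec_radii_memI[OF hess_mat_carrier])
  show "primitive_mat (hess_mat cat_coeff 2)"
    unfolding primitive_mat_def
  proof (intro conjI exI[of _ 1])
    have e: "0 < hess_mat cat_coeff 2 $$ (i, j)" if "i < 2" "j < 2" for i j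
      using that by (auto simp: hess_mat_def cat_coeff_def less_2_cases_iff)
    show "nonneg_mat (hess_mat cat_coeff 2)" using e by (auto simp: nonneg_mat_def less_imp_le)
    show "pos_mat (hess_mat cat_coeff 2 ^\<^sub>m 1)" using e by (auto simp: pos_mat_def)
  qed auto
  show q: "char_poly (hess_mat cat_coeff 2) = [:1, - 3, 1:]"
    by (subst char_poly_hess_mat) (simp_all add: numeral_2_eq_2 hess_poly.simps(2) cat_coeff_def monom_altdef one_pCons)
  show "x ^ 2 * poly (map_poly of_int [:1, - 3, 1:]) (1 / x) = poly (map_poly of_int [:1, - 3, 1:]) x"
    if "x \<noteq> 0" for x :: complex
    using that by (simp add: field_simps power2_eq_square)
  show "0 \<le> poly (map_poly of_int [:1, - 3, 1:]) (3::real)" by simp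
qed simp_all

lemma rec_radii_nonempty: "rec_radii (2 * g) \<noteq> {}" if "1 \<le> g"
proof (cases "g = 1")
  case True
  then show ?thesis using cat_mat_rec_radii by auto
next
  case False
  then show ?thesis using lt_mat_rec_radii[of g] that by auto
qed

lemma rec_radii_6: "\<exists>r\<in>rec_radii 6. r < 1.41"
proof -
  let ?A = "lt_mat 3"
  \<comment> \<open>An approximate Perron eigenvector.\<close>
  define v :: "nat \<Rightarrow> real" where "v i = [100, 140, 196, 275, 286, 205] ! i" for i
  have v: "v 0 = 100" "v 1 = 140" "v 2 = 196" "v 3 = 275" "v 4 = 286" "v 5 = 205"
    by (simp_all add: v_def eval_nat_numeral)
  have nn: "nonneg_mat ?A" by (rule nonneg_hess_mat) (simp add: lt_coeff_def)
  have c: "?A \<in> carrier_mat 6 6" using hess_mat_carrier[of "lt_coeff 3" "2 * 3"] by simp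
  have sum6: "(\<Sum>j<6. f j) = f 0 + f 1 + f 2 + f 3 + f 4 + f 5" for f :: "nat \<Rightarrow> real"
    by (simp add: eval_nat_numeral)
  have "spectral_radius (complex_mat ?A) \<le> 1.405"
  proof (rule spectral_radius_le_vector[OF c nn, of v])
    fix i :: nat assume "i < 6"
    then have i: "i = 0 \<or> i = 1 \<or> i = 2 \<or> i = 3 \<or> i = 4 \<or> i = 5" by linarith
    show "0 < v i" using i v by (elim disjE) simp_all
    show "(\<Sum>j<6. of_int (?A $$ (i, j)) * v j) \<le> 1.405 * v i"
      unfolding sum6 v using i by (elim disjE) (simp_all add: hess_mat_def lt_coeff_def v del: One_nat_def)
  qed simp
  then have "spectral_radius (complex_mat ?A) < 1.41" by simp
  then show ?thesis using lt_mat_rec_radii[of 3] by auto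
qed

text \<open>The substitution of \<open>- 1 / x\<close> exchanges the two outer terms and the two
  middle ones of \<open>X^(2 g) - X^(g + k) - X^(g - k) - 1\<close>. Since \<open>g + k\<close> and
  \<open>g - k\<close> are odd, the result is the negative of the polynomial.\<close>

lemma skew_radii_witness:
  assumes k: "0 < k" "k < g" "odd (g + k)" and T: "1 < T" "1 + T ^ (g - k) + T ^ (g + k) \<le> T ^ (2 * g)"
    and cop: "coprime (g + k) (g - k)"
  shows "\<exists>r\<in>skew_radii (2 * g). r \<le> T \<and> (1 + T ^ (g - k) + T ^ (g + k) < T ^ (2 * g) \<longrightarrow> r < T)"
proof -
  let ?J = "{0, g - k, g + k}"
  have S: "(\<Sum>j\<in>?J. f j) = f 0 + f (g - k) + f (g + k)" for f :: "nat \<Rightarrow> 'a::comm_monoid_add"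
    using k by (simp add: add.assoc)
  have card: "2 \<le> card ?J" using k by simp
  have d: "2 * g - (g - k) = g + k" "2 * g - (g + k) = g - k" using k by auto
  have odd': "odd (g - k)" using k by simp
  have "\<exists>r\<in>skew_radii (2 * g). r \<le> T \<and> ((\<Sum>j\<in>?J. T ^ j) < T ^ (2 * g) \<longrightarrow> r < T)"
  proof (rule companion_mat_skew_radius[where c = "- 1" and i = "g - k" and j = "g + k"])
    show "x ^ (2 * g) * ((- 1 / x) ^ (2 * g) - (\<Sum>j\<in>?J. (- 1 / x) ^ j)) = - 1 * (x ^ (2 * g) - (\<Sum>j\<in>?J. x ^ j))"
      if x: "x \<noteq> 0" for x :: complex
    proof -
      have m: "x ^ (2 * g) * (1 / x) ^ l = x ^ (2 * g - l)" if "l \<le> 2 * g" for l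
        using that x by (simp add: power_diff power_divide)
      have p: "(- 1 / x) ^ (2 * g) = (1 / x) ^ (2 * g)" "(- 1 / x) ^ (g - k) = - ((1 / x) ^ (g - k))"
        "(- 1 / x) ^ (g + k) = - ((1 / x) ^ (g + k))"
        using odd' k(3) by (simp_all add: power_minus_odd power_minus_even)
      have "x ^ (2 * g) * ((1 / x) ^ (2 * g) - (1 - (1 / x) ^ (g - k) - (1 / x) ^ (g + k))) =
        x ^ (2 * g) * (1 / x) ^ (2 * g) - x ^ (2 * g) + x ^ (2 * g) * (1 / x) ^ (g - k) + x ^ (2 * g) * (1 / x) ^ (g + k)"
        by (simp only: right_diff_distrib mult_1_right) simp
      also have "\<dots> = 1 - x ^ (2 * g) + x ^ (g + k) + x ^ (g - k)"
        using k by (subst (1 2 3) m) (simp_all add: d)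
      finally show ?thesis unfolding S p by simp
    qed
    show "coprime (2 * g - (g - k)) (2 * g - (g + k))" unfolding d by (rule cop)
    show "(\<Sum>j\<in>?J. T ^ j) \<le> T ^ (2 * g)" unfolding S using T by simp
  qed (use k card T in auto)
  then show ?thesis unfolding S by simp
qed

text \<open>The polynomial is \<open>X^2 - X - 1\<close>. The crude bound 2 suffices because the
  reciprocal threshold for \<open>g = 1\<close> is \<open>(3 + sqrt 5) / 2 > 2\<close>.\<close>

lemma skew_radii_2: "\<exists>r\<in>skew_radii 2. r \<le> 2"
proof -
  have "\<exists>r\<in>skew_radii 2. r \<le> 2 \<and> ((\<Sum>j\<in>{0, 1}. 2 ^ j) < (2::real) ^ 2 \<longrightarrow> r < 2)"
  proof (rule companion_mat_skew_radius[where c = "- 1" and i = 0 and j = 1])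
    show "x ^ 2 * ((- 1 / x) ^ 2 - (\<Sum>j\<in>{0, 1}. (- 1 / x) ^ j)) = - 1 * (x ^ 2 - (\<Sum>j\<in>{0, 1}. x ^ j))"
      if "x \<noteq> 0" for x :: complex
      using that by (simp add: field_simps power2_eq_square)
  qed auto
  then show ?thesis by blast
qed

lemma coprime_add_diff:
  fixes g k :: nat
  assumes "odd (g + k)" "k < g" "k = 1 \<or> k = 2"
  shows "coprime (g + k) (g - k)"
proof (rule coprimeI)
  fix c assume c: "c dvd g + k" "c dvd g - k"
  then have "c dvd (g + k) - (g - k)" by (rule dvd_diff_nat)
  also have "(g + k) - (g - k) = 2 * k" using assms(2) by simp
  also have "\<dots> dvd 2 ^ 2" using assms(3) by auto
  finally have "c dvd 2 ^ 2" .
  then obtain i where i: "c = 2 ^ i" using divides_primepow_nat[OF two_is_prime_nat] by blast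
  have "odd c" using c(1) assms(1) dvd_trans by blast
  then show "is_unit c" using i by (cases i) auto
qed

lemma skew_radii_nonempty: "skew_radii (2 * g) \<noteq> {}" if g: "1 \<le> g"
proof (cases "g = 1")
  case True
  then show ?thesis using skew_radii_2 by auto
next
  case False
  define k :: nat where "k = (if even g then 1 else 2)"
  have k: "0 < k" "k < g" "odd (g + k)" "k = 1 \<or> k = 2"
    using False g by (auto simp: k_def elim: oddE)
  \<comment> \<open>At \<open>T = 3\<close> each of the three lower terms is at most a third of
    \<open>T ^ (2 * g)\<close>. Only \<open>k < g\<close> is needed, so \<open>g = 3\<close> with
    \<open>k = 2\<close> is included.\<close>
  have "(3::real) ^ (g - k) \<le> 3 ^ (2 * g - 1)" "(3::real) ^ (g + k) \<le> 3 ^ (2 * g - 1)" "1 \<le> (3::real) ^ (2 * g - 1)"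
    using k by (auto intro!: power_increasing)
  moreover have "(3::real) ^ (2 * g) = 3 * 3 ^ (2 * g - 1)"
    using g by (simp flip: power_Suc)
  ultimately have "1 + (3::real) ^ (g - k) + 3 ^ (g + k) \<le> 3 ^ (2 * g)" by linarith
  then show ?thesis
    using skew_radii_witness[OF k(1-3), of 3] coprime_add_diff[OF k(3,2,4)] by auto
qed

text \<open>With \<open>x = T ^ k\<close> and the golden ratio \<open>\<phi>\<close>, the value at \<open>T\<close> of the polynomial
  \<open>X ^ (2 * g) - X ^ (g + k) - X ^ (g - k) - 1\<close> is a positive multiple of
  \<open>sqrt 5 * x - 1 - x\<^sup>2 = (\<phi> - x) (x - 1/\<phi>)\<close>, and \<open>x \<le> \<phi>\<close> amounts to \<open>2 * k \<le> g\<close>.\<close>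

lemma skew_radii_small:
  assumes k: "0 < k" "k < g" "odd (g + k)" "k = 1 \<or> k = 2" "2 * k \<le> g"
    and T: "0 < T" "T ^ g = (3 + sqrt 5) / 2"
  shows "\<exists>r\<in>skew_radii (2 * g). r \<le> T \<and> (2 * k < g \<longrightarrow> r < T)"
proof -
  obtain s where s_def: "s = sqrt 5" by blast
  have s5: "1 < s" "s * s = 5" unfolding s_def by auto
  define Y \<phi> :: real where "Y = (3 + s) / 2" and "\<phi> = (1 + s) / 2"
  define x where "x = T ^ k"
  have "4 * (Y\<^sup>2 - 1) = 4 * (s * Y)" "4 * \<phi>\<^sup>2 = 4 * Y"
    using s5(2) by (simp_all add: Y_def \<phi>_def power2_eq_square algebra_simps)
  then have Y: "Y\<^sup>2 - 1 = s * Y" "\<phi>\<^sup>2 = Y" by simp_all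
  have Y1: "1 < Y" and phi: "0 < \<phi>" using s5(1) by (simp_all add: Y_def \<phi>_def)
  have TY: "T ^ g = Y" using T by (simp add: Y_def s_def)
  have T1: "1 < T"
  proof (rule ccontr)
    assume "\<not> 1 < T"
    then have "T ^ g \<le> 1" using T by (intro power_le_one) auto
    then show False using TY Y1 by simp
  qed
  have x1: "1 < x" using T1 k by (simp add: x_def one_less_power)
  have x2: "x\<^sup>2 = T ^ (2 * k)" by (simp add: x_def power_mult[symmetric] mult.commute)
  have "T ^ (2 * k) \<le> T ^ g" using T1 k by (intro power_increasing) auto
  then have "x\<^sup>2 \<le> \<phi>\<^sup>2" by (simp only: x2 Y(2) TY)
  then have xle: "x \<le> \<phi>" by (rule power2_le_imp_le) (use phi in simp)
  have xlt: "x < \<phi>" if "2 * k < g"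
  proof -
    have "T ^ (2 * k) < T ^ g" using T1 that by (intro power_strict_increasing) auto
    then have "x\<^sup>2 < \<phi>\<^sup>2" by (simp only: x2 Y(2) TY)
    then show ?thesis by (rule power2_less_imp_less) (use phi in simp)
  qed
  have fac: "s * x - 1 - x\<^sup>2 = (\<phi> - x) * (x - (s - 1) / 2)"
    using s5 by (simp add: \<phi>_def field_simps power2_eq_square)
  have "s < 3" unfolding s_def by (rule real_less_lsqrt) auto
  then have pos: "0 < x - (s - 1) / 2" using x1 by (simp add: field_simps)
  have "T ^ (g - k) * x = Y" using k by (simp add: x_def TY[symmetric] flip: power_add)
  moreover have "T ^ (2 * g) = Y * Y" "T ^ (g + k) = Y * x" by (simp_all only: mult_2 power_add TY x_def)
  ultimately have "x * (T ^ (2 * g) - (1 + T ^ (g - k) + T ^ (g + k))) = x * (Y\<^sup>2 - 1) - Y - Y * x\<^sup>2"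
    by (simp add: power2_eq_square algebra_simps)
  also have "\<dots> = Y * ((\<phi> - x) * (x - (s - 1) / 2))"
    unfolding Y(1) fac[symmetric] by (simp add: algebra_simps)
  finally have eq: "x * (T ^ (2 * g) - (1 + T ^ (g - k) + T ^ (g + k))) = Y * ((\<phi> - x) * (x - (s - 1) / 2))" .
  have "0 \<le> Y * ((\<phi> - x) * (x - (s - 1) / 2))" using Y1 pos xle by simp
  then have "0 \<le> x * (T ^ (2 * g) - (1 + T ^ (g - k) + T ^ (g + k)))" unfolding eq .
  then have le: "1 + T ^ (g - k) + T ^ (g + k) \<le> T ^ (2 * g)"
    using x1 by (simp add: zero_le_mult_iff)
  have lt: "1 + T ^ (g - k) + T ^ (g + k) < T ^ (2 * g)" if "2 * k < g"
  proof -
    have "0 < Y * ((\<phi> - x) * (x - (s - 1) / 2))" using Y1 pos xlt[OF that] by simp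
    then have "0 < x * (T ^ (2 * g) - (1 + T ^ (g - k) + T ^ (g + k)))" unfolding eq .
    then show ?thesis using x1 by (simp add: zero_less_mult_iff)
  qed
  show ?thesis
    using skew_radii_witness[OF k(1-3) T1 le coprime_add_diff[OF k(3,2,4)]] lt by blast
qed

section \<open>Discreteness of the spectral radii\<close>

lemma norm_coeff_lin_prod_le:
  fixes es :: "complex list"
  assumes "\<And>e. e \<in> set es \<Longrightarrow> norm e \<le> R" "0 \<le> R"
  shows "norm (coeff (lin_prod es) i) \<le> (1 + R) ^ length es"
  using assms(1)
proof (induction es arbitrary: i)
  case (Cons e es)
  have IH: "norm (coeff (lin_prod es) i) \<le> (1 + R) ^ length es" for i using Cons by simp
  have "lin_prod (e # es) = pCons 0 (lin_prod es) - Polynomial.smult e (lin_prod es)"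
    by simp
  then have "coeff (lin_prod (e # es)) i = (case i of 0 \<Rightarrow> 0 | Suc j \<Rightarrow> coeff (lin_prod es) j) - e * coeff (lin_prod es) i"
    by (simp add: coeff_pCons)
  then have "norm (coeff (lin_prod (e # es)) i) \<le>
      norm (case i of 0 \<Rightarrow> 0 | Suc j \<Rightarrow> coeff (lin_prod es) j) + norm e * norm (coeff (lin_prod es) i)"
    by (metis norm_mult norm_triangle_ineq4)
  also have "\<dots> \<le> (1 + R) ^ length es + R * (1 + R) ^ length es"
    using IH assms(2) Cons.prems[of e] by (intro add_mono mult_mono) (auto split: nat.splits)
  finally show ?case by (simp add: algebra_simps)
qed simp

lemma finite_bounded_int_polys:
  "finite {p :: int poly. degree p \<le> n \<and> (\<forall>i. \<bar>coeff p i\<bar> \<le> B)}"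
proof -
  let ?L = "{xs. set xs \<subseteq> {-B..B} \<and> length xs = Suc n}"
  have "p \<in> Poly ` ?L" if "degree p \<le> n" "\<forall>i. \<bar>coeff p i\<bar> \<le> B" for p :: "int poly"
  proof
    show "map (coeff p) [0..<Suc n] \<in> ?L" using that(2) by (auto simp: abs_le_iff minus_le_iff simp del: upt_Suc)
    show "p = Poly (map (coeff p) [0..<Suc n])"
      by (rule poly_eqI) (use that(1) in \<open>auto simp: nth_default_def coeff_eq_0 simp del: upt_Suc\<close>)
  qed
  then have "{p :: int poly. degree p \<le> n \<and> (\<forall>i. \<bar>coeff p i\<bar> \<le> B)} \<subseteq> Poly ` ?L" by auto
  then show ?thesis by (rule finite_subset) (intro finite_imageI finite_lists_length_eq finite_atLeastAtMost_int)
qed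

text \<open>Infinitely many matrices may satisfy the bound, but the radius depends only on the
  characteristic polynomial, whose integer coefficients are bounded through the eigenvalues.\<close>

lemma finite_spectral_radii:
  assumes n: "0 < n"
  shows "finite {spectral_radius (complex_mat A) | A. A \<in> carrier_mat n n \<and> spectral_radius (complex_mat A) \<le> R}"
    (is "finite ?S")
proof -
  let ?B = "\<lceil>(1 + \<bar>R\<bar>) ^ n\<rceil>"
  let ?P = "{p :: int poly. degree p \<le> n \<and> (\<forall>i. \<bar>coeff p i\<bar> \<le> ?B)}"
  have "?S \<subseteq> (\<lambda>p. Max (norm ` {z::complex. poly (map_poly of_int p) z = 0})) ` ?P"
  proof
    fix r assume "r \<in> ?S"
    then obtain A where A: "A \<in> carrier_mat n n" "spectral_radius (complex_mat A) \<le> R" "r = spectral_radius (complex_mat A)"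
      by auto
    have cA: "complex_mat A \<in> carrier_mat n n" using A by simp
    obtain es where es: "char_poly (complex_mat A) = lin_prod es" "length es = n" using char_poly_lin_prod[OF cA] .
    have le: "norm e \<le> \<bar>R\<bar>" if "e \<in> set es" for e
    proof -
      have "poly (char_poly (complex_mat A)) e = 0"
        unfolding es(1) using that by (auto simp: poly_lin_prod prod_list_zero_iff)
      then show ?thesis using root_le_spectral_radius[OF cA] A(2) by force
    qed
    have "\<bar>coeff (char_poly A) i\<bar> \<le> ?B" for i
    proof -
      have "complex_of_int (coeff (char_poly A) i) = coeff (lin_prod es) i"
        unfolding es(1)[symmetric] complex_char_poly_int[OF A(1)] by (simp add: coeff_map_poly)
      then have "norm (complex_of_int (coeff (char_poly A) i)) \<le> (1 + \<bar>R\<bar>) ^ n"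
        using norm_coeff_lin_prod_le[of es "\<bar>R\<bar>" i] le es(2) by simp
      then have "real_of_int \<bar>coeff (char_poly A) i\<bar> \<le> (1 + \<bar>R\<bar>) ^ n" by simp
      then show ?thesis by linarith
    qed
    then have "char_poly A \<in> ?P" using degree_monic_char_poly[OF A(1)] by simp
    moreover have "r = Max (norm ` {z::complex. poly (map_poly of_int (char_poly A)) z = 0})"
      unfolding A(3) spectral_radius_def spectrum_root_char_poly[OF cA] complex_char_poly_int[OF A(1)] ..
    ultimately show "r \<in> (\<lambda>p. Max (norm ` {z::complex. poly (map_poly of_int p) z = 0})) ` ?P" by blast
  qed
  then show ?thesis by (rule finite_subset) (intro finite_imageI finite_bounded_int_polys)
qed

lemma Least_locally_finite:
  fixes S :: "real set"
  assumes "S \<noteq> {}" "\<And>R. finite {r \<in> S. r \<le> R}"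
  shows "(LEAST r. r \<in> S) \<in> S \<and> (\<forall>r\<in>S. (LEAST r. r \<in> S) \<le> r)"
proof -
  obtain s where s: "s \<in> S" using assms by auto
  let ?F = "{r \<in> S. r \<le> s}"
  have F: "finite ?F" "?F \<noteq> {}" using assms s by auto
  have m: "Min ?F \<in> S" "Min ?F \<le> s" using Min_in[OF F] by auto
  have le: "Min ?F \<le> r" if "r \<in> S" for r
    using Min_le[OF F(1), of r] m that by (cases "r \<le> s") auto
  have "(LEAST r. r \<in> S) = Min ?F" by (rule Least_equality) (use m le in auto)
  then show ?thesis using m le by simp
qed

lemma m_skew_least: "m_skew (2 * g) \<in> skew_radii (2 * g) \<and> (\<forall>r\<in>skew_radii (2 * g). m_skew (2 * g) \<le> r)" if "1 \<le> g"
proof -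
  have "finite {r \<in> skew_radii (2 * g). r \<le> R}" for R
    by (rule finite_subset[OF _ finite_spectral_radii[of "2 * g" R]])
      (use that in \<open>auto simp: skew_radii_def carrier_GL_int\<close>)
  then show ?thesis
    unfolding m_skew_def by (rule Least_locally_finite[OF skew_radii_nonempty[OF that]])
qed

lemma m_rec_least: "m_rec (2 * g) \<in> rec_radii (2 * g) \<and> (\<forall>r\<in>rec_radii (2 * g). m_rec (2 * g) \<le> r)" if "1 \<le> g"
proof -
  have "finite {r \<in> rec_radii (2 * g). r \<le> R}" for R
    by (rule finite_subset[OF _ finite_spectral_radii[of "2 * g" R]])
      (use that in \<open>auto simp: rec_radii_def carrier_GL_int\<close>)
  then show ?thesis
    unfolding m_rec_def by (rule Least_locally_finite[OF rec_radii_nonempty[OF that]])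
qed

section \<open>Comparison of the two minima\<close>

lemma m_skew_less_m_rec:
  assumes g: "1 \<le> g" "g \<noteq> 3"
  shows "m_skew (2 * g) < m_rec (2 * g)"
proof -
  define T where "T = root g ((3 + sqrt 5) / 2)"
  have s5: "2 < sqrt 5" by (rule real_less_rsqrt) simp
  have Tg: "T ^ g = (3 + sqrt 5) / 2" unfolding T_def using g s5 by (intro real_root_pow_pos2) auto
  have T0: "0 < T" unfolding T_def using g s5 by (intro real_root_gt_zero) auto
  have t: "0 < 1 / T" "(1 / T) ^ g = (3 - sqrt 5) / 2"
    using T0 s5 by (auto simp: power_one_over Tg field_simps)
  note rec = m_rec_least[OF g(1)] and skew = m_skew_least[OF g(1)]
  obtain A where A: "A \<in> GL_int (2 * g)" "primitive_mat A" "reciprocal_mat (complex_mat A)"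
      "1 < spectral_radius (complex_mat A)" "m_rec (2 * g) = spectral_radius (complex_mat A)"
    using rec unfolding rec_radii_def by auto
  have ge: "T \<le> m_rec (2 * g)"
    unfolding A(5) using reciprocal_spectral_radius_ge[OF carrier_GL_int[OF A(1)] A(2,3) _ A(4) t] g by simp
  consider "g = 1" | "g = 2" | "4 \<le> g" using g by linarith
  then show ?thesis
  proof cases
    case 1
    then have "2 < T" using Tg s5 by simp
    moreover obtain r where "r \<in> skew_radii (2 * g)" "r \<le> 2" using skew_radii_2 1 by auto
    ultimately show ?thesis using skew ge by fastforce
  next
    case 2
    have "T < m_rec (2 * g)"
      unfolding A(5) using reciprocal_spectral_radius_4[of A "1 / T"] carrier_GL_int[OF A(1)] A t 2 by simp
    moreover obtain r where "r \<in> skew_radii (2 * g)" "r \<le> T"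
      using skew_radii_small[of 1 g T] T0 Tg 2 by auto
    ultimately show ?thesis using skew by fastforce
  next
    case 3
    define k :: nat where "k = (if even g then 1 else 2)"
    \<comment> \<open>An odd \<open>g\<close> is then at least 5, which gives the strict inequality
      \<open>2 * k < g\<close> for \<open>k = 2\<close>.\<close>
    have "4 < g" if "odd g" using 3 that by (cases "g = 4") auto
    then have k: "0 < k" "k < g" "odd (g + k)" "k = 1 \<or> k = 2" "2 * k \<le> g" "2 * k < g"
      using 3 by (auto simp: k_def)
    then obtain r where "r \<in> skew_radii (2 * g)" "r < T"
      using skew_radii_small[OF k(1-5) T0 Tg] by auto
    then show ?thesis using skew ge by fastforce
  qed
qed

lemma m_rec_less_m_skew_6: "m_rec 6 < m_skew 6"
proof -
  obtain r where r: "r \<in> rec_radii 6" "r < 1.41" using rec_radii_6 by auto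
  obtain A where A: "A \<in> GL_int 6" "primitive_mat A" "skew_reciprocal_mat (complex_mat A)"
      "m_skew 6 = spectral_radius (complex_mat A)"
    using m_skew_least[of 3] unfolding skew_radii_def by auto
  have "m_rec 6 \<le> r" using m_rec_least[of 3] r by simp
  also have "r < 1.41" by (rule r(2))
  also have "\<dots> \<le> m_skew 6"
    unfolding A(4) by (rule skew_spectral_radius_6[OF carrier_GL_int[OF A(1)] A(2,3)])
  finally show ?thesis .
qed

theorem theorem1:
  fixes g :: nat
  assumes "g \<ge> 1"
  shows "m_skew (2 * g) \<in> skew_radii (2 * g) \<and> (\<forall>r \<in> skew_radii (2 * g). m_skew (2 * g) \<le> r) \<and>
         m_rec (2 * g) \<in> rec_radii (2 * g) \<and> (\<forall>r \<in> rec_radii (2 * g). m_rec (2 * g) \<le> r) \<and>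
         (g \<noteq> 3 \<longrightarrow> m_skew (2 * g) < m_rec (2 * g)) \<and>
         (g = 3 \<longrightarrow> m_rec 6 < m_skew 6)"
  using m_skew_least[OF assms] m_rec_least[OF assms] m_skew_less_m_rec[OF assms] m_rec_less_m_skew_6
  by blast

end
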